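(* Let $d\ge 1$, $H\in(0,1)$, let $k=(k_1,\dots,k_d)\in\mathbb{N}^d$ (with $0\in\mathbb{N}$) and $|k|=k_1+\cdots+k_d$. Let $B^H$ and $\hat B^H$ be two independent $d$-dimensional fractional Brownian motions with the same Hurst parameter $H$, and for $\epsilon>0$ let $$\alpha_\epsilon^{(k)}=\int_0^1\int_0^1 \delta_\epsilon^{(k)}(B^H_s-\hat B^H_r)\,dr\,ds .$$ Suppose that $2|k|H+Hd<2$. Then $\alpha_\epsilon^{(k)}$ converges in $L^n(\Omega)$ as $\epsilon\to 0$ for all $n\ge 1$.
   Context: A $d$-dimensional fractional Brownian motion $B^H=(B^{H,1},\dots,B^{H,d})$ with Hurst parameter $H\in(0,1)$ is an a.s. continuous centered Gaussian process whose components are independent copies of a one-dimensional fractional Brownian motion with covariance $\mathbb{E}[B^{H,j}_tB^{H,j}_s]=\tfrac12(t^{2H}+s^{2H}-|t-s|^{2H})$. For $\epsilon>0$ and $x\in\mathbb{R}^d$, $\delta_\epsilon(x)=(2\pi\epsilon)^{-d/2}e^{-|x|^2/(2\epsilon)}$, and $\delta_\epsilon^{(k)}=\partial_{x_1}^{k_1}\cdots\partial_{x_d}^{k_d}\delta_\epsilon$, equivalently $\delta^{(k)}_\epsilon(x)=\frac{i^{|k|}}{(2\pi)^d}\int_{\mathbb{R}^d}\prod_{j=1}^d p_j^{k_j}\,e^{i\langle p,x\rangle}e^{-\epsilon|p|^2/2}\,dp$. *)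

theory Defs
  imports "HOL-Probability.Probability"
begin

text \<open>Dirac masses count as (degenerate) Gaussian laws.\<close>

definition gaussian_rv :: "'a measure \<Rightarrow> ('a \<Rightarrow> real) \<Rightarrow> bool" where
  "gaussian_rv M X \<longleftrightarrow>
     X \<in> borel_measurable M \<and>
     ((\<exists>\<mu> \<sigma>. \<sigma> > 0 \<and> distributed M lborel X (normal_density \<mu> \<sigma>)) \<or>
      (\<exists>\<mu>. AE \<omega> in M. X \<omega> = \<mu>))"

definition gaussian_process ::
    "'a measure \<Rightarrow> 'i set \<Rightarrow> ('i \<Rightarrow> 'a \<Rightarrow> 'b::euclidean_space) \<Rightarrow> bool" where
  "gaussian_process M T X \<longleftrightarrow>
     (\<forall>F c. finite F \<and> F \<subseteq> T \<longrightarrow> gaussian_rv M (\<lambda>\<omega>. \<Sum>t\<in>F. c t \<bullet> X t \<omega>))"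

text \<open>Time runs through \<open>{0..}\<close>; the values of \<open>B\<close> at negative times are irrelevant.
  Note \<open>0 powr (2 * H) = 0\<close>, as needed in the covariance.\<close>

definition fractional_brownian_motion ::
    "'a measure \<Rightarrow> real \<Rightarrow> (real \<Rightarrow> 'a \<Rightarrow> real ^ 'n) \<Rightarrow> bool" where
  "fractional_brownian_motion M H B \<longleftrightarrow>
     gaussian_process M {0..} B \<and>
     (\<forall>t\<ge>0. (\<integral>\<omega>. B t \<omega> \<partial>M) = 0) \<and>
     (AE \<omega> in M. continuous_on {0..} (\<lambda>t. B t \<omega>)) \<and>
     prob_space.indep_vars M (\<lambda>j. \<Pi>\<^sub>M t\<in>{0..}. borel)
       (\<lambda>j \<omega>. \<lambda>t\<in>{0..}. B t \<omega> $ j) UNIV \<and>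
     (\<forall>j. \<forall>t\<ge>0. \<forall>s\<ge>0.
        (\<integral>\<omega>. B t \<omega> $ j * B s \<omega> $ j \<partial>M) =
          (t powr (2 * H) + s powr (2 * H) - \<bar>t - s\<bar> powr (2 * H)) / 2)"

definition indep_processes ::
    "'a measure \<Rightarrow> (real \<Rightarrow> 'a \<Rightarrow> real ^ 'n) \<Rightarrow> (real \<Rightarrow> 'a \<Rightarrow> real ^ 'n) \<Rightarrow> bool" where
  "indep_processes M X Y \<longleftrightarrow>
     prob_space.indep_var M
       (\<Pi>\<^sub>M t\<in>{0..}. borel) (\<lambda>\<omega>. \<lambda>t\<in>{0..}. X t \<omega>)
       (\<Pi>\<^sub>M t\<in>{0..}. borel) (\<lambda>\<omega>. \<lambda>t\<in>{0..}. Y t \<omega>)"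

definition heat_kernel :: "real \<Rightarrow> real ^ 'n \<Rightarrow> real" where
  "heat_kernel \<epsilon> x =
     (2 * pi * \<epsilon>) powr (- real CARD('n) / 2) * exp (- (norm x)\<^sup>2 / (2 * \<epsilon>))"

definition partial_deriv :: "'n \<Rightarrow> (real ^ 'n \<Rightarrow> real) \<Rightarrow> real ^ 'n \<Rightarrow> real" where
  "partial_deriv j f x = deriv (\<lambda>t. f (x + t *\<^sub>R axis j 1)) 0"

text \<open>The linear order on the index type plays the role of the order of \<open>{1, \<dots>, d}\<close>: with
  \<open>j\<^sub>1 < \<dots> < j\<^sub>d\<close> the elements of \<open>'n\<close>, this is the composition of the \<open>k $ j\<^sub>i\<close>-fold
  \<open>j\<^sub>i\<close>-th partial derivatives, those in direction \<open>j\<^sub>d\<close> being applied first.\<close>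

definition multi_partial_deriv ::
    "nat ^ 'n::{finite,linorder} \<Rightarrow> (real ^ 'n::{finite,linorder} \<Rightarrow> real) \<Rightarrow>
      real ^ 'n::{finite,linorder} \<Rightarrow> real" where
  "multi_partial_deriv k f =
     foldr (\<lambda>j. partial_deriv j ^^ (k $ j)) (sorted_list_of_set UNIV) f"

definition approx_intersection_deriv ::
    "nat ^ 'n::{finite,linorder} \<Rightarrow>
      (real \<Rightarrow> 'a \<Rightarrow> real ^ 'n::{finite,linorder}) \<Rightarrow>
      (real \<Rightarrow> 'a \<Rightarrow> real ^ 'n::{finite,linorder}) \<Rightarrow>
      real \<Rightarrow> 'a \<Rightarrow> real" where
  "approx_intersection_deriv k B B' \<epsilon> \<omega> =
     (LINT s:{0..1}|lborel. LINT r:{0..1}|lborel.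
        multi_partial_deriv k (heat_kernel \<epsilon>) (B s \<omega> - B' r \<omega>))"

text \<open>Paths are continuous only almost surely and the probability space need not be complete, so
  \<open>approx_intersection_deriv k B B' \<epsilon>\<close> need not be measurable on \<open>M\<close> itself (and a
  Bochner integral of a non-measurable function is \<open>0\<close>); it is a random variable on
  \<open>completion M\<close>, where the notions below are to be applied.\<close>

definition in_Lp :: "'a measure \<Rightarrow> real \<Rightarrow> ('a \<Rightarrow> real) \<Rightarrow> bool" where
  "in_Lp M p f \<longleftrightarrow> f \<in> borel_measurable M \<and> integrable M (\<lambda>\<omega>. \<bar>f \<omega>\<bar> powr p)"

definition converges_in_Lp ::
    "'a measure \<Rightarrow> real \<Rightarrow> ('i \<Rightarrow> 'a \<Rightarrow> real) \<Rightarrow> 'i filter \<Rightarrow> bool" where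
  "converges_in_Lp M p f F \<longleftrightarrow>
     (\<forall>\<^sub>F i in F. in_Lp M p (f i)) \<and>
     (\<exists>X. in_Lp M p X \<and> ((\<lambda>i. \<integral>\<omega>. \<bar>f i \<omega> - X \<omega>\<bar> powr p \<partial>M) \<longlongrightarrow> 0) F)"

end

theory Submission
  imports Defs
begin

text \<open>
  By Fourier inversion the approximation is \<open>\<alpha>\<^sub>\<epsilon> = \<integral> w\<^sub>\<epsilon>(p) Z(p) Z'(p) dp\<close>, where
  \<open>w\<^sub>\<epsilon>(p) = (2 \<pi>)\<^sup>-\<^sup>d (i p)\<^sup>k exp (- \<epsilon> |p|\<^sup>2 / 2)\<close> and \<open>Z(p) = \<integral> exp (i \<langle>p, B\<^sub>s\<rangle>) ds\<close>,
  \<open>Z'(p) = \<integral> exp (- i \<langle>p, B'\<^sub>r\<rangle>) dr\<close> are independent with the same mixed moments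
  \<open>f(p\<^sub>1, \<dots>, p\<^sub>N) = E[Z(p\<^sub>1) \<dots> Z(p\<^sub>N)] = \<integral> exp (- Var (\<Sum> \<langle>p\<^sub>i, B\<^sub>s\<^sub>i\<rangle>) / 2) ds \<ge> 0\<close>.
  Hence for even \<open>N\<close> the \<open>N\<close>-th moment of \<open>\<alpha>\<^sub>\<epsilon> - \<alpha>\<^sub>\<eta>\<close> is the integral of
  \<open>\<Prod> (w\<^sub>\<epsilon> - w\<^sub>\<eta>)(p\<^sub>i) f(p)\<^sup>2\<close>, and by dominated convergence it suffices that
  \<open>\<Prod> |p\<^sub>i|\<^sup>|\<^sup>k\<^sup>| f(p)\<^sup>2\<close> is integrable.

  For a given ordering of the times, let \<open>u\<^sub>i\<close> be the sum of \<open>p\<^sub>i\<close> and all \<open>p\<^sub>j\<close> at later times, and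
  \<open>\<Delta>\<^sub>i\<close> the distance from \<open>s\<^sub>i\<close> to the previous time. Local nondeterminism bounds the variance below
  by a multiple of \<open>\<Sum> |u\<^sub>i|\<^sup>2 \<Delta>\<^sub>i\<^sup>2\<^sup>H\<close>. Integrating over the times gives \<open>f \<le> C \<Prod> (1 + |u\<^sub>i|)\<^sup>-\<^sup>\<theta>\<close> for every
  \<open>\<theta> < 1 / H\<close>, summed over the orderings, while \<open>\<Prod> |p\<^sub>i| \<le> \<Prod> (1 + |u\<^sub>i|)\<^sup>2\<close>. What remains is
  the convergence of \<open>\<integral> (1 + |u|)\<^sup>2\<^sup>|\<^sup>k\<^sup>| \<^sup>- \<^sup>2\<^sup>\<theta> du\<close>, that is \<open>2 \<theta> > 2 |k| + d\<close>; such a \<open>\<theta>\<close> exists because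
  \<open>2 |k| H + H d < 2\<close>.
\<close>

section \<open>Spectral representation and local nondeterminism\<close>

text \<open>The lower bound for the variance is proved one gap between consecutive times at a time,
  and the sum over all gaps comes from averaging the \<open>N\<close> separate bounds. This costs a
  factor \<open>N\<close>, harmless for a fixed moment, and replaces conditional variances by a
  single Cauchy-Schwarz inequality in the spectral domain, which treats all \<open>H\<close> in (0,
  1) alike.

  Nonnegativity of the mixed moments makes the domination work: only the weights are estimated in
  absolute value, since the oscillation of the exponentials has already been evaluated in the
  characteristic functions. Even exponents are natural because the moment formula is polynomial in
  the real variable \<alpha>; the other exponents follow by interpolation.

  The condition \<open>\<theta> < 1 / H\<close> is the local integrability of
  \<open>\<bar>y\<bar> powr (- (H * \<theta>))\<close> in one time variable. The exponent
  \<open>2 * \<theta>\<close> appears because each of the two independent processes contributes one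
  factor \<open>f\<close>, and the 2 in front of the order of differentiation because each suffix
  sum enters two of the frequencies.\<close>

lemma integrable_of_nonneg_has_integral:
  fixes f :: "real \<Rightarrow> real"
  assumes [measurable]: "f \<in> borel_measurable borel" and f: "\<And>x. 0 \<le> f x"
    and "(f has_integral I) UNIV"
  shows "integrable lborel f"
proof (rule integrableI_nonneg)
  show "(\<integral>\<^sup>+x. ennreal (f x) \<partial>lborel) < \<infinity>"
    using nn_integral_has_integral_lborel[OF assms] by simp
qed (use f in auto)

lemma integrable_reflect:
  fixes f :: "real \<Rightarrow> real"
  shows "integrable lborel (\<lambda>x. f (- x)) \<longleftrightarrow> integrable lborel f"
  using lborel_integrable_real_affine_iff[of "-1" f 0] by simp

lemma integrable_powr_near_0:
  fixes a :: real assumes "a > -1"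
  shows "integrable lborel (\<lambda>x::real. indicator {-1..1} x * \<bar>x\<bar> powr a)"
proof -
  let ?g = "\<lambda>x::real. indicator {0..1} x * \<bar>x\<bar> powr a"
  have "((\<lambda>x. x powr a) has_integral 1 powr (a + 1) / (a + 1)) {0..1}"
    by (rule has_integral_powr_from_0) (use assms in auto)
  hence "((\<lambda>x. if x \<in> {0..1} then x powr a else 0) has_integral 1 powr (a + 1) / (a + 1)) UNIV"
    by (subst has_integral_restrict_UNIV)
  hence "(?g has_integral 1 powr (a + 1) / (a + 1)) UNIV"
    by (rule has_integral_eq[rotated]) auto
  hence g: "integrable lborel ?g"
    by (intro integrable_of_nonneg_has_integral) auto
  have "integrable lborel (\<lambda>x. ?g x + ?g (-x))"
    using g integrable_reflect[of ?g] by (intro Bochner_Integration.integrable_add) auto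
  thus ?thesis
    by (rule Bochner_Integration.integrable_bound) (auto simp: indicator_def)
qed

lemma integrable_powr_at_infinity:
  fixes a :: real assumes "a < -1"
  shows "integrable lborel (\<lambda>x::real. indicator {x. 1 \<le> \<bar>x\<bar>} x * \<bar>x\<bar> powr a)"
proof -
  let ?g = "\<lambda>x::real. indicator {1..} x * \<bar>x\<bar> powr a"
  have "((\<lambda>x. x powr a) has_integral - (1 powr (a + 1)) / (a + 1)) {1..}"
    by (rule has_integral_powr_to_inf) (use assms in auto)
  hence "((\<lambda>x. if x \<in> {1..} then x powr a else 0) has_integral - (1 powr (a + 1)) / (a + 1)) UNIV"
    by (subst has_integral_restrict_UNIV)
  hence "(?g has_integral - (1 powr (a + 1)) / (a + 1)) UNIV"
    by (rule has_integral_eq[rotated]) auto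
  hence g: "integrable lborel ?g"
    by (intro integrable_of_nonneg_has_integral) auto
  have "integrable lborel (\<lambda>x. ?g x + ?g (-x))"
    using g integrable_reflect[of ?g] by (intro Bochner_Integration.integrable_add) auto
  moreover have "(\<lambda>x::real. indicator {x. 1 \<le> \<bar>x\<bar>} x * \<bar>x\<bar> powr a) \<in> borel_measurable lborel"
    by measurable
  ultimately show ?thesis
    by (rule Bochner_Integration.integrable_bound) (auto simp: indicator_def)
qed

section \<open>Spectral integral of a single increment\<close>

lemma one_minus_cos_le: "1 - cos (x::real) \<le> x\<^sup>2 / 2"
proof -
  have "1 - cos x = 2 * (sin (x/2))\<^sup>2"
    using cos_double_sin[of "x/2"] by simp
  moreover have "(sin (x/2))\<^sup>2 \<le> (x/2)\<^sup>2"
    using abs_sin_x_le_abs_x[of "x/2"] by (metis abs_le_square_iff)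
  ultimately show ?thesis by (simp add: power2_eq_square)
qed

text \<open>Half the squared modulus of \<open>exp (\<i> * t * x) - 1\<close> against the weight
  \<open>\<bar>x\<bar> powr (-1 - 2 * h)\<close>: the spectral density of an increment over a time
  span \<open>t\<close>, up to the normalisation \<open>fbm_const\<close>.\<close>

definition fbm_kernel :: "real \<Rightarrow> real \<Rightarrow> real \<Rightarrow> real" where
  "fbm_kernel h t x = (1 - cos (t * x)) * \<bar>x\<bar> powr (-1 - 2 * h)"

definition fbm_const :: "real \<Rightarrow> real" where
  "fbm_const h = (LBINT x. fbm_kernel h 1 x)"

lemma fbm_kernel_measurable [measurable]: "fbm_kernel h t \<in> borel_measurable borel"
  unfolding fbm_kernel_def by measurable

lemma fbm_kernel_nonneg: "0 \<le> fbm_kernel h t x"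
  by (simp add: fbm_kernel_def)

text \<open>The two bounds on \<open>h\<close> serve the two ends. Near 0 the factor
  \<open>1 - cos x \<le> x\<^sup>2\<close> raises the exponent to \<open>1 - 2 * h > -1\<close>; at
  infinity the exponent \<open>-1 - 2 * h < -1\<close> suffices.\<close>

lemma integrable_fbm_kernel_1:
  assumes "0 < h" "h < 1"
  shows "integrable lborel (fbm_kernel h 1)"
proof -
  have 1: "integrable lborel (\<lambda>x::real. indicator {-1..1} x * \<bar>x\<bar> powr (1 - 2 * h))"
    by (rule integrable_powr_near_0) (use assms in auto)
  have 2: "integrable lborel (\<lambda>x::real. 2 * (indicator {x. 1 \<le> \<bar>x\<bar>} x * \<bar>x\<bar> powr (-1 - 2 * h)))"
    by (intro integrable_mult_right integrable_powr_at_infinity) (use assms in auto)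
  show ?thesis
  proof (rule Bochner_Integration.integrable_bound[OF Bochner_Integration.integrable_add[OF 1 2]])
    show "AE x in lborel. norm (fbm_kernel h 1 x) \<le> norm (indicator {-1..1} x * \<bar>x\<bar> powr (1 - 2 * h) +
       2 * (indicator {x. 1 \<le> \<bar>x\<bar>} x * \<bar>x\<bar> powr (-1 - 2 * h)))"
    proof (intro AE_I2)
      fix x :: real
      show "norm (fbm_kernel h 1 x) \<le> norm (indicator {-1..1} x * \<bar>x\<bar> powr (1 - 2 * h) +
       2 * (indicator {x. 1 \<le> \<bar>x\<bar>} x * \<bar>x\<bar> powr (-1 - 2 * h)))"
      proof (cases "\<bar>x\<bar> < 1")
        case True
        have "\<bar>x\<bar> powr (1 - 2 * h) = x\<^sup>2 * \<bar>x\<bar> powr (-1 - 2 * h)" if "x \<noteq> 0"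
        proof -
          have "\<bar>x\<bar> powr (1 - 2 * h) = \<bar>x\<bar> powr (2 + (-1 - 2 * h))" by (simp add: algebra_simps)
          also have "\<dots> = \<bar>x\<bar> powr 2 * \<bar>x\<bar> powr (-1 - 2 * h)" by (rule powr_add)
          finally show ?thesis using that by simp
        qed
        moreover have "1 - cos x \<le> x\<^sup>2" using one_minus_cos_le[of x] zero_le_power2[of x] by linarith
        ultimately show ?thesis using True
          by (cases "x = 0") (auto simp: fbm_kernel_def indicator_def intro!: mult_right_mono)
      next
        case False
        have "1 - cos x \<le> 2" using cos_ge_minus_one[of x] by linarith
        hence "(1 - cos x) * \<bar>x\<bar> powr (-1 - 2*h) \<le> 2 * \<bar>x\<bar> powr (-1 - 2*h)"
          by (intro mult_right_mono) auto
        thus ?thesis using False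
          by (auto simp: fbm_kernel_def indicator_def abs_mult intro: add_increasing)
      qed
    qed
  qed simp
qed

text \<open>Self-similarity: substituting \<open>t * x\<close> for the variable extracts
  \<open>\<bar>t\<bar> powr (1 + 2 * h)\<close> from the weight and loses one power to the
  Jacobian.\<close>

lemma has_bochner_integral_fbm_kernel:
  assumes "0 < h" "h < 1"
  shows "has_bochner_integral lborel (fbm_kernel h t) (fbm_const h * \<bar>t\<bar> powr (2 * h))"
proof (cases "t = 0")
  case True
  then show ?thesis by (simp add: fbm_kernel_def[abs_def] has_bochner_integral_zero)
next
  case False
  have *: "fbm_kernel h t x = \<bar>t\<bar> powr (1 + 2 * h) * fbm_kernel h 1 (0 + t * x)" for x
  proof -
    have "\<bar>t * x\<bar> powr (-1 - 2 * h) = \<bar>t\<bar> powr (-1 - 2 * h) * \<bar>x\<bar> powr (-1 - 2 * h)"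
      by (simp add: abs_mult powr_mult)
    moreover have "\<bar>t\<bar> powr (1 + 2 * h) * \<bar>t\<bar> powr (-1 - 2 * h) = 1"
      using False by (simp add: powr_add[symmetric])
    ultimately show ?thesis by (simp add: fbm_kernel_def)
  qed
  have "has_bochner_integral lborel (\<lambda>x. fbm_kernel h 1 (0 + t * x)) (fbm_const h /\<^sub>R \<bar>t\<bar>)"
    using integrable_fbm_kernel_1[OF assms] False
    using lborel_has_bochner_integral_real_affine_iff[of t "fbm_kernel h 1" "fbm_const h" 0]
    by (auto simp: has_bochner_integral_iff fbm_const_def)
  hence "has_bochner_integral lborel (\<lambda>x. \<bar>t\<bar> powr (1 + 2 * h) * fbm_kernel h 1 (0 + t * x))
           (\<bar>t\<bar> powr (1 + 2 * h) * (fbm_const h /\<^sub>R \<bar>t\<bar>))"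
    by (rule has_bochner_integral_mult_right) 
  moreover have "\<bar>t\<bar> powr (1 + 2 * h) * (fbm_const h /\<^sub>R \<bar>t\<bar>) = fbm_const h * \<bar>t\<bar> powr (2 * h)"
    using False by (simp add: powr_add field_simps)
  ultimately show ?thesis by (simp only: * cong: has_bochner_integral_cong)
qed

lemma fbm_const_pos:
  assumes "0 < h" "h < 1" shows "fbm_const h > 0"
proof -
  have "fbm_const h \<noteq> 0"
  proof
    assume "fbm_const h = 0"
    hence "AE x in lborel. fbm_kernel h 1 x = 0"
      unfolding fbm_const_def using integrable_fbm_kernel_1[OF assms]
      by (subst (asm) integral_nonneg_eq_0_iff_AE) (auto simp: fbm_kernel_nonneg)
    moreover have "fbm_kernel h 1 x \<noteq> 0" if "x \<in> {1<..<2}" for x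
    proof -
      have "cos x < cos 0" using that pi_gt3 by (intro cos_monotone_0_pi) auto
      thus ?thesis using that by (simp add: fbm_kernel_def)
    qed
    ultimately have "AE x in lborel. x \<notin> {1<..<2::real}" by (auto elim: eventually_mono)
    hence "emeasure lborel {1<..<2::real} = 0"
      by (subst (asm) AE_iff_measurable[of "{1<..<2::real}"]) auto
    thus False by simp
  qed
  moreover have "0 \<le> fbm_const h" unfolding fbm_const_def
    by (intro Bochner_Integration.integral_nonneg) (rule fbm_kernel_nonneg)
  ultimately show ?thesis by simp
qed

section \<open>The covariance form and its spectral representation\<close>

definition fbm_cov :: "real \<Rightarrow> real \<Rightarrow> real \<Rightarrow> real" where
  "fbm_cov h t s = (\<bar>t\<bar> powr (2 * h) + \<bar>s\<bar> powr (2 * h) - \<bar>t - s\<bar> powr (2 * h)) / 2"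

text \<open>The variance of the sum of \<open>p i \<bullet> B (s i)\<close>, as
  \<open>fractional_brownian_motion_second_moment\<close> confirms for nonnegative times. Stated
  algebraically, it can be estimated without any process. The absolute values in
  \<open>fbm_cov\<close> match the evenness of the cosine, so the spectral formula holds for all
  real times.\<close>

definition fbm_form :: "real \<Rightarrow> 'i set \<Rightarrow> ('i \<Rightarrow> 'v::real_inner) \<Rightarrow> ('i \<Rightarrow> real) \<Rightarrow> real" where
  "fbm_form h I p s = (\<Sum>i\<in>I. \<Sum>j\<in>I. (p i \<bullet> p j) * fbm_cov h (s i) (s j))"

lemma square_le_of_quadratic_nonneg:
  fixes a b c :: real
  assumes q: "\<And>l. 0 \<le> l\<^sup>2 * a - 2 * l * c + b" and a: "a \<ge> 0"
  shows "c\<^sup>2 \<le> a * b"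
proof (cases "a = 0")
  case True
  have "c = 0"
  proof (rule ccontr)
    assume "c \<noteq> 0"
    thus False using q[of "(b + 1) / (2 * c)"] True by simp
  qed
  thus ?thesis using True by simp
next
  case False
  have "0 \<le> (c/a)\<^sup>2 * a - 2 * (c/a) * c + b" by (rule q)
  also have "\<dots> = b - c\<^sup>2/a" using False by (simp add: power2_eq_square field_simps)
  finally show ?thesis using False a by (simp add: field_simps)
qed

text \<open>\<open>C\<close> and \<open>S\<close> are the real and imaginary parts of the sum of
  \<open>p i * (exp (\<i> * s i * x) - 1)\<close>. Polarising the squared modulus gives the kernels
  at \<open>s i\<close>, \<open>s j\<close> and \<open>s i - s j\<close> in exactly the combination
  that defines the covariance. The factor 2 undoes the halving in \<open>fbm_cov\<close>.\<close>

lemma fbm_form_spectral: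
  fixes p s :: "'i \<Rightarrow> real"
  assumes "0 < h" "h < 1" and I: "finite I"
  defines "C \<equiv> \<lambda>x. \<Sum>i\<in>I. p i * (cos (s i * x) - 1)"
    and "S \<equiv> \<lambda>x. \<Sum>i\<in>I. p i * sin (s i * x)"
  shows "has_bochner_integral lborel (\<lambda>x. ((C x)\<^sup>2 + (S x)\<^sup>2) * \<bar>x\<bar> powr (-1 - 2 * h))
           (2 * fbm_const h * fbm_form h I p s)"
proof -
  have "((C x)\<^sup>2 + (S x)\<^sup>2) * \<bar>x\<bar> powr (-1 - 2 * h) =
      (\<Sum>i\<in>I. \<Sum>j\<in>I. (p i * p j) * (fbm_kernel h (s i) x + fbm_kernel h (s j) x - fbm_kernel h (s i - s j) x))" for x
  proof -
    have "(p i * p j) * (fbm_kernel h (s i) x + fbm_kernel h (s j) x - fbm_kernel h (s i - s j) x) =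
       (p i * (cos (s i * x) - 1)) * (p j * (cos (s j * x) - 1)) * \<bar>x\<bar> powr (-1 - 2 * h) +
       (p i * sin (s i * x)) * (p j * sin (s j * x)) * \<bar>x\<bar> powr (-1 - 2 * h)" for i j
    proof -
      have "cos ((s i - s j) * x) = cos (s i * x) * cos (s j * x) + sin (s i * x) * sin (s j * x)"
        by (simp add: left_diff_distrib cos_diff)
      thus ?thesis unfolding fbm_kernel_def by (simp add: algebra_simps)
    qed
    thus ?thesis
      unfolding C_def S_def power2_eq_square sum_product
      by (simp add: sum.distrib sum_distrib_right distrib_right)
  qed
  moreover have "has_bochner_integral lborel
     (\<lambda>x. \<Sum>i\<in>I. \<Sum>j\<in>I. (p i * p j) * (fbm_kernel h (s i) x + fbm_kernel h (s j) x - fbm_kernel h (s i - s j) x))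
     (\<Sum>i\<in>I. \<Sum>j\<in>I. (p i * p j) * (fbm_const h * \<bar>s i\<bar> powr (2 * h) + fbm_const h * \<bar>s j\<bar> powr (2 * h)
        - fbm_const h * \<bar>s i - s j\<bar> powr (2 * h)))"
    by (intro has_bochner_integral_sum has_bochner_integral_mult_right has_bochner_integral_add
          has_bochner_integral_diff has_bochner_integral_fbm_kernel assms(1,2))
  moreover have "(\<Sum>i\<in>I. \<Sum>j\<in>I. (p i * p j) * (fbm_const h * \<bar>s i\<bar> powr (2 * h) + fbm_const h * \<bar>s j\<bar> powr (2 * h)
        - fbm_const h * \<bar>s i - s j\<bar> powr (2 * h))) = 2 * fbm_const h * fbm_form h I p s"
    unfolding fbm_form_def sum_distrib_left
    by (intro sum.cong refl) (simp add: fbm_cov_def algebra_simps)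
  ultimately show ?thesis by simp
qed

lemma fbm_form_nonneg_real:
  fixes p s :: "'i \<Rightarrow> real"
  assumes "0 < h" "h < 1" "finite I"
  shows "0 \<le> fbm_form h I p s"
proof -
  have "0 \<le> 2 * fbm_const h * fbm_form h I p s"
    using has_bochner_integral_integral_eq[OF fbm_form_spectral[OF assms, of p s]]
    by (metis (no_types, lifting) Bochner_Integration.integral_nonneg powr_ge_zero mult_nonneg_nonneg
        sum_power2_ge_zero)
  thus ?thesis using fbm_const_pos[OF assms(1,2)] by (simp add: zero_le_mult_iff)
qed

text \<open>Duality between the exponents \<open>h\<close> and \<open>1 - h\<close>: in the spectral representation, the
  Cauchy-Schwarz inequality with the weights \<open>-1 - 2 * h\<close> and \<open>-1 - 2 * (1 - h)\<close> tests the
  process against an increment over \<open>{a..b}\<close>. The mixed weight \<open>-2\<close> is that of Brownian motion,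
  for which increments over disjoint intervals are orthogonal.\<close>

lemma fbm_form_ge_increment_real:
  fixes p s :: "'i \<Rightarrow> real"
  assumes h: "0 < h" "h < 1" and I: "finite I"
    and ab: "0 \<le> a" "a < b" and s: "\<And>i. i \<in> I \<Longrightarrow> s i \<le> a \<or> b \<le> s i"
  shows "(fbm_const (1/2))\<^sup>2 * (\<Sum>i\<in>{i\<in>I. b \<le> s i}. p i)\<^sup>2 * (b - a) powr (2 * h)
     \<le> fbm_const h * fbm_const (1 - h) * fbm_form h I p s"
proof -
  define C where "C = (\<lambda>x. \<Sum>i\<in>I. p i * (cos (s i * x) - 1))"
  define S where "S = (\<lambda>x. \<Sum>i\<in>I. p i * sin (s i * x))"
  \<comment> \<open>\<open>D\<close> and \<open>T\<close> are the real and imaginary parts of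
    \<open>exp (\<i> * b * x) - exp (\<i> * a * x)\<close>, the spectral function of the test
    increment.\<close>
  define D where "D = (\<lambda>x. cos (b * x) - cos (a * x))"
  define T where "T = (\<lambda>x. sin (b * x) - sin (a * x))"
  define u where "u = (\<Sum>i\<in>{i\<in>I. b \<le> s i}. p i)"
  let ?A = "2 * fbm_const h * fbm_form h I p s" and ?B = "2 * (fbm_const (1-h) * (b - a) powr (2 * (1 - h)))"
    and ?E = "2 * fbm_const (1/2) * (b - a) * u"
  have 1: "has_bochner_integral lborel (\<lambda>x. ((C x)\<^sup>2 + (S x)\<^sup>2) * \<bar>x\<bar> powr (-1 - 2 * h)) ?A"
    unfolding C_def S_def by (rule fbm_form_spectral[OF h I])
  have "has_bochner_integral lborel (\<lambda>x. 2 * fbm_kernel (1-h) (b-a) x) (2 * (fbm_const (1-h) * \<bar>b-a\<bar> powr (2 * (1 - h))))"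
    by (intro has_bochner_integral_mult_right has_bochner_integral_fbm_kernel) (use h in auto)
  moreover have "2 * fbm_kernel (1-h) (b-a) x = ((D x)\<^sup>2 + (T x)\<^sup>2) * \<bar>x\<bar> powr (-1 - 2 * (1 - h))" for x
  proof -
    have "(D x)\<^sup>2 + (T x)\<^sup>2 = 2 * (1 - cos ((b - a) * x))"
      unfolding D_def T_def left_diff_distrib cos_diff
      using sin_cos_squared_add[of "a*x"] sin_cos_squared_add[of "b*x"]
      by (simp add: power2_eq_square algebra_simps)
    thus ?thesis by (simp add: fbm_kernel_def)
  qed
  ultimately have 2: "has_bochner_integral lborel (\<lambda>x. ((D x)\<^sup>2 + (T x)\<^sup>2) * \<bar>x\<bar> powr (-1 - 2 * (1 - h))) ?B"
    using ab by simp
  have "has_bochner_integral lborel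
     (\<lambda>x. \<Sum>i\<in>I. p i * (fbm_kernel (1/2) (s i - a) x - fbm_kernel (1/2) (s i - b) x - fbm_kernel (1/2) a x + fbm_kernel (1/2) b x))
     (\<Sum>i\<in>I. p i * (fbm_const (1/2) * \<bar>s i - a\<bar> powr (2 * (1/2)) - fbm_const (1/2) * \<bar>s i - b\<bar> powr (2 * (1/2))
        - fbm_const (1/2) * \<bar>a\<bar> powr (2 * (1/2)) + fbm_const (1/2) * \<bar>b\<bar> powr (2 * (1/2))))"
    by (intro has_bochner_integral_sum has_bochner_integral_mult_right has_bochner_integral_add
          has_bochner_integral_diff has_bochner_integral_fbm_kernel) auto
  moreover have "(\<Sum>i\<in>I. p i * (fbm_kernel (1/2) (s i - a) x - fbm_kernel (1/2) (s i - b) x - fbm_kernel (1/2) a x + fbm_kernel (1/2) b x))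
     = (C x * D x + S x * T x) * \<bar>x\<bar> powr (- 2)" for x
  proof -
    have "p i * (fbm_kernel (1/2) (s i - a) x - fbm_kernel (1/2) (s i - b) x - fbm_kernel (1/2) a x + fbm_kernel (1/2) b x)
      = ((p i * (cos (s i * x) - 1)) * D x + (p i * sin (s i * x)) * T x) * \<bar>x\<bar> powr (- 2)" for i
      unfolding D_def T_def fbm_kernel_def left_diff_distrib cos_diff by (simp add: algebra_simps)
    thus ?thesis unfolding C_def S_def by (simp add: sum_distrib_right sum.distrib distrib_right)
  qed
  \<comment> \<open>At \<open>h = 1/2\<close> the covariance is piecewise linear: the bracket is
    \<open>2 * (b - a)\<close> for a time after \<open>b\<close> and 0 for a time before
    \<open>a\<close>. This is why no time may lie strictly between \<open>a\<close> and
    \<open>b\<close>.\<close>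
  moreover have "(\<Sum>i\<in>I. p i * (fbm_const (1/2) * \<bar>s i - a\<bar> powr (2 * (1/2)) - fbm_const (1/2) * \<bar>s i - b\<bar> powr (2 * (1/2))
        - fbm_const (1/2) * \<bar>a\<bar> powr (2 * (1/2)) + fbm_const (1/2) * \<bar>b\<bar> powr (2 * (1/2)))) = ?E"
  proof -
    have "(\<Sum>i\<in>I. p i * (fbm_const (1/2) * \<bar>s i - a\<bar> powr (2 * (1/2)) - fbm_const (1/2) * \<bar>s i - b\<bar> powr (2 * (1/2))
        - fbm_const (1/2) * \<bar>a\<bar> powr (2 * (1/2)) + fbm_const (1/2) * \<bar>b\<bar> powr (2 * (1/2))))
      = (\<Sum>i\<in>I. if b \<le> s i then 2 * fbm_const (1/2) * (b - a) * p i else 0)"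
      using s ab by (intro sum.cong refl) (force simp: algebra_simps)
    thus ?thesis using I by (simp add: sum.If_cases u_def sum_distrib_left Int_def)
  qed
  ultimately have 3: "has_bochner_integral lborel (\<lambda>x. (C x * D x + S x * T x) * \<bar>x\<bar> powr (- 2)) ?E"
    by simp
  have "0 \<le> l\<^sup>2 * ?A - 2 * l * ?E + ?B" for l
  proof -
    have *: "has_bochner_integral lborel (\<lambda>x. l\<^sup>2 * (((C x)\<^sup>2 + (S x)\<^sup>2) * \<bar>x\<bar> powr (-1 - 2 * h))
        - 2 * l * ((C x * D x + S x * T x) * \<bar>x\<bar> powr (- 2))
        + ((D x)\<^sup>2 + (T x)\<^sup>2) * \<bar>x\<bar> powr (-1 - 2 * (1 - h))) (l\<^sup>2 * ?A - 2 * l * ?E + ?B)"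
      by (intro has_bochner_integral_add has_bochner_integral_diff has_bochner_integral_mult_right 1 2 3)
    have "0 \<le> l\<^sup>2 * (((C x)\<^sup>2 + (S x)\<^sup>2) * \<bar>x\<bar> powr (-1 - 2 * h))
        - 2 * l * ((C x * D x + S x * T x) * \<bar>x\<bar> powr (- 2))
        + ((D x)\<^sup>2 + (T x)\<^sup>2) * \<bar>x\<bar> powr (-1 - 2 * (1 - h))" for x
    proof -
      \<comment> \<open>\<open>f\<close> and \<open>g\<close> are square roots of the two weights
        and their product is the mixed weight, so the integrand is a sum of two squares for every
        \<open>l\<close>. The discriminant of the resulting quadratic in \<open>l\<close> gives
        Cauchy-Schwarz.\<close>
      define f where "f = \<bar>x\<bar> powr (-1/2 - h)"
      define g where "g = \<bar>x\<bar> powr (-1/2 - (1 - h))"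
      have "f\<^sup>2 = \<bar>x\<bar> powr (-1 - 2 * h)" "g\<^sup>2 = \<bar>x\<bar> powr (-1 - 2 * (1 - h))" "f * g = \<bar>x\<bar> powr (-2)"
        unfolding f_def g_def power2_eq_square powr_add[symmetric] by (simp_all add: algebra_simps)
      note fg = this[symmetric]
      have "l\<^sup>2 * (((C x)\<^sup>2 + (S x)\<^sup>2) * \<bar>x\<bar> powr (-1 - 2 * h))
        - 2 * l * ((C x * D x + S x * T x) * \<bar>x\<bar> powr (- 2))
        + ((D x)\<^sup>2 + (T x)\<^sup>2) * \<bar>x\<bar> powr (-1 - 2 * (1 - h)) = (l * C x * f - D x * g)\<^sup>2 + (l * S x * f - T x * g)\<^sup>2"
        unfolding fg by (simp add: power2_eq_square algebra_simps)
      thus ?thesis by simp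
    qed
    hence "0 \<le> (LBINT x. l\<^sup>2 * (((C x)\<^sup>2 + (S x)\<^sup>2) * \<bar>x\<bar> powr (-1 - 2 * h))
        - 2 * l * ((C x * D x + S x * T x) * \<bar>x\<bar> powr (- 2))
        + ((D x)\<^sup>2 + (T x)\<^sup>2) * \<bar>x\<bar> powr (-1 - 2 * (1 - h)))"
      by (rule Bochner_Integration.integral_nonneg)
    also have "\<dots> = l\<^sup>2 * ?A - 2 * l * ?E + ?B" using * by (rule has_bochner_integral_integral_eq)
    finally show ?thesis .
  qed
  moreover have "?A \<ge> 0" using fbm_form_nonneg_real[OF h I] fbm_const_pos[OF h] by simp
  ultimately have *: "?E\<^sup>2 \<le> ?A * ?B" by (rule square_le_of_quadratic_nonneg)
  \<comment> \<open>The mixed term contributes the square of \<open>b - a\<close>, the test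
    increment only the power \<open>2 * (1 - h)\<close>; cancelling the latter leaves the power
    \<open>2 * h\<close>.\<close>
  define q where "q = (b - a) powr (2 * (1 - h))"
  have q: "q > 0" unfolding q_def using ab by simp
  have "(b - a)\<^sup>2 = q * (b - a) powr (2 * h)"
    unfolding q_def powr_add[symmetric] using ab by (simp add: algebra_simps)
  with * have "(fbm_const (1/2))\<^sup>2 * u\<^sup>2 * (q * (b - a) powr (2 * h))
     \<le> fbm_const h * fbm_const (1 - h) * fbm_form h I p s * q"
    unfolding q_def[symmetric] power_mult_distrib by (simp add: mult.commute mult.left_commute)
  hence "q * ((fbm_const (1/2))\<^sup>2 * u\<^sup>2 * (b - a) powr (2 * h))
     \<le> q * (fbm_const h * fbm_const (1 - h) * fbm_form h I p s)"
    by (simp only: ac_simps)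
  thus ?thesis using q unfolding u_def by (simp only: mult_le_cancel_left_pos)
qed

text \<open>The same scalar covariance acts in every coordinate, so vector frequencies reduce to
  scalar ones.\<close>

lemma fbm_form_sum_Basis:
  fixes p :: "'i \<Rightarrow> 'v::euclidean_space"
  shows "fbm_form h I p s = (\<Sum>b\<in>Basis. fbm_form h I (\<lambda>i. p i \<bullet> b) s)"
proof -
  have "(\<Sum>b\<in>Basis. fbm_form h I (\<lambda>i. p i \<bullet> b) s)
     = (\<Sum>b\<in>Basis. \<Sum>i\<in>I. \<Sum>j\<in>I. ((p i \<bullet> b) * (p j \<bullet> b)) * fbm_cov h (s i) (s j))"
    by (simp add: fbm_form_def)
  also have "\<dots> = (\<Sum>i\<in>I. \<Sum>b\<in>Basis. \<Sum>j\<in>I. ((p i \<bullet> b) * (p j \<bullet> b)) * fbm_cov h (s i) (s j))"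
    by (rule sum.swap)
  also have "\<dots> = (\<Sum>i\<in>I. \<Sum>j\<in>I. \<Sum>b\<in>Basis. ((p i \<bullet> b) * (p j \<bullet> b)) * fbm_cov h (s i) (s j))"
    by (intro sum.cong refl sum.swap)
  also have "\<dots> = fbm_form h I p s"
    unfolding fbm_form_def by (subst euclidean_inner) (simp only: sum_distrib_right)
  finally show ?thesis ..
qed

lemma fbm_form_nonneg:
  fixes p :: "'i \<Rightarrow> 'v::euclidean_space"
  assumes "0 < h" "h < 1" "finite I"
  shows "0 \<le> fbm_form h I p s"
  by (subst fbm_form_sum_Basis) (intro sum_nonneg fbm_form_nonneg_real assms)

text \<open>One constant must serve all index sets, frequencies, times and gaps, hence the
  quantifiers inside the obtained fact. It is the constant of the Cauchy-Schwarz inequality and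
  depends on \<open>h\<close> only; summing the scalar bound over the coordinates does not change
  it.\<close>

lemma fbm_local_nondeterminism:
  assumes h: "0 < h" "h < 1"
  obtains \<kappa> where "\<kappa> > 0"
    "\<forall>(I :: 'i set) (p :: 'i \<Rightarrow> 'v::euclidean_space) (s :: 'i \<Rightarrow> real) a b.
      finite I \<and> 0 \<le> a \<and> a \<le> b \<and> (\<forall>i\<in>I. s i \<le> a \<or> b \<le> s i) \<longrightarrow>
      \<kappa> * (norm (\<Sum>i\<in>{i\<in>I. b \<le> s i}. p i))\<^sup>2 * (b - a) powr (2 * h) \<le> fbm_form h I p s"
proof
  show "(fbm_const (1/2))\<^sup>2 / (fbm_const h * fbm_const (1 - h)) > 0"
    using h fbm_const_pos[of "1/2"] fbm_const_pos[of h] fbm_const_pos[of "1 - h"] by simp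
next
  show "\<forall>(I :: 'i set) (p :: 'i \<Rightarrow> 'v) (s :: 'i \<Rightarrow> real) a b.
      finite I \<and> 0 \<le> a \<and> a \<le> b \<and> (\<forall>i\<in>I. s i \<le> a \<or> b \<le> s i) \<longrightarrow>
      (fbm_const (1/2))\<^sup>2 / (fbm_const h * fbm_const (1 - h)) * (norm (\<Sum>i\<in>{i\<in>I. b \<le> s i}. p i))\<^sup>2 * (b - a) powr (2 * h)
        \<le> fbm_form h I p s"
  proof (intro allI impI, elim conjE)
    fix I :: "'i set" and p :: "'i \<Rightarrow> 'v" and s :: "'i \<Rightarrow> real" and a b :: real
    assume I: "finite I" and ab: "0 \<le> a" "a \<le> b" and s: "\<forall>i\<in>I. s i \<le> a \<or> b \<le> s i"
    let ?K = "fbm_const h * fbm_const (1 - h)"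
    have K: "?K > 0" using h by (intro mult_pos_pos fbm_const_pos) auto
    let ?u = "\<Sum>i\<in>{i\<in>I. b \<le> s i}. p i"
    show "(fbm_const (1/2))\<^sup>2 / ?K * (norm ?u)\<^sup>2 * (b - a) powr (2 * h) \<le> fbm_form h I p s"
    proof (cases "a = b")
      case True
      then show ?thesis using fbm_form_nonneg[OF h I] by simp
    next
      case False
      have "(norm ?u)\<^sup>2 = (\<Sum>e\<in>Basis. (\<Sum>i\<in>{i\<in>I. b \<le> s i}. p i \<bullet> e)\<^sup>2)"
        unfolding power2_norm_eq_inner by (subst euclidean_inner) (simp add: inner_sum_left power2_eq_square)
      hence "(fbm_const (1/2))\<^sup>2 * (norm ?u)\<^sup>2 * (b - a) powr (2 * h)
         = (\<Sum>e\<in>Basis. (fbm_const (1/2))\<^sup>2 * (\<Sum>i\<in>{i\<in>I. b \<le> s i}. p i \<bullet> e)\<^sup>2 * (b - a) powr (2 * h))"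
        by (simp add: sum_distrib_left sum_distrib_right)
      also have "\<dots> \<le> (\<Sum>e\<in>Basis. ?K * fbm_form h I (\<lambda>i. p i \<bullet> e) s)"
        using False ab s by (intro sum_mono fbm_form_ge_increment_real h I) auto
      also have "\<dots> = ?K * fbm_form h I p s"
        by (subst fbm_form_sum_Basis) (simp add: sum_distrib_left)
      finally show ?thesis using K by (simp add: field_simps)
    qed
  qed
qed

section \<open>Integrability of the squared moment function\<close>

text \<open>A density rather than a restriction of \<open>lborel\<close>: the result is a
  probability measure whose space is the whole line with the usual Borel sets, so maps on the line
  need no restriction to \<open>{0..1}\<close>.\<close>

definition unit_lborel :: "real measure" where
  "unit_lborel = density lborel (\<lambda>x. ennreal (indicator {0..1} x))"

lemma sets_unit_lborel [measurable_cong, simp]: "sets unit_lborel = sets borel"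
  by (simp add: unit_lborel_def)

lemma space_unit_lborel [simp]: "space unit_lborel = UNIV"
  by (simp add: unit_lborel_def)

lemma prob_space_unit_lborel: "prob_space unit_lborel"
proof
  have "emeasure unit_lborel (space unit_lborel) = (\<integral>\<^sup>+x. indicator {0..1::real} x \<partial>lborel)"
    unfolding unit_lborel_def by (subst emeasure_density) (auto simp: ennreal_indicator)
  thus "emeasure unit_lborel (space unit_lborel) = 1" by simp
qed

lemma AE_unit_lborel: "AE x in unit_lborel. x \<in> {0..1}"
  unfolding unit_lborel_def by (subst AE_density) (auto simp: indicator_def)

text \<open>Lists are orderings of the times in increasing order; the argument \<open>c\<close> of
  \<open>increment_exp\<close> is the time preceding those in the list.\<close>

fun suffix_prod :: "('v::monoid_add \<Rightarrow> 'r::monoid_mult) \<Rightarrow> ('i \<Rightarrow> 'v) \<Rightarrow> 'i list \<Rightarrow> 'r" where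
  "suffix_prod g p [] = 1"
| "suffix_prod g p (a # xs) = g (sum_list (map p (a # xs))) * suffix_prod g p xs"

fun increment_exp :: "real \<Rightarrow> real \<Rightarrow> ('i \<Rightarrow> 'v::real_normed_vector) \<Rightarrow> ('i \<Rightarrow> real) \<Rightarrow> real \<Rightarrow> 'i list \<Rightarrow> real" where
  "increment_exp \<kappa> h p s c [] = 1"
| "increment_exp \<kappa> h p s c (a # xs) =
     exp (- (\<kappa> * (norm (sum_list (map p (a # xs))))\<^sup>2 * \<bar>s a - c\<bar> powr (2 * h))) * increment_exp \<kappa> h p s (s a) xs"

lemma increment_exp_cong:
  assumes "\<And>i. i \<in> set xs \<Longrightarrow> s i = s' i"
  shows "increment_exp \<kappa> h p s c xs = increment_exp \<kappa> h p s' c xs"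
  using assms by (induction xs arbitrary: c) auto

lemma increment_exp_nonneg: "0 \<le> increment_exp \<kappa> h p s c xs"
  by (induction xs arbitrary: c) auto

text \<open>The preceding time has to be a function of \<open>s\<close>, because in the recursion it
  becomes the coordinate \<open>s a\<close>.\<close>

lemma increment_exp_measurable:
  assumes "set xs \<subseteq> I" "c \<in> borel_measurable (PiM I (\<lambda>_. unit_lborel))"
  shows "(\<lambda>s. increment_exp \<kappa> h p s (c s) xs) \<in> borel_measurable (PiM I (\<lambda>_. unit_lborel))"
  using assms
proof (induction xs arbitrary: c)
  case (Cons a xs)
  have [measurable]: "c \<in> borel_measurable (PiM I (\<lambda>_. unit_lborel))" by (rule Cons.prems)
  have "(\<lambda>s. s a) \<in> measurable (PiM I (\<lambda>_. unit_lborel)) unit_lborel"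
    using Cons.prems by (intro measurable_component_singleton) auto
  hence [measurable]: "(\<lambda>s. s a) \<in> borel_measurable (PiM I (\<lambda>_. unit_lborel))"
    by (simp add: measurable_cong_sets[OF refl sets_unit_lborel])
  have [measurable]: "(\<lambda>s. increment_exp \<kappa> h p s (s a) xs) \<in> borel_measurable (PiM I (\<lambda>_. unit_lborel))"
    by (rule Cons.IH) (use Cons.prems in auto)
  show ?case by simp
qed simp

text \<open>The full variance dominates the contribution of each gap separately, so it dominates
  their average. Of the divisor \<open>2 * length xs\<close>, the length comes from this averaging
  and the 2 from the halved variance in the exponent.\<close>

lemma exp_fbm_form_le_increment_exp:
  fixes p :: "'i \<Rightarrow> 'v::euclidean_space"
  assumes h: "0 < h" "h < 1" and \<kappa>: "\<kappa> > 0"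
    and LND: "\<forall>(I :: 'i set) (p :: 'i \<Rightarrow> 'v) (s :: 'i \<Rightarrow> real) a b.
      finite I \<and> 0 \<le> a \<and> a \<le> b \<and> (\<forall>i\<in>I. s i \<le> a \<or> b \<le> s i) \<longrightarrow>
      \<kappa> * (norm (\<Sum>i\<in>{i\<in>I. b \<le> s i}. p i))\<^sup>2 * (b - a) powr (2 * h) \<le> fbm_form h I p s"
    and xs: "distinct xs" "sorted (map s xs)" and s: "\<And>i. i \<in> set xs \<Longrightarrow> 0 \<le> s i"
  shows "exp (- fbm_form h (set xs) p s / 2) \<le> increment_exp (\<kappa> / (2 * length xs)) h p s 0 xs"
proof (cases "xs = []")
  case True
  thus ?thesis by (simp add: fbm_form_def)
next
  case False
  define V where "V = fbm_form h (set xs) p s"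
  define N where "N = real (length xs)"
  have N: "N > 0" using False by (simp add: N_def)
  \<comment> \<open>Each entry of the list consumes the share \<open>V / (2 * N)\<close>. The prefix
    \<open>ys\<close> is kept because the gap bound always refers to the variance of the complete
    list.\<close>
  have "exp (- (real (length zs) * V / (2 * N))) \<le> increment_exp (\<kappa> / (2 * N)) h p s c zs"
    if "xs = ys @ zs" "0 \<le> c" "\<forall>i\<in>set ys. s i \<le> c" "\<forall>i\<in>set zs. c \<le> s i" for ys zs c
    using that
  proof (induction zs arbitrary: ys c)
    case (Cons a zs)
    have srt: "s a \<le> s i" if "i \<in> set zs" for i
      using xs(2) Cons.prems(1) that by (auto simp: sorted_append)
    have ys: "s i \<le> s a" if "i \<in> set ys" for i
      using xs(2) Cons.prems(1) that by (auto simp: sorted_append)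
    let ?u = "sum_list (map p (a # zs))"
    \<comment> \<open>With a tie \<open>c = s a\<close>, indices of the prefix may also satisfy
      \<open>s a \<le> s i\<close>, but then the left side vanishes because
      \<open>0 powr (2 * h) = 0\<close>. Without a tie these indices are exactly those of the
      suffix.\<close>
    have "\<kappa> * (norm ?u)\<^sup>2 * \<bar>s a - c\<bar> powr (2 * h) \<le> V"
    proof (cases "c = s a")
      case True
      thus ?thesis using fbm_form_nonneg[OF h, of "set xs" p s] by (simp add: V_def)
    next
      case False
      hence "c < s a" using Cons.prems(4) by auto
      hence "{i \<in> set xs. s a \<le> s i} = set (a # zs)"
        using Cons.prems srt by fastforce
      moreover have "distinct (a # zs)" using xs(1) Cons.prems(1) by simp
      ultimately have "?u = (\<Sum>i\<in>{i \<in> set xs. s a \<le> s i}. p i)"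
        by (simp add: sum_list_distinct_conv_sum_set)
      moreover have "\<kappa> * (norm (\<Sum>i\<in>{i\<in>set xs. s a \<le> s i}. p i))\<^sup>2 * (s a - c) powr (2 * h) \<le> V"
        unfolding V_def using Cons.prems srt \<open>c < s a\<close> by (intro LND[rule_format]) auto
      ultimately show ?thesis using \<open>c < s a\<close> by simp
    qed
    hence "\<kappa> / (2*N) * (norm ?u)\<^sup>2 * \<bar>s a - c\<bar> powr (2 * h) \<le> V / (2*N)"
      using N by (simp add: field_simps)
    hence 1: "exp (- (V / (2*N))) \<le> exp (- (\<kappa> / (2*N) * (norm ?u)\<^sup>2 * \<bar>s a - c\<bar> powr (2 * h)))"
      by simp
    have 2: "exp (- (real (length zs) * V / (2 * N))) \<le> increment_exp (\<kappa> / (2 * N)) h p s (s a) zs"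
      by (rule Cons.IH[of "ys @ [a]"]) (use Cons.prems ys srt s in auto)
    have "exp (- (real (length (a#zs)) * V / (2 * N))) = exp (- (V / (2*N))) * exp (- (real (length zs) * V / (2 * N)))"
      by (simp add: exp_add[symmetric] add_divide_distrib[symmetric] algebra_simps)
    also have "\<dots> \<le> exp (- (\<kappa> / (2*N) * (norm ?u)\<^sup>2 * \<bar>s a - c\<bar> powr (2 * h))) * increment_exp (\<kappa> / (2 * N)) h p s (s a) zs"
      using 1 2 by (intro mult_mono) auto
    finally show ?case by simp
  qed simp
  from this[of "[]" xs 0] show ?thesis using s N by (simp add: V_def N_def)
qed

text \<open>With \<open>w = U * z powr h\<close> this follows from \<open>(1 + U) * z powr h \<le> 1 + w\<close> and
  \<open>\<theta> * w - \<kappa> * w\<^sup>2 \<le> \<theta>\<^sup>2 / (4 * \<kappa>)\<close>.\<close>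

lemma exp_increment_bound:
  fixes \<kappa> h \<theta> U z :: real
  assumes "\<kappa> > 0" "h > 0" "\<theta> \<ge> 0" "U \<ge> 0" "0 < z" "z \<le> 1"
  shows "exp (- (\<kappa> * U\<^sup>2 * z powr (2 * h))) \<le> exp (\<theta>\<^sup>2 / (4 * \<kappa>)) * (1 + U) powr (-\<theta>) * z powr (- (h * \<theta>))"
proof -
  define w where "w = U * z powr h"
  have w: "w \<ge> 0" using assms by (simp add: w_def)
  have "(z powr h)\<^sup>2 = z powr (2 * h)" by (simp add: power2_eq_square powr_add[symmetric])
  hence w2: "U\<^sup>2 * z powr (2 * h) = w\<^sup>2" by (simp add: w_def power_mult_distrib)
  have "z powr h \<le> 1" using assms by (simp add: powr_le1)
  hence le: "(1 + U) * z powr h \<le> 1 + w" by (simp add: w_def algebra_simps)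
  have "0 \<le> (2 * \<kappa> * w - \<theta>)\<^sup>2" by simp
  hence "4 * \<kappa> * (\<theta> * w - \<kappa> * w\<^sup>2) \<le> \<theta>\<^sup>2" by (simp add: power2_eq_square algebra_simps)
  hence "\<theta> * w - \<kappa> * w\<^sup>2 \<le> \<theta>\<^sup>2 / (4 * \<kappa>)" using assms by (simp add: field_simps)
  hence "- (\<kappa> * w\<^sup>2) \<le> \<theta>\<^sup>2 / (4 * \<kappa>) - \<theta> * w" by simp
  hence "exp (- (\<kappa> * w\<^sup>2)) \<le> exp (\<theta>\<^sup>2 / (4 * \<kappa>)) * exp (- (\<theta> * w))"
    by (simp add: exp_add[symmetric])
  also have "exp (- (\<theta> * w)) \<le> (1 + w) powr (-\<theta>)"
  proof -
    have "(1 + w) powr \<theta> \<le> exp w powr \<theta>"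
      using w assms exp_ge_add_one_self[of w] by (intro powr_mono2) auto
    also have "\<dots> = exp (\<theta> * w)" by (simp add: powr_def)
    finally show ?thesis using w by (simp add: powr_minus exp_minus le_imp_inverse_le)
  qed
  also have "(1 + w) powr (-\<theta>) \<le> ((1 + U) * z powr h) powr (-\<theta>)"
    using le assms by (intro powr_mono2') auto
  also have "\<dots> = (1 + U) powr (-\<theta>) * z powr (- (h * \<theta>))"
    using assms by (simp add: powr_mult powr_powr)
  finally show ?thesis using w2 by (simp add: mult.assoc)
qed

text \<open>The pointwise bound leaves the singularity
  \<open>\<bar>y - c\<bar> powr (- (h * \<theta>))\<close>, integrable since
  \<open>h * \<theta> < 1\<close>. As \<open>y - c\<close> stays in \<open>{-1..1}\<close>,
  integrating over that whole interval yields a constant that is uniform in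
  \<open>c\<close>.\<close>

lemma nn_integral_exp_increment_bound:
  assumes "\<kappa> > 0" "h > 0" "\<theta> \<ge> 0" "h * \<theta> < 1"
  obtains C :: real where "C \<ge> 0"
    "\<forall>c\<in>{0..1}. \<forall>U\<ge>0.
       (\<integral>\<^sup>+y. ennreal (exp (- (\<kappa> * U\<^sup>2 * \<bar>y - c\<bar> powr (2 * h)))) \<partial>unit_lborel) \<le> ennreal (C * (1 + U) powr (-\<theta>))"
proof
  show "exp (\<theta>\<^sup>2 / (4 * \<kappa>)) * (LBINT x. indicator {-1..1} x * \<bar>x\<bar> powr (- (h * \<theta>))) \<ge> 0"
    by (intro mult_nonneg_nonneg Bochner_Integration.integral_nonneg) auto
next
  show "\<forall>c\<in>{0..1}. \<forall>U\<ge>0. (\<integral>\<^sup>+y. ennreal (exp (- (\<kappa> * U\<^sup>2 * \<bar>y - c\<bar> powr (2 * h)))) \<partial>unit_lborel)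
      \<le> ennreal (exp (\<theta>\<^sup>2 / (4 * \<kappa>)) * (LBINT x. indicator {-1..1} x * \<bar>x\<bar> powr (- (h * \<theta>))) * (1 + U) powr (-\<theta>))"
  proof (intro ballI allI impI)
    fix c U :: real assume c: "c \<in> {0..1}" and U: "U \<ge> 0"
    let ?g = "\<lambda>x::real. indicator {-1..1} x * \<bar>x\<bar> powr (- (h * \<theta>))"
    let ?K = "LBINT x. ?g x"
    have K: "?K \<ge> 0" by (intro Bochner_Integration.integral_nonneg) simp
    have int: "integrable lborel ?g" by (rule integrable_powr_near_0) (use assms in simp)
    let ?D = "exp (\<theta>\<^sup>2 / (4 * \<kappa>)) * (1 + U) powr (-\<theta>)"
    have "(\<integral>\<^sup>+y. ennreal (exp (- (\<kappa> * U\<^sup>2 * \<bar>y - c\<bar> powr (2 * h)))) \<partial>unit_lborel)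
        = (\<integral>\<^sup>+y. ennreal (indicator {0..1} y) * ennreal (exp (- (\<kappa> * U\<^sup>2 * \<bar>y - c\<bar> powr (2 * h)))) \<partial>lborel)"
      unfolding unit_lborel_def by (subst nn_integral_density) auto
    also have "\<dots> \<le> (\<integral>\<^sup>+y. ennreal ?D * ennreal (?g (- c + 1 * y)) \<partial>lborel)"
    proof (rule nn_integral_mono_AE)
      \<comment> \<open>At \<open>y = c\<close> the comparison fails, as \<open>0 powr\<close>
        anything is 0 while the exponential is 1.\<close>
      have "AE y in lborel. y \<noteq> c" by (rule AE_lborel_singleton)
      thus "AE y in lborel. ennreal (indicator {0..1} y) * ennreal (exp (- (\<kappa> * U\<^sup>2 * \<bar>y - c\<bar> powr (2 * h))))
          \<le> ennreal ?D * ennreal (?g (- c + 1 * y))"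
      proof (rule AE_mp, intro AE_I2 impI)
        fix y assume y: "y \<noteq> c"
        show "ennreal (indicator {0..1} y) * ennreal (exp (- (\<kappa> * U\<^sup>2 * \<bar>y - c\<bar> powr (2 * h))))
          \<le> ennreal ?D * ennreal (?g (- c + 1 * y))"
        proof (cases "y \<in> {0..1}")
          case True
          have "exp (- (\<kappa> * U\<^sup>2 * \<bar>y - c\<bar> powr (2 * h))) \<le> ?D * \<bar>y - c\<bar> powr (- (h * \<theta>))"
            by (rule exp_increment_bound) (use assms U y c True in auto)
          thus ?thesis using True c y
            by (auto simp: ennreal_mult[symmetric] indicator_def intro!: ennreal_leI)
        qed simp
      qed
    qed
    also have "\<dots> = ennreal ?D * (\<integral>\<^sup>+y. ennreal (?g (- c + 1 * y)) \<partial>lborel)"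
      by (rule nn_integral_cmult) measurable
    also have "(\<integral>\<^sup>+y. ennreal (?g (- c + 1 * y)) \<partial>lborel) = (\<integral>\<^sup>+y. ennreal (?g y) \<partial>lborel)"
      by (subst nn_integral_real_affine[of "\<lambda>y. ennreal (?g y)" 1 "-c"]) auto
    also have "\<dots> = ennreal ?K"
      by (rule nn_integral_eq_integral[OF int]) simp
    finally show "(\<integral>\<^sup>+y. ennreal (exp (- (\<kappa> * U\<^sup>2 * \<bar>y - c\<bar> powr (2 * h)))) \<partial>unit_lborel)
        \<le> ennreal (exp (\<theta>\<^sup>2 / (4 * \<kappa>)) * ?K * (1 + U) powr (-\<theta>))"
      using K by (simp add: ennreal_mult[symmetric] mult_ac)
  qed
qed

text \<open>The ordering of the times is given up here: with the absolute value in
  \<open>increment_exp\<close> the integral runs over the whole cube. Since the one-variable bound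
  is uniform in the preceding time, the times can be integrated out one by one, the last one
  innermost.\<close>

lemma nn_integral_increment_exp_le:
  fixes p :: "'i \<Rightarrow> 'v::euclidean_space"
  assumes C: "C \<ge> 0"
    "\<forall>c\<in>{0..1}. \<forall>U\<ge>0.
       (\<integral>\<^sup>+y. ennreal (exp (- (\<kappa> * U\<^sup>2 * \<bar>y - c\<bar> powr (2 * h)))) \<partial>unit_lborel) \<le> ennreal (C * (1 + U) powr (-\<theta>))"
    and "distinct xs" "c \<in> {0..1}"
  shows "(\<integral>\<^sup>+s. ennreal (increment_exp \<kappa> h p s c xs) \<partial>PiM (set xs) (\<lambda>_. unit_lborel))
    \<le> suffix_prod (\<lambda>u. ennreal (C * (1 + norm u) powr (-\<theta>))) p xs"
  using assms(3,4)
proof (induction xs arbitrary: c)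
  case Nil
  then show ?case by (simp add: PiM_empty)
next
  case (Cons a xs)
  interpret prob_space unit_lborel by (rule prob_space_unit_lborel)
  interpret P: product_sigma_finite "\<lambda>_. unit_lborel" by unfold_locales
  let ?u = "norm (sum_list (map p (a # xs)))"
  let ?e = "\<lambda>y. exp (- (\<kappa> * ?u\<^sup>2 * \<bar>y - c\<bar> powr (2 * h)))"
  have "(\<integral>\<^sup>+s. ennreal (increment_exp \<kappa> h p s c (a # xs)) \<partial>PiM (set (a # xs)) (\<lambda>_. unit_lborel))
     = (\<integral>\<^sup>+y. \<integral>\<^sup>+s. ennreal (increment_exp \<kappa> h p (s(a := y)) c (a # xs)) \<partial>PiM (set xs) (\<lambda>_. unit_lborel) \<partial>unit_lborel)"
    unfolding list.set using Cons.prems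
    by (intro P.product_nn_integral_insert_rev measurable_compose[OF increment_exp_measurable measurable_ennreal]) auto
  also have "\<dots> = (\<integral>\<^sup>+y. ennreal (?e y) *
       (\<integral>\<^sup>+s. ennreal (increment_exp \<kappa> h p s y xs) \<partial>PiM (set xs) (\<lambda>_. unit_lborel)) \<partial>unit_lborel)"
  proof (intro nn_integral_cong)
    fix y
    have m: "(\<lambda>s. ennreal (increment_exp \<kappa> h p s y xs)) \<in> borel_measurable (PiM (set xs) (\<lambda>_. unit_lborel))"
      by (rule measurable_compose[OF increment_exp_measurable[where c = "\<lambda>_. y"] measurable_ennreal]) auto
    have "increment_exp \<kappa> h p (s(a := y)) y xs = increment_exp \<kappa> h p s y xs" for s
      by (rule increment_exp_cong) (use Cons.prems in auto)
    thus "(\<integral>\<^sup>+s. ennreal (increment_exp \<kappa> h p (s(a := y)) c (a # xs)) \<partial>PiM (set xs) (\<lambda>_. unit_lborel))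
      = ennreal (?e y) * (\<integral>\<^sup>+s. ennreal (increment_exp \<kappa> h p s y xs) \<partial>PiM (set xs) (\<lambda>_. unit_lborel))"
      by (simp add: ennreal_mult increment_exp_nonneg nn_integral_cmult[OF m])
  qed
  also have "\<dots> \<le> (\<integral>\<^sup>+y. ennreal (?e y) * suffix_prod (\<lambda>u. ennreal (C * (1 + norm u) powr (-\<theta>))) p xs \<partial>unit_lborel)"
    using AE_unit_lborel Cons
    by (intro nn_integral_mono_AE, elim eventually_mono) (auto intro!: mult_left_mono)
  also have "\<dots> = (\<integral>\<^sup>+y. ennreal (?e y) \<partial>unit_lborel) * suffix_prod (\<lambda>u. ennreal (C * (1 + norm u) powr (-\<theta>))) p xs"
    by (rule nn_integral_multc) auto
  also have "\<dots> \<le> suffix_prod (\<lambda>u. ennreal (C * (1 + norm u) powr (-\<theta>))) p (a # xs)"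
    unfolding suffix_prod.simps using Cons.prems by (intro mult_right_mono C(2)[rule_format]) auto
  finally show ?case .
qed

section \<open>Integration over the frequencies\<close>

lemma suffix_prod_cong:
  assumes "\<And>i. i \<in> set xs \<Longrightarrow> p i = q i"
  shows "suffix_prod g p xs = suffix_prod g q xs"
proof -
  have "map p ys = map q ys" if "set ys \<subseteq> set xs" for ys
    using that assms by (intro map_cong) auto
  moreover have "set xs \<subseteq> set xs" ..
  ultimately show ?thesis
  proof (induction xs)
    case (Cons a xs)
    have "map p (a # xs) = map q (a # xs)" by (rule Cons.prems) auto
    moreover have "suffix_prod g p xs = suffix_prod g q xs"
      using Cons.prems by (intro Cons.IH) auto
    ultimately show ?case by (simp only: suffix_prod.simps)
  qed simp
qed

lemma suffix_prod_measurable: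
  fixes g :: "'v::euclidean_space \<Rightarrow> ennreal"
  assumes [measurable]: "g \<in> borel_measurable borel" and "set xs \<subseteq> I"
  shows "(\<lambda>p. suffix_prod g p xs) \<in> borel_measurable (PiM I (\<lambda>_. lborel))"
  using assms(2)
proof (induction xs)
  case (Cons a xs)
  have 1: "(\<lambda>p. sum_list (map p ys)) \<in> borel_measurable (PiM I (\<lambda>_. lborel))"
    if "set ys \<subseteq> I" for ys :: "'a list" using that
  proof (induction ys)
    case (Cons b ys)
    have "(\<lambda>p. p b) \<in> measurable (PiM I (\<lambda>_. lborel)) lborel"
      using Cons.prems by (intro measurable_component_singleton) auto
    hence [measurable]: "(\<lambda>p. p b) \<in> borel_measurable (PiM I (\<lambda>_. lborel))" by simp
    show ?case using Cons by simp
  qed simp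
  have [measurable]: "(\<lambda>p. sum_list (map p (a # xs))) \<in> borel_measurable (PiM I (\<lambda>_. lborel))"
    by (rule 1) (use Cons.prems in auto)
  have [measurable]: "(\<lambda>p. suffix_prod g p xs) \<in> borel_measurable (PiM I (\<lambda>_. lborel))"
    using Cons by simp
  show ?case unfolding suffix_prod.simps by measurable
qed simp

text \<open>The passage from frequencies to suffix sums is triangular with unit diagonal. It is
  carried out one variable at a time: the head of the list occurs only in the first factor, where
  translation invariance removes the other summands.\<close>

lemma nn_integral_suffix_prod:
  fixes g :: "'v::euclidean_space \<Rightarrow> ennreal"
  assumes [measurable]: "g \<in> borel_measurable borel" and "distinct xs"
  shows "(\<integral>\<^sup>+p. suffix_prod g p xs \<partial>PiM (set xs) (\<lambda>_. lborel)) = (\<integral>\<^sup>+u. g u \<partial>lborel) ^ length xs"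
  using assms(2)
proof (induction xs)
  case (Cons a xs)
  interpret P: product_sigma_finite "\<lambda>_. lborel :: 'v measure" by unfold_locales
  have "(\<integral>\<^sup>+p. suffix_prod g p (a # xs) \<partial>PiM (set (a # xs)) (\<lambda>_. lborel))
      = (\<integral>\<^sup>+p. \<integral>\<^sup>+y. suffix_prod g (p(a := y)) (a # xs) \<partial>lborel \<partial>PiM (set xs) (\<lambda>_. lborel))"
    unfolding list.set using Cons.prems
    by (intro P.product_nn_integral_insert suffix_prod_measurable) auto
  also have "\<dots> = (\<integral>\<^sup>+p. (\<integral>\<^sup>+u. g u \<partial>lborel) * suffix_prod g p xs \<partial>PiM (set xs) (\<lambda>_. lborel))"
  proof (intro nn_integral_cong)
    fix p :: "'a \<Rightarrow> 'v"
    have m: "map (p(a := y)) xs = map p xs" for y using Cons.prems by auto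
    have "suffix_prod g (p(a := y)) xs = suffix_prod g p xs" for y
      by (rule suffix_prod_cong) (use Cons.prems in auto)
    hence "(\<integral>\<^sup>+y. suffix_prod g (p(a := y)) (a # xs) \<partial>lborel) = (\<integral>\<^sup>+y. g (sum_list (map p xs) + y) * suffix_prod g p xs \<partial>lborel)"
      by (simp only: suffix_prod.simps list.map sum_list.Cons m fun_upd_same add.commute)
    also have "\<dots> = (\<integral>\<^sup>+y. g (sum_list (map p xs) + y) \<partial>lborel) * suffix_prod g p xs"
      by (rule nn_integral_multc) measurable
    also have "(\<integral>\<^sup>+y. g (sum_list (map p xs) + y) \<partial>lborel) = (\<integral>\<^sup>+y. g y \<partial>lborel)"
      using nn_integral_distr[of "(+) (sum_list (map p xs))" lborel borel g]
      by (simp add: lborel_distr_plus)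
    finally show "(\<integral>\<^sup>+y. suffix_prod g (p(a := y)) (a # xs) \<partial>lborel) = (\<integral>\<^sup>+u. g u \<partial>lborel) * suffix_prod g p xs" .
  qed
  also have "\<dots> = (\<integral>\<^sup>+u. g u \<partial>lborel) * (\<integral>\<^sup>+p. suffix_prod g p xs \<partial>PiM (set xs) (\<lambda>_. lborel))"
    by (rule nn_integral_cmult, rule suffix_prod_measurable) auto
  finally show ?case using Cons by simp
qed (simp add: PiM_empty)

text \<open>Each \<open>p i\<close> is a difference of two consecutive suffix sums; the extra factor on the left
  makes the induction work.\<close>

lemma prod_norm_le_suffix_prod:
  fixes p :: "'i \<Rightarrow> 'v::real_normed_vector"
  assumes "distinct xs"
  shows "(1 + norm (sum_list (map p xs))) * (\<Prod>i\<in>set xs. norm (p i)) \<le> suffix_prod (\<lambda>u. (1 + norm u)\<^sup>2) p xs"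
  using assms
proof (induction xs)
  case (Cons a xs)
  let ?u = "sum_list (map p xs)" and ?v = "sum_list (map p (a # xs))"
  let ?P = "\<Prod>i\<in>set xs. norm (p i)"
  have P: "?P \<ge> 0" by (simp add: prod_nonneg)
  have "norm (p a) \<le> norm ?v + norm ?u"
    using norm_triangle_ineq4[of ?v ?u] by simp
  also have "\<dots> \<le> (1 + norm ?v) * (1 + norm ?u)" by (simp add: algebra_simps)
  finally have "(1 + norm ?v) * norm (p a) * ?P \<le> (1 + norm ?v) * ((1 + norm ?v) * (1 + norm ?u)) * ?P"
    using P by (intro mult_right_mono mult_left_mono) auto
  also have "\<dots> = (1 + norm ?v)\<^sup>2 * ((1 + norm ?u) * ?P)" by (simp add: power2_eq_square)
  also have "\<dots> \<le> (1 + norm ?v)\<^sup>2 * suffix_prod (\<lambda>u. (1 + norm u)\<^sup>2) p xs"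
    using Cons by (intro mult_left_mono) auto
  finally show ?case using Cons.prems by (simp add: mult.assoc)
qed simp

lemma suffix_prod_ennreal:
  assumes "\<And>u. 0 \<le> g u"
  shows "suffix_prod (\<lambda>u. ennreal (g u)) p xs = ennreal (suffix_prod g p xs)" "0 \<le> suffix_prod g p xs"
proof -
  show *: "0 \<le> suffix_prod g p xs" for xs by (induction xs) (auto simp: assms)
  show "suffix_prod (\<lambda>u. ennreal (g u)) p xs = ennreal (suffix_prod g p xs)"
    by (induction xs) (auto simp: ennreal_mult assms *)
qed

lemma suffix_prod_mult:
  fixes f g :: "_ \<Rightarrow> 'r::comm_monoid_mult"
  shows "suffix_prod (\<lambda>u. f u * g u) p xs = suffix_prod f p xs * suffix_prod g p xs"
  by (induction xs) (auto simp: mult_ac)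

lemma suffix_prod_power:
  fixes f :: "_ \<Rightarrow> 'r::comm_monoid_mult"
  shows "suffix_prod (\<lambda>u. f u ^ n) p xs = suffix_prod f p xs ^ n"
  by (induction xs) (auto simp: power_mult_distrib)


text \<open>Splitting the exponent evenly over the coordinates and using that each coordinate is at
  most the norm gives a product of one-dimensional functions with exponent
  \<open>\<beta> / DIM('v) > 1\<close>; no polar coordinates are needed.\<close>

lemma nn_integral_one_plus_norm_powr:
  fixes \<beta> :: real
  assumes "\<beta> > DIM('v)"
  shows "(\<integral>\<^sup>+u. ennreal ((1 + norm u) powr (-\<beta>)) \<partial>(lborel :: 'v::euclidean_space measure)) < \<infinity>"
proof -
  define a where "a = \<beta> / DIM('v)"
  have a: "a > 1" using assms by (simp add: a_def)
  let ?f = "\<lambda>x::real. (1 + \<bar>x\<bar>) powr (-a)"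
  have "integrable lborel (indicator {-1..1} :: real \<Rightarrow> real)"
       "integrable lborel (\<lambda>x::real. indicator {x. 1 \<le> \<bar>x\<bar>} x * \<bar>x\<bar> powr (-a))"
    by (simp, rule integrable_powr_at_infinity, use a in simp)
  from Bochner_Integration.integrable_add[OF this] have int: "integrable lborel ?f"
  proof (rule Bochner_Integration.integrable_bound, measurable, intro AE_I2)
    fix x :: real
    have "?f x \<le> 1" using a by (simp add: powr_minus_divide ge_one_powr_ge_zero)
    moreover have "?f x \<le> \<bar>x\<bar> powr (-a)" if "x \<noteq> 0" using a that by (intro powr_mono2') auto
    moreover have "?f 0 = 1" by simp
    ultimately show "norm (?f x) \<le> norm (indicator {-1..1} x + indicator {x. 1 \<le> \<bar>x\<bar>} x * \<bar>x\<bar> powr (-a))"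
      by (cases "x = 0"; cases "\<bar>x\<bar> < 1") (auto simp: indicator_def intro: add_increasing2 )
  qed
  have "(\<integral>\<^sup>+u. ennreal ((1 + norm u) powr (-\<beta>)) \<partial>(lborel :: 'v measure))
      \<le> (\<integral>\<^sup>+u. (\<Prod>b\<in>Basis. ennreal (?f (u \<bullet> b))) \<partial>(lborel :: 'v measure))"
  proof (rule nn_integral_mono)
    fix u :: 'v
    have "(1 + norm u) powr (-\<beta>) = (\<Prod>b\<in>(Basis :: 'v set). (1 + norm u) powr (-a))"
      by (simp add: a_def powr_power add_nonneg_eq_0_iff)
    also have "\<dots> \<le> (\<Prod>b\<in>Basis. ?f (u \<bullet> b))"
      using a Basis_le_norm[of _ u] by (intro prod_mono) (auto intro!: powr_mono2')
    finally show "ennreal ((1 + norm u) powr (-\<beta>)) \<le> (\<Prod>b\<in>Basis. ennreal (?f (u \<bullet> b)))"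
      by (simp add: prod_ennreal ennreal_leI)
  qed
  also have "\<dots> = (\<Prod>b\<in>(Basis :: 'v set). \<integral>\<^sup>+x. ennreal (?f x) \<partial>lborel)"
    by (rule nn_integral_lborel_prod) auto
  also have "\<dots> < \<infinity>"
    using nn_integral_eq_integral[OF int] by (simp add: power_less_top_ennreal)
  finally show ?thesis .
qed

section \<open>Bounds for the mixed moments\<close>

definition fbm_time_integral :: "real \<Rightarrow> nat \<Rightarrow> (nat \<Rightarrow> 'v::euclidean_space) \<Rightarrow> real" where
  "fbm_time_integral h N p = (LINT s|PiM {..<N} (\<lambda>_. unit_lborel). exp (- fbm_form h {..<N} p s / 2))"

lemma borel_measurable_PiM_component:
  fixes M :: "'b::topological_space measure"
  assumes "sets M = sets borel" "i \<in> I"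
  shows "(\<lambda>s. s i) \<in> borel_measurable (PiM I (\<lambda>_. M))"
proof -
  have "(\<lambda>s. s i) \<in> measurable (PiM I (\<lambda>_. M)) M"
    using assms(2) by (rule measurable_component_singleton)
  thus ?thesis using assms(1) by (simp add: measurable_cong_sets[OF refl assms(1)])
qed

lemma fbm_form_measurable_PiM:
  fixes p :: "'i \<Rightarrow> 'v::euclidean_space"
  shows "(\<lambda>s. fbm_form h I p s) \<in> borel_measurable (PiM I (\<lambda>_. unit_lborel))"
  unfolding fbm_form_def fbm_cov_def
  by (intro borel_measurable_sum borel_measurable_times borel_measurable_divide borel_measurable_diff
       borel_measurable_add borel_measurable_const powr_real_measurable borel_measurable_abs
       borel_measurable_PiM_component sets_unit_lborel)

text \<open>The cube is not cut into simplices. At each point the integrand is bounded by the term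
  of the sorted order, hence by the sum of the nonnegative terms of all orders, and every term is
  integrated over the full cube.\<close>

lemma fbm_time_integral_bound:
  assumes h: "0 < h" "h < 1" and \<theta>: "\<theta> \<ge> 0" "h * \<theta> < 1"
  obtains C :: real where "C \<ge> 0"
    "\<forall>p :: nat \<Rightarrow> 'v::euclidean_space.
       fbm_time_integral h N p \<le> (\<Sum>xs\<in>{xs. distinct xs \<and> set xs = {..<N}}. suffix_prod (\<lambda>u. C * (1 + norm u) powr (-\<theta>)) p xs)"
proof -
  obtain \<kappa> where \<kappa>: "\<kappa> > 0"
    "\<forall>(I :: nat set) (p :: nat \<Rightarrow> 'v) (s :: nat \<Rightarrow> real) a b.
      finite I \<and> 0 \<le> a \<and> a \<le> b \<and> (\<forall>i\<in>I. s i \<le> a \<or> b \<le> s i) \<longrightarrow>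
      \<kappa> * (norm (\<Sum>i\<in>{i\<in>I. b \<le> s i}. p i))\<^sup>2 * (b - a) powr (2 * h) \<le> fbm_form h I p s"
    by (rule fbm_local_nondeterminism[OF h, where 'i = nat and 'v = 'v]) (rule that)
  \<comment> \<open>The case distinction keeps the constant positive for \<open>N = 0\<close>, where
    \<open>length xs\<close> would give a division by 0.\<close>
  define \<kappa>' where "\<kappa>' = \<kappa> / (2 * (if N = 0 then 1 else real N))"
  have \<kappa>': "\<kappa>' > 0" using \<kappa> by (simp add: \<kappa>'_def)
  obtain C :: real where C: "C \<ge> 0"
    "\<forall>c\<in>{0..1}. \<forall>U\<ge>0.
       (\<integral>\<^sup>+y. ennreal (exp (- (\<kappa>' * U\<^sup>2 * \<bar>y - c\<bar> powr (2 * h)))) \<partial>unit_lborel) \<le> ennreal (C * (1 + U) powr (-\<theta>))"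
    by (rule nn_integral_exp_increment_bound[OF \<kappa>' h(1) \<theta>]) (rule that)
  let ?L = "{xs. distinct xs \<and> set xs = {..<N}}"
  have fin: "finite ?L"
    by (rule finite_subset[OF _ finite_subset_distinct[of "{..<N}"]]) auto
  let ?P = "PiM {..<N} (\<lambda>_. unit_lborel)"
  interpret U: prob_space unit_lborel by (rule prob_space_unit_lborel)
  interpret P: prob_space ?P by (intro prob_space_PiM prob_space_unit_lborel)
  interpret PP: finite_product_prob_space "\<lambda>_. unit_lborel" "{..<N}" by unfold_locales auto
  let ?g = "\<lambda>u::'v. C * (1 + norm u) powr (-\<theta>)"
  have g: "0 \<le> ?g u" for u using C(1) by simp
  show ?thesis
  proof (rule that[OF C(1)], rule allI)
    fix p :: "nat \<Rightarrow> 'v"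
    have "AE s in ?P. s i \<in> {0..1}" if "i < N" for i
      using AE_unit_lborel that by (intro AE_PiM_component prob_space_unit_lborel) auto
    hence AE: "AE s in ?P. \<forall>i\<in>{..<N}. s i \<in> {0..1}" by (intro AE_finite_allI) auto
    have pw: "exp (- fbm_form h {..<N} p s / 2) \<le> (\<Sum>xs\<in>?L. increment_exp \<kappa>' h p s 0 xs)"
      if "\<forall>i\<in>{..<N}. s i \<in> {0..1}" for s
    proof -
      define xs where "xs = sort_key s [0..<N]"
      have xs: "distinct xs" "set xs = {..<N}" "sorted (map s xs)" by (auto simp: xs_def)
      have "length xs = N" by (simp add: xs_def)
      have "exp (- fbm_form h {..<N} p s / 2) = exp (- fbm_form h (set xs) p s / 2)" by (simp add: xs)
      also have "\<dots> \<le> increment_exp (\<kappa> / (2 * length xs)) h p s 0 xs"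
        using that xs by (intro exp_fbm_form_le_increment_exp h \<kappa>) auto
      also have "\<dots> = increment_exp \<kappa>' h p s 0 xs"
        using \<open>length xs = N\<close> by (cases "N = 0") (auto simp: \<kappa>'_def)
      also have "\<dots> \<le> (\<Sum>xs\<in>?L. increment_exp \<kappa>' h p s 0 xs)"
        using fin xs by (intro member_le_sum increment_exp_nonneg) auto
      finally show ?thesis .
    qed
    have int: "integrable ?P (\<lambda>s. exp (- fbm_form h {..<N} p s / 2))"
    proof (rule P.integrable_const_bound[where B = 1])
      show "AE s in ?P. norm (exp (- fbm_form h {..<N} p s / 2)) \<le> 1"
        by (intro AE_I2) (simp add: fbm_form_nonneg[OF h])
    next
      note fbm_form_measurable_PiM[measurable]
      show "(\<lambda>s. exp (- fbm_form h {..<N} p s / 2)) \<in> borel_measurable ?P" by measurable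
    qed
    have "ennreal (fbm_time_integral h N p) = (\<integral>\<^sup>+s. ennreal (exp (- fbm_form h {..<N} p s / 2)) \<partial>?P)"
      unfolding fbm_time_integral_def by (rule nn_integral_eq_integral[symmetric, OF int]) simp
    also have "\<dots> \<le> (\<integral>\<^sup>+s. (\<Sum>xs\<in>?L. ennreal (increment_exp \<kappa>' h p s 0 xs)) \<partial>?P)"
    proof (rule nn_integral_mono_AE)
      show "AE s in ?P. ennreal (exp (- fbm_form h {..<N} p s / 2)) \<le> (\<Sum>xs\<in>?L. ennreal (increment_exp \<kappa>' h p s 0 xs))"
        using AE by eventually_elim (use pw in \<open>simp add: sum_ennreal increment_exp_nonneg ennreal_leI\<close>)
    qed
    also have "\<dots> = (\<Sum>xs\<in>?L. \<integral>\<^sup>+s. ennreal (increment_exp \<kappa>' h p s 0 xs) \<partial>?P)"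
      by (intro nn_integral_sum measurable_compose[OF increment_exp_measurable[where c = "\<lambda>_. 0"] measurable_ennreal]) auto
    also have "\<dots> \<le> (\<Sum>xs\<in>?L. suffix_prod (\<lambda>u. ennreal (?g u)) p xs)"
    proof (rule sum_mono)
      fix xs :: "nat list" assume xs: "xs \<in> ?L"
      hence "?P = PiM (set xs) (\<lambda>_. unit_lborel)" by auto
      thus "(\<integral>\<^sup>+s. ennreal (increment_exp \<kappa>' h p s 0 xs) \<partial>?P) \<le> suffix_prod (\<lambda>u. ennreal (?g u)) p xs"
        using xs by (simp only:) (rule nn_integral_increment_exp_le[OF C], auto)
    qed
    also have "\<dots> = ennreal (\<Sum>xs\<in>?L. suffix_prod ?g p xs)"
      by (simp add: suffix_prod_ennreal[of ?g, OF g])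
    finally show "fbm_time_integral h N p \<le> (\<Sum>xs\<in>?L. suffix_prod ?g p xs)"
      by (simp add: suffix_prod_ennreal(2)[of ?g, OF g] ennreal_le_iff sum_nonneg)
  qed
qed

lemma nn_integral_moment_bound:
  fixes h :: real and K N :: nat
  assumes h: "0 < h" "h < 1" and K: "2 * real K * h + h * DIM('v) < 2"
  shows "(\<integral>\<^sup>+p. ennreal ((\<Prod>i<N. norm (p i) ^ K) * (fbm_time_integral h N p)\<^sup>2)
            \<partial>PiM {..<N} (\<lambda>_. lborel :: 'v::euclidean_space measure)) < \<infinity>"
proof -
  \<comment> \<open>The midpoint of the interval from \<open>real K + DIM('v) / 2\<close> to
    \<open>1 / h\<close>, which the hypothesis makes nonempty.\<close>
  define \<theta> where "\<theta> = (real K + DIM('v) / 2 + 1 / h) / 2"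
  have "real K + DIM('v) / 2 < 1 / h" using K h by (simp add: field_simps)
  hence \<theta>1: "2 * \<theta> > 2 * real K + DIM('v)" and "\<theta> < 1 / h" by (simp_all add: \<theta>_def)
  hence \<theta>: "\<theta> \<ge> 0" "h * \<theta> < 1" using h by (auto simp: \<theta>_def field_simps)
  let ?L = "{xs. distinct xs \<and> set xs = {..<N}}"
  obtain C :: real where C: "C \<ge> 0" "\<forall>p :: nat \<Rightarrow> 'v.
       fbm_time_integral h N p \<le> (\<Sum>xs\<in>?L. suffix_prod (\<lambda>u. C * (1 + norm u) powr (-\<theta>)) p xs)"
    by (rule fbm_time_integral_bound[OF h \<theta>, where 'v = 'v]) (rule that)
  have fin: "finite ?L"
    by (rule finite_subset[OF _ finite_subset_distinct[of "{..<N}"]]) auto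
  let ?g = "\<lambda>u::'v. C * (1 + norm u) powr (-\<theta>)"
  have g: "0 \<le> ?g u" for u using C(1) by simp
  define G where "G = (\<lambda>u::'v. C\<^sup>2 * (1 + norm u) powr (- (2 * \<theta> - 2 * real K)))"
  have G0: "0 \<le> G u" for u by (simp add: G_def)
  have Gint: "(\<integral>\<^sup>+u. ennreal (G u) \<partial>lborel) < \<infinity>"
  proof -
    have "(\<integral>\<^sup>+u. ennreal (G u) \<partial>lborel) = ennreal (C\<^sup>2) * (\<integral>\<^sup>+u. ennreal ((1 + norm (u::'v)) powr (- (2 * \<theta> - 2 * real K))) \<partial>lborel)"
      unfolding G_def by (subst nn_integral_cmult[symmetric]) (auto simp: ennreal_mult)
    moreover have "(\<integral>\<^sup>+u. ennreal ((1 + norm (u::'v)) powr (- (2 * \<theta> - 2 * real K))) \<partial>lborel) < \<infinity>"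
      by (rule nn_integral_one_plus_norm_powr) (use \<theta>1 in simp)
    ultimately show ?thesis by (simp add: ennreal_mult_less_top)
  qed
  have pw: "(\<Prod>i<N. norm (p i) ^ K) * (fbm_time_integral h N p)\<^sup>2 \<le> real (card ?L) * (\<Sum>xs\<in>?L. suffix_prod G p xs)"
    for p :: "nat \<Rightarrow> 'v"
  proof -
    let ?W = "\<Prod>i<N. norm (p i) ^ K"
    have W: "?W \<ge> 0" by (simp add: prod_nonneg)
    have "0 \<le> fbm_time_integral h N p" unfolding fbm_time_integral_def
      by (rule Bochner_Integration.integral_nonneg) simp
    hence "(fbm_time_integral h N p)\<^sup>2 \<le> (\<Sum>xs\<in>?L. suffix_prod ?g p xs)\<^sup>2"
      by (intro power_mono C(2)[rule_format])
    \<comment> \<open>Cauchy-Schwarz decouples the orders: a product of terms of two different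
      orders would not factor in the suffix sums of either, whereas the square of one term
      does.\<close>
    also have "\<dots> \<le> (\<Sum>xs\<in>?L. (suffix_prod ?g p xs)\<^sup>2) * (\<Sum>xs\<in>?L. 1\<^sup>2)"
      using Cauchy_Schwarz_ineq_sum[of "\<lambda>xs. suffix_prod ?g p xs" "\<lambda>_. 1" ?L] by simp
    also have "\<dots> = real (card ?L) * (\<Sum>xs\<in>?L. suffix_prod (\<lambda>u. (?g u)\<^sup>2) p xs)"
      by (simp add: suffix_prod_power)
    finally have "?W * (fbm_time_integral h N p)\<^sup>2 \<le> ?W * (real (card ?L) * (\<Sum>xs\<in>?L. suffix_prod (\<lambda>u. (?g u)\<^sup>2) p xs))"
      using W by (rule mult_left_mono)
    also have "\<dots> = real (card ?L) * (\<Sum>xs\<in>?L. ?W * suffix_prod (\<lambda>u. (?g u)\<^sup>2) p xs)"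
      by (simp add: sum_distrib_left mult_ac)
    also have "\<dots> \<le> real (card ?L) * (\<Sum>xs\<in>?L. suffix_prod G p xs)"
    proof (intro mult_left_mono sum_mono)
      fix xs :: "nat list" assume xs: "xs \<in> ?L"
      have "(\<Prod>i\<in>set xs. norm (p i)) \<le> (1 + norm (sum_list (map p xs))) * (\<Prod>i\<in>set xs. norm (p i))"
        by (simp add: algebra_simps prod_nonneg)
      also have "\<dots> \<le> suffix_prod (\<lambda>u. (1 + norm u)\<^sup>2) p xs"
        using xs by (intro prod_norm_le_suffix_prod) auto
      finally have "(\<Prod>i\<in>set xs. norm (p i)) ^ K \<le> suffix_prod (\<lambda>u. (1 + norm u)\<^sup>2) p xs ^ K"
        by (intro power_mono prod_nonneg) auto
      also have "(\<Prod>i\<in>set xs. norm (p i)) ^ K = ?W" using xs by (auto simp: prod_power_distrib)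
      finally have "?W * suffix_prod (\<lambda>u. (?g u)\<^sup>2) p xs
          \<le> suffix_prod (\<lambda>u. (1 + norm u)\<^sup>2) p xs ^ K * suffix_prod (\<lambda>u. (?g u)\<^sup>2) p xs"
        by (intro mult_right_mono suffix_prod_ennreal(2)) auto
      also have "\<dots> = suffix_prod (\<lambda>u. ((1 + norm u)\<^sup>2) ^ K * (?g u)\<^sup>2) p xs"
        by (simp only: suffix_prod_mult suffix_prod_power)
      also have "\<dots> = suffix_prod G p xs"
      proof -
        have "((1 + norm u)\<^sup>2) ^ K * (?g u)\<^sup>2 = G u" for u
        proof -
          have "1 + norm u > 0" by (simp add: add_pos_nonneg)
          moreover from this have "((1 + norm u)\<^sup>2) ^ K = (1 + norm u) powr (2 * real K)"
            using powr_realpow[of "1 + norm u" "2 * K"] by (simp add: power_mult[symmetric])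
          moreover have "((1 + norm u) powr (-\<theta>))\<^sup>2 = (1 + norm u) powr (- 2 * \<theta>)"
            by (simp add: power2_eq_square powr_add[symmetric])
          ultimately show ?thesis by (simp add: G_def power_mult_distrib powr_add[symmetric] mult_ac)
        qed
        thus ?thesis by simp
      qed
      finally show "?W * suffix_prod (\<lambda>u. (?g u)\<^sup>2) p xs \<le> suffix_prod G p xs" .
    qed simp
    finally show ?thesis .
  qed
  let ?P = "PiM {..<N} (\<lambda>_. lborel :: 'v measure)"
  have "(\<integral>\<^sup>+p. ennreal ((\<Prod>i<N. norm (p i) ^ K) * (fbm_time_integral h N p)\<^sup>2) \<partial>?P)
     \<le> (\<integral>\<^sup>+p. ennreal (real (card ?L)) * (\<Sum>xs\<in>?L. suffix_prod (\<lambda>u. ennreal (G u)) p xs) \<partial>?P)"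
  proof (rule nn_integral_mono)
    fix p :: "nat \<Rightarrow> 'v"
    have "ennreal (real (card ?L)) * (\<Sum>xs\<in>?L. suffix_prod (\<lambda>u. ennreal (G u)) p xs)
        = ennreal (real (card ?L) * (\<Sum>xs\<in>?L. suffix_prod G p xs))"
      by (simp add: suffix_prod_ennreal[of G, OF G0] ennreal_mult sum_nonneg)
    thus "ennreal ((\<Prod>i<N. norm (p i) ^ K) * (fbm_time_integral h N p)\<^sup>2)
        \<le> ennreal (real (card ?L)) * (\<Sum>xs\<in>?L. suffix_prod (\<lambda>u. ennreal (G u)) p xs)"
      using pw[of p] by (simp only: ennreal_leI)
  qed
  also have "\<dots> = ennreal (real (card ?L)) * (\<Sum>xs\<in>?L. \<integral>\<^sup>+p. suffix_prod (\<lambda>u. ennreal (G u)) p xs \<partial>?P)"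
  proof -
    have "(\<lambda>u. ennreal (G u)) \<in> borel_measurable borel" unfolding G_def by measurable
    hence m: "(\<lambda>p. suffix_prod (\<lambda>u. ennreal (G u)) p xs) \<in> borel_measurable ?P" if "xs \<in> ?L" for xs
      using that by (intro suffix_prod_measurable) auto
    have "(\<lambda>p. \<Sum>xs\<in>?L. suffix_prod (\<lambda>u. ennreal (G u)) p xs) \<in> borel_measurable ?P"
      by (intro borel_measurable_sum m)
    thus ?thesis by (simp only: nn_integral_cmult nn_integral_sum[OF m])
  qed
  also have "\<dots> = ennreal (real (card ?L)) * (\<Sum>xs\<in>?L. (\<integral>\<^sup>+u. ennreal (G u) \<partial>lborel) ^ length xs)"
  proof (intro arg_cong2[where f = "(*)"] sum.cong refl)
    fix xs :: "nat list" assume xs: "xs \<in> ?L"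
    hence eq: "?P = PiM (set xs) (\<lambda>_. lborel :: 'v measure)" by auto
    show "(\<integral>\<^sup>+p. suffix_prod (\<lambda>u. ennreal (G u)) p xs \<partial>?P) = (\<integral>\<^sup>+u. ennreal (G u) \<partial>lborel) ^ length xs"
      unfolding eq using xs by (intro nn_integral_suffix_prod) (auto simp: G_def)
  qed
  also have "\<dots> < \<infinity>"
    using Gint fin by (auto simp: ennreal_mult_less_top power_less_top_ennreal)
  finally show ?thesis .
qed

section \<open>Completeness of Lp in terms of a real parameter\<close>

text \<open>Interpolation with a free threshold \<open>t\<close>: small values are bounded by the
  threshold, large ones by the higher power. On a probability space it replaces Hoelder's
  inequality, once to pass from exponent \<open>n\<close> to 1 and once from an even integer
  \<open>N\<close> to \<open>n\<close>.\<close>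

lemma powr_le_add_powr:
  fixes y t n m :: real
  assumes "0 \<le> y" "0 < t" "0 \<le> n" "n \<le> m"
  shows "y powr n \<le> t powr n + t powr (n - m) * y powr m"
proof (cases "y \<le> t")
  case True
  hence "y powr n \<le> t powr n" using assms by (intro powr_mono2) auto
  thus ?thesis by (simp add: add_increasing2)
next
  case False
  have "y powr n = y powr (n - m) * y powr m" by (simp add: powr_add[symmetric])
  also have "\<dots> \<le> t powr (n - m) * y powr m"
    using False assms by (intro mult_right_mono powr_mono2') auto
  finally show ?thesis by (simp add: add_increasing)
qed

lemma powr_add_le:
  fixes x y n :: real
  assumes "0 \<le> n"
  shows "\<bar>x + y\<bar> powr n \<le> 2 powr n * (\<bar>x\<bar> powr n + \<bar>y\<bar> powr n)"
proof -
  have "\<bar>x + y\<bar> powr n \<le> (2 * max \<bar>x\<bar> \<bar>y\<bar>) powr n"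
    using assms by (intro powr_mono2) auto
  also have "\<dots> = 2 powr n * (max \<bar>x\<bar> \<bar>y\<bar>) powr n" by (simp add: powr_mult)
  also have "(max \<bar>x\<bar> \<bar>y\<bar>) powr n \<le> \<bar>x\<bar> powr n + \<bar>y\<bar> powr n" by (simp add: max_def)
  finally show ?thesis by simp
qed

text \<open>The Riesz-Fischer argument for a continuous parameter: a sequence of parameters is
  chosen so fast that the increments are summable in mean, its almost sure limit is taken, and
  Fatou's lemma transfers the Cauchy estimate to the distance from that limit.\<close>

lemma (in prob_space) converges_in_Lp_of_Cauchy:
  fixes f :: "real \<Rightarrow> 'a \<Rightarrow> real"
  assumes n: "n \<ge> 1"
    and Lp: "\<And>\<epsilon>. \<epsilon> > 0 \<Longrightarrow> in_Lp M n (f \<epsilon>)"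
    and Cauchy: "\<And>\<delta>. \<delta> > 0 \<Longrightarrow> \<exists>e>0. \<forall>\<epsilon> \<eta>. 0 < \<epsilon> \<and> \<epsilon> \<le> e \<and> 0 < \<eta> \<and> \<eta> \<le> e \<longrightarrow>
       (\<integral>\<^sup>+\<omega>. ennreal (\<bar>f \<epsilon> \<omega> - f \<eta> \<omega>\<bar> powr n) \<partial>M) \<le> ennreal \<delta>"
  shows "converges_in_Lp M n f (at_right 0)"
proof -
  have meas [measurable]: "f \<epsilon> \<in> borel_measurable M" if "\<epsilon> > 0" for \<epsilon>
    using Lp[OF that] by (simp add: in_Lp_def)
  have "\<exists>e>0. \<forall>\<epsilon> \<eta>. 0 < \<epsilon> \<and> \<epsilon> \<le> e \<and> 0 < \<eta> \<and> \<eta> \<le> e \<longrightarrow>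
       (\<integral>\<^sup>+\<omega>. ennreal (\<bar>f \<epsilon> \<omega> - f \<eta> \<omega>\<bar> powr n) \<partial>M) \<le> ennreal (((1/2)^m) powr n)" for m :: nat
    by (rule Cauchy) simp
  then obtain e0 where e0: "\<And>m. e0 m > 0" "\<And>m \<epsilon> \<eta>. 0 < \<epsilon> \<Longrightarrow> \<epsilon> \<le> e0 m \<Longrightarrow> 0 < \<eta> \<Longrightarrow> \<eta> \<le> e0 m \<Longrightarrow>
       (\<integral>\<^sup>+\<omega>. ennreal (\<bar>f \<epsilon> \<omega> - f \<eta> \<omega>\<bar> powr n) \<partial>M) \<le> ennreal (((1/2)^m) powr n)"
    by metis
  \<comment> \<open>The minimum over all earlier thresholds makes both \<open>e m\<close> and
    \<open>e (Suc m)\<close> admissible for \<open>e0 m\<close>; the second argument of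
    \<open>min\<close> forces convergence to 0.\<close>
  define e where "e = (\<lambda>m. min (Min (e0 ` {..m})) (1 / Suc m))"
  have e_pos: "e m > 0" for m using e0(1) by (simp add: e_def)
  have e_le: "e k \<le> e0 m" if "m \<le> k" for m k
  proof -
    have "Min (e0 ` {..k}) \<le> e0 m" using that by (intro Min_le) auto
    thus ?thesis by (simp add: e_def min.coboundedI1)
  qed
  have e_lim: "e \<longlonglongrightarrow> 0"
  proof (rule tendsto_sandwich[of "\<lambda>_. 0" e _ "\<lambda>m. 1 / real (Suc m)"])
    show "(\<lambda>m. 1 / real (Suc m)) \<longlonglongrightarrow> 0" using LIMSEQ_inverse_real_of_nat by (simp add: inverse_eq_divide)
  qed (use e_pos in \<open>auto simp: e_def less_imp_le\<close>)
  have meas_e [measurable]: "f (e m) \<in> borel_measurable M" for m by (rule meas[OF e_pos])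
  \<comment> \<open>The threshold \<open>t = (1/2) ^ m\<close> fits the Cauchy tolerance
    \<open>t powr n\<close>: both terms of the interpolation then equal \<open>t\<close>, and the
    bounds are summable.\<close>
  have step: "(\<integral>\<^sup>+\<omega>. ennreal \<bar>f (e (Suc m)) \<omega> - f (e m) \<omega>\<bar> \<partial>M) \<le> ennreal (2 * (1/2)^m)" for m
  proof -
    let ?t = "(1/2::real)^m" and ?y = "\<lambda>\<omega>. \<bar>f (e (Suc m)) \<omega> - f (e m) \<omega>\<bar>"
    have "(\<integral>\<^sup>+\<omega>. ennreal (?y \<omega>) \<partial>M) \<le> (\<integral>\<^sup>+\<omega>. ennreal ?t + ennreal (?t powr (1 - n)) * ennreal (?y \<omega> powr n) \<partial>M)"
    proof (rule nn_integral_mono)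
      fix \<omega>
      have "?y \<omega> \<le> ?t + ?t powr (1 - n) * ?y \<omega> powr n"
        using powr_le_add_powr[of "?y \<omega>" ?t 1 n] n by simp
      thus "ennreal (?y \<omega>) \<le> ennreal ?t + ennreal (?t powr (1 - n)) * ennreal (?y \<omega> powr n)"
        by (simp add: ennreal_mult[symmetric] ennreal_plus[symmetric] ennreal_leI del: ennreal_plus)
    qed
    also have "\<dots> = ennreal ?t + ennreal (?t powr (1 - n)) * (\<integral>\<^sup>+\<omega>. ennreal (?y \<omega> powr n) \<partial>M)"
      by (subst nn_integral_add) (auto simp: nn_integral_cmult emeasure_space_1)
    also have "\<dots> \<le> ennreal ?t + ennreal (?t powr (1 - n)) * ennreal (?t powr n)"
      by (intro add_left_mono mult_left_mono e0(2) e_pos e_le) auto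
    also have "\<dots> = ennreal (2 * ?t)"
      by (simp add: ennreal_mult[symmetric] ennreal_plus[symmetric] powr_add[symmetric] del: ennreal_plus)
    finally show ?thesis .
  qed
  have "(\<integral>\<^sup>+\<omega>. (\<Sum>m. ennreal \<bar>f (e (Suc m)) \<omega> - f (e m) \<omega>\<bar>) \<partial>M)
      = (\<Sum>m. \<integral>\<^sup>+\<omega>. ennreal \<bar>f (e (Suc m)) \<omega> - f (e m) \<omega>\<bar> \<partial>M)"
    by (rule nn_integral_suminf) measurable
  also have "\<dots> \<le> (\<Sum>m. ennreal (2 * (1/2)^m))"
    by (intro suminf_le step) auto
  also have "\<dots> = ennreal (\<Sum>m. 2 * (1/2)^m)"
    by (intro suminf_ennreal2 summable_mult summable_geometric) auto
  also have "\<dots> < \<infinity>" by simp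
  finally have "AE \<omega> in M. (\<Sum>m. ennreal \<bar>f (e (Suc m)) \<omega> - f (e m) \<omega>\<bar>) \<noteq> \<infinity>"
    by (intro nn_integral_PInf_AE) auto
  hence conv: "AE \<omega> in M. convergent (\<lambda>m. f (e m) \<omega>)"
  proof eventually_elim
    case (elim \<omega>)
    hence "summable (\<lambda>m. \<bar>f (e (Suc m)) \<omega> - f (e m) \<omega>\<bar>)"
      by (intro summable_suminf_not_top) auto
    hence "summable (\<lambda>m. f (e (Suc m)) \<omega> - f (e m) \<omega>)"
      by (rule summable_rabs_cancel)
    hence "convergent (\<lambda>k. \<Sum>m<k. f (e (Suc m)) \<omega> - f (e m) \<omega>)" by (simp add: summable_iff_convergent)
    hence "convergent (\<lambda>k. f (e k) \<omega> - f (e 0) \<omega>)" 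
      by (simp add: sum_lessThan_telescope[of "\<lambda>m. f (e m) \<omega>"])
    hence "convergent (\<lambda>k. (f (e k) \<omega> - f (e 0) \<omega>) + f (e 0) \<omega>)"
      by (intro convergent_add convergent_const)
    thus ?case by simp
  qed
  \<comment> \<open>\<open>lim\<close> is total, so \<open>X\<close> is defined and measurable
    everywhere; its values where the sequence diverges lie in a null set.\<close>
  define X where "X = (\<lambda>\<omega>. lim (\<lambda>m. f (e m) \<omega>))"
  have [measurable]: "X \<in> borel_measurable M" unfolding X_def by measurable
  have X: "AE \<omega> in M. (\<lambda>m. f (e m) \<omega>) \<longlonglongrightarrow> X \<omega>"
    using conv by eventually_elim (simp add: X_def convergent_LIMSEQ_iff)
  have dist: "\<exists>e'>0. \<forall>\<epsilon>. 0 < \<epsilon> \<and> \<epsilon> \<le> e' \<longrightarrow> (\<integral>\<^sup>+\<omega>. ennreal (\<bar>f \<epsilon> \<omega> - X \<omega>\<bar> powr n) \<partial>M) \<le> ennreal \<delta>"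
    if "\<delta> > 0" for \<delta>
  proof -
    obtain e' where e': "e' > 0" "\<And>\<epsilon> \<eta>. 0 < \<epsilon> \<Longrightarrow> \<epsilon> \<le> e' \<Longrightarrow> 0 < \<eta> \<Longrightarrow> \<eta> \<le> e' \<Longrightarrow>
       (\<integral>\<^sup>+\<omega>. ennreal (\<bar>f \<epsilon> \<omega> - f \<eta> \<omega>\<bar> powr n) \<partial>M) \<le> ennreal \<delta>"
      using Cauchy[OF \<open>\<delta> > 0\<close>] by metis
    have "(\<integral>\<^sup>+\<omega>. ennreal (\<bar>f \<epsilon> \<omega> - X \<omega>\<bar> powr n) \<partial>M) \<le> ennreal \<delta>" if \<epsilon>: "0 < \<epsilon>" "\<epsilon> \<le> e'" for \<epsilon>
    proof -
      note [measurable] = meas[OF \<epsilon>(1)]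
      have "(\<integral>\<^sup>+\<omega>. ennreal (\<bar>f \<epsilon> \<omega> - X \<omega>\<bar> powr n) \<partial>M) = (\<integral>\<^sup>+\<omega>. liminf (\<lambda>m. ennreal (\<bar>f \<epsilon> \<omega> - f (e m) \<omega>\<bar> powr n)) \<partial>M)"
      proof (rule nn_integral_cong_AE)
        show "AE \<omega> in M. ennreal (\<bar>f \<epsilon> \<omega> - X \<omega>\<bar> powr n) = liminf (\<lambda>m. ennreal (\<bar>f \<epsilon> \<omega> - f (e m) \<omega>\<bar> powr n))"
          using X
        proof eventually_elim
          case (elim \<omega>)
          have "(\<lambda>m. ennreal (\<bar>f \<epsilon> \<omega> - f (e m) \<omega>\<bar> powr n)) \<longlonglongrightarrow> ennreal (\<bar>f \<epsilon> \<omega> - X \<omega>\<bar> powr n)"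
            using n by (intro tendsto_ennrealI tendsto_powr' tendsto_intros elim) auto
          from lim_imp_Liminf[OF _ this] show ?case by simp
        qed
      qed
      also have "\<dots> \<le> liminf (\<lambda>m. \<integral>\<^sup>+\<omega>. ennreal (\<bar>f \<epsilon> \<omega> - f (e m) \<omega>\<bar> powr n) \<partial>M)"
        by (rule nn_integral_liminf) measurable
      also have "\<dots> \<le> limsup (\<lambda>m. \<integral>\<^sup>+\<omega>. ennreal (\<bar>f \<epsilon> \<omega> - f (e m) \<omega>\<bar> powr n) \<partial>M)"
        by (rule Liminf_le_Limsup) simp
      also have "\<dots> \<le> ennreal \<delta>"
      proof (rule Limsup_bounded)
        have "eventually (\<lambda>m. e m < e') sequentially"
          using e_lim e'(1) by (rule order_tendstoD)
        thus "eventually (\<lambda>m. (\<integral>\<^sup>+\<omega>. ennreal (\<bar>f \<epsilon> \<omega> - f (e m) \<omega>\<bar> powr n) \<partial>M) \<le> ennreal \<delta>) sequentially"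
          by eventually_elim (rule e'(2), use \<epsilon> e_pos in auto)
      qed
      finally show ?thesis .
    qed
    thus ?thesis using e'(1) by blast
  qed
  have XLp: "in_Lp M n X"
  proof -
    obtain e' where e': "e' > 0" "\<And>\<epsilon>. 0 < \<epsilon> \<Longrightarrow> \<epsilon> \<le> e' \<Longrightarrow> (\<integral>\<^sup>+\<omega>. ennreal (\<bar>f \<epsilon> \<omega> - X \<omega>\<bar> powr n) \<partial>M) \<le> ennreal 1"
      using dist[of 1] by auto
    note [measurable] = meas[OF e'(1)]
    have "(\<integral>\<^sup>+\<omega>. ennreal (\<bar>f e' \<omega> - X \<omega>\<bar> powr n) \<partial>M) < \<infinity>"
      using e'(2)[of e'] e'(1) by (simp add: order_le_less_trans)
    hence "integrable M (\<lambda>\<omega>. \<bar>f e' \<omega> - X \<omega>\<bar> powr n)" by (intro integrableI_nonneg) auto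
    moreover have "integrable M (\<lambda>\<omega>. \<bar>f e' \<omega>\<bar> powr n)" using Lp[OF e'(1)] by (simp add: in_Lp_def)
    ultimately have "integrable M (\<lambda>\<omega>. 2 powr n * (\<bar>f e' \<omega>\<bar> powr n + \<bar>f e' \<omega> - X \<omega>\<bar> powr n))"
      by auto
    hence "integrable M (\<lambda>\<omega>. \<bar>X \<omega>\<bar> powr n)"
    proof (rule Bochner_Integration.integrable_bound, measurable, intro AE_I2)
      fix \<omega>
      show "norm (\<bar>X \<omega>\<bar> powr n) \<le> norm (2 powr n * (\<bar>f e' \<omega>\<bar> powr n + \<bar>f e' \<omega> - X \<omega>\<bar> powr n))"
        using powr_add_le[of n "f e' \<omega>" "X \<omega> - f e' \<omega>"] n by (simp add: abs_minus_commute)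
    qed
    thus ?thesis by (simp add: in_Lp_def)
  qed
  show ?thesis unfolding converges_in_Lp_def
  proof (intro conjI exI[of _ X] XLp)
    show "\<forall>\<^sub>F \<epsilon> in at_right 0. in_Lp M n (f \<epsilon>)"
      using Lp by (auto simp: eventually_at_filter)
    show "((\<lambda>\<epsilon>. \<integral>\<omega>. \<bar>f \<epsilon> \<omega> - X \<omega>\<bar> powr n \<partial>M) \<longlongrightarrow> 0) (at_right 0)"
    proof (rule tendstoI)
      fix \<delta> :: real assume "\<delta> > 0"
      then obtain e' where e': "e' > 0" "\<And>\<epsilon>. 0 < \<epsilon> \<Longrightarrow> \<epsilon> \<le> e' \<Longrightarrow> (\<integral>\<^sup>+\<omega>. ennreal (\<bar>f \<epsilon> \<omega> - X \<omega>\<bar> powr n) \<partial>M) \<le> ennreal (\<delta>/2)"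
        using dist[of "\<delta>/2"] by auto
      have "(\<integral>\<omega>. \<bar>f \<epsilon> \<omega> - X \<omega>\<bar> powr n \<partial>M) < \<delta>" if "0 < \<epsilon>" "\<epsilon> < e'" for \<epsilon>
      proof -
        note [measurable] = meas[OF that(1)]
        have "(\<integral>\<omega>. \<bar>f \<epsilon> \<omega> - X \<omega>\<bar> powr n \<partial>M) = enn2real (\<integral>\<^sup>+\<omega>. ennreal (\<bar>f \<epsilon> \<omega> - X \<omega>\<bar> powr n) \<partial>M)"
          by (rule integral_eq_nn_integral) auto
        also have "\<dots> \<le> enn2real (ennreal (\<delta>/2))"
          using e'(2)[of \<epsilon>] that by (intro enn2real_mono) auto
        also have "\<dots> < \<delta>" using \<open>\<delta> > 0\<close> by simp
        finally show ?thesis .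
      qed
      moreover have "0 \<le> (\<integral>\<omega>. \<bar>f \<epsilon> \<omega> - X \<omega>\<bar> powr n \<partial>M)" for \<epsilon> by simp
      ultimately show "\<forall>\<^sub>F \<epsilon> in at_right 0. dist (\<integral>\<omega>. \<bar>f \<epsilon> \<omega> - X \<omega>\<bar> powr n \<partial>M) 0 < \<delta>"
        using e'(1) by (auto simp: eventually_at_right_field dist_real_def intro!: exI[of _ e'])
    qed
  qed
qed

section \<open>Moments of Fourier integrals\<close>

text \<open>A power of an integral is an integral over \<open>N\<close> independent copies of the
  frequency. Fubini applies because \<zeta> is bounded by 1 on a probability space and the product
  of the weights is integrable.\<close>

lemma (in prob_space) moment_formula:
  fixes \<zeta> :: "'v::euclidean_space \<Rightarrow> 'a \<Rightarrow> complex" and w :: "'v \<Rightarrow> complex"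
  assumes meas [measurable]: "(\<lambda>(p, \<omega>). \<zeta> p \<omega>) \<in> borel_measurable (lborel \<Otimes>\<^sub>M M)"
    and bound: "\<And>p \<omega>. norm (\<zeta> p \<omega>) \<le> 1"
    and w: "integrable lborel w"
  shows "(\<integral>\<omega>. (LINT p|lborel. w p * \<zeta> p \<omega>) ^ N \<partial>M) =
     (LINT p|PiM {..<N} (\<lambda>_. lborel). (\<Prod>i<N. w (p i)) * (\<integral>\<omega>. (\<Prod>i<N. \<zeta> (p i) \<omega>) \<partial>M))"
proof -
  let ?P = "PiM {..<N} (\<lambda>_. lborel :: 'v measure)"
  interpret L: product_sigma_finite "\<lambda>_::nat. lborel :: 'v measure" by unfold_locales
  interpret S: sigma_finite_measure ?P by (rule L.sigma_finite) simp
  interpret pair_sigma_finite M ?P by unfold_locales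
  have [measurable]: "w \<in> borel_measurable borel" using w by auto
  have \<zeta>_section: "(\<lambda>p. \<zeta> p \<omega>) \<in> borel_measurable borel" if "\<omega> \<in> space M" for \<omega>
    using measurable_compose[OF measurable_Pair1'[OF that, of lborel] measurable_compose[OF measurable_pair_swap' meas]]
    by simp
  have int: "integrable lborel (\<lambda>p. w p * \<zeta> p \<omega>)" if "\<omega> \<in> space M" for \<omega>
  proof (rule Bochner_Integration.integrable_bound[OF w])
    show "AE p in lborel. norm (w p * \<zeta> p \<omega>) \<le> norm (w p)"
      using bound by (intro AE_I2) (simp add: norm_mult mult_left_le)
  qed (use \<zeta>_section[OF that] in measurable)
  let ?h = "\<lambda>\<omega> p. \<Prod>i<N. w (p i) * \<zeta> (p i) \<omega>"
  have comp: "(\<lambda>x. snd x i) \<in> borel_measurable (M \<Otimes>\<^sub>M ?P)" if "i < N" for i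
    by (rule measurable_compose[OF measurable_snd borel_measurable_PiM_component]) (use that in auto)
  have h_meas: "(\<lambda>x. ?h (fst x) (snd x)) \<in> borel_measurable (M \<Otimes>\<^sub>M ?P)"
  proof (rule borel_measurable_prod)
    fix i assume i: "i \<in> {..<N}"
    hence "(\<lambda>x. (snd x i, fst x)) \<in> measurable (M \<Otimes>\<^sub>M ?P) (lborel \<Otimes>\<^sub>M M)"
      using comp[of i] by (intro measurable_Pair) auto
    from measurable_compose[OF this meas] have "(\<lambda>x. \<zeta> (snd x i) (fst x)) \<in> borel_measurable (M \<Otimes>\<^sub>M ?P)"
      by simp
    moreover have "(\<lambda>x. w (snd x i)) \<in> borel_measurable (M \<Otimes>\<^sub>M ?P)"
      by (rule measurable_compose[OF comp]) (use i in auto)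
    ultimately show "(\<lambda>x. w (snd x i) * \<zeta> (snd x i) (fst x)) \<in> borel_measurable (M \<Otimes>\<^sub>M ?P)"
      by (rule borel_measurable_times[rotated])
  qed
  have wint: "integrable ?P (\<lambda>p. \<Prod>i<N. norm (w (p i)))"
    by (rule L.product_integrable_prod) (use w in auto)
  have h_le: "norm (?h \<omega> p) \<le> (\<Prod>i<N. norm (w (p i)))" for \<omega> p
    unfolding prod_norm[symmetric] norm_mult
    by (rule prod_mono) (use bound in \<open>auto intro: mult_left_le\<close>)
  have h_int: "integrable (M \<Otimes>\<^sub>M ?P) (\<lambda>x. ?h (fst x) (snd x))"
  proof (rule Bochner_Integration.integrable_bound)
    have [measurable]: "(\<lambda>p. \<Prod>i<N. norm (w (p i))) \<in> borel_measurable ?P"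
      using wint by (rule borel_measurable_integrable)
    show "integrable (M \<Otimes>\<^sub>M ?P) (\<lambda>x. \<Prod>i<N. norm (w (snd x i)))"
    proof (rule integrableI_bounded)
      have "(\<integral>\<^sup>+x. ennreal (norm (\<Prod>i<N. norm (w (snd x i)))) \<partial>(M \<Otimes>\<^sub>M ?P))
          = (\<integral>\<^sup>+\<omega>. \<integral>\<^sup>+p. ennreal (norm (\<Prod>i<N. norm (w (p i)))) \<partial>?P \<partial>M)"
        by (subst S.nn_integral_fst[symmetric]) (auto simp: split_beta')
      also have "\<dots> < \<infinity>" using wint by (simp add: emeasure_space_1 integrable_iff_bounded)
      finally show "(\<integral>\<^sup>+x. ennreal (norm (\<Prod>i<N. norm (w (snd x i)))) \<partial>(M \<Otimes>\<^sub>M ?P)) < \<infinity>" .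
    qed measurable
  qed (use h_meas h_le in \<open>auto intro!: AE_I2 simp: abs_of_nonneg[OF prod_nonneg]\<close>)
  have "(\<integral>\<omega>. (LINT p|lborel. w p * \<zeta> p \<omega>) ^ N \<partial>M) = (\<integral>\<omega>. (LINT p|?P. ?h \<omega> p) \<partial>M)"
    by (rule Bochner_Integration.integral_cong[OF refl]) (subst L.product_integral_prod, use int in auto)
  also have "\<dots> = (LINT p|?P. \<integral>\<omega>. ?h \<omega> p \<partial>M)"
    by (rule Fubini_integral[symmetric]) (use h_int in \<open>simp add: split_beta'\<close>)
  also have "\<dots> = (LINT p|?P. (\<Prod>i<N. w (p i)) * (\<integral>\<omega>. (\<Prod>i<N. \<zeta> (p i) \<omega>) \<partial>M))"
    by (simp add: prod.distrib)
  finally show ?thesis .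
qed

text \<open>The probabilistic core without the process: the mixed moments \<open>F\<close> of
  \<zeta> are nonnegative and integrable against the majorant of the weights. The limit weight
  \<open>v\<close> only has to exist pointwise; it cancels in the Cauchy differences.\<close>

lemma (in prob_space) converges_in_Lp_of_moments:
  fixes \<zeta> :: "'v::euclidean_space \<Rightarrow> 'a \<Rightarrow> complex" and w :: "real \<Rightarrow> 'v \<Rightarrow> complex"
    and v :: "'v \<Rightarrow> complex" and W :: "'v \<Rightarrow> real" and F :: "nat \<Rightarrow> (nat \<Rightarrow> 'v) \<Rightarrow> real"
  assumes meas [measurable]: "(\<lambda>(p, \<omega>). \<zeta> p \<omega>) \<in> borel_measurable (lborel \<Otimes>\<^sub>M M)"
    and bound: "\<And>p \<omega>. norm (\<zeta> p \<omega>) \<le> 1"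
    and w: "\<And>\<epsilon>. \<epsilon> > 0 \<Longrightarrow> integrable lborel (w \<epsilon>)"
    and w_le: "\<And>\<epsilon> p. \<epsilon> > 0 \<Longrightarrow> norm (w \<epsilon> p) \<le> W p"
    and w_lim: "\<And>p. ((\<lambda>\<epsilon>. w \<epsilon> p) \<longlongrightarrow> v p) (at_right 0)"
    and W: "W \<in> borel_measurable borel"
    and F: "\<And>N p. F N p \<ge> 0"
      "\<And>N p. (\<integral>\<omega>. (\<Prod>i<N. \<zeta> (p i) \<omega>) \<partial>M) = complex_of_real (F N p)"
    and F_meas: "\<And>N. F N \<in> borel_measurable (PiM {..<N} (\<lambda>_. lborel))"
    and fin: "\<And>N. (\<integral>\<^sup>+p. ennreal ((\<Prod>i<N. W (p i)) * F N p) \<partial>PiM {..<N} (\<lambda>_. lborel)) < \<infinity>"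
    and \<alpha>: "\<And>\<epsilon> \<omega>. \<epsilon> > 0 \<Longrightarrow> \<omega> \<in> space M \<Longrightarrow> complex_of_real (\<alpha> \<epsilon> \<omega>) = (LINT p|lborel. w \<epsilon> p * \<zeta> p \<omega>)"
    and n: "n \<ge> 1"
  shows "converges_in_Lp M n \<alpha> (at_right 0)"
proof (rule converges_in_Lp_of_Cauchy[OF n])
  have w_meas [measurable]: "w \<epsilon> \<in> borel_measurable borel" if "\<epsilon> > 0" for \<epsilon>
    using w[OF that] by auto
  have \<alpha>_meas: "\<alpha> \<epsilon> \<in> borel_measurable M" if "\<epsilon> > 0" for \<epsilon>
  proof -
    note [measurable] = w_meas[OF that]
    have "(\<lambda>x. \<zeta> (snd x) (fst x)) \<in> borel_measurable (M \<Otimes>\<^sub>M lborel)"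
      using measurable_compose[OF measurable_pair_swap' meas] by (simp add: split_beta')
    moreover have "(\<lambda>x. w \<epsilon> (snd x)) \<in> borel_measurable (M \<Otimes>\<^sub>M lborel)"
      by measurable
    ultimately have "(\<lambda>(\<omega>, p). w \<epsilon> p * \<zeta> p \<omega>) \<in> borel_measurable (M \<Otimes>\<^sub>M lborel)"
      unfolding split_beta' by (intro borel_measurable_times)
    from measurable_compose[OF lborel.borel_measurable_lebesgue_integral[OF this] borel_measurable_Re]
    have "(\<lambda>\<omega>. Re (LINT p|lborel. w \<epsilon> p * \<zeta> p \<omega>)) \<in> borel_measurable M" .
    moreover have "\<alpha> \<epsilon> \<omega> = Re (LINT p|lborel. w \<epsilon> p * \<zeta> p \<omega>)" if "\<omega> \<in> space M" for \<omega>
      by (simp flip: \<alpha>[OF \<open>\<epsilon> > 0\<close> that])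
    ultimately show ?thesis by (subst measurable_cong) auto
  qed
  have \<alpha>_bdd: "\<bar>\<alpha> \<epsilon> \<omega>\<bar> \<le> (LINT p|lborel. norm (w \<epsilon> p))" if "\<epsilon> > 0" "\<omega> \<in> space M" for \<epsilon> \<omega>
  proof -
    have "\<bar>\<alpha> \<epsilon> \<omega>\<bar> = norm (LINT p|lborel. w \<epsilon> p * \<zeta> p \<omega>)"
      by (simp flip: \<alpha>[OF that])
    also have "\<dots> \<le> (LINT p|lborel. norm (w \<epsilon> p * \<zeta> p \<omega>))" by (rule integral_norm_bound)
    also have "\<dots> \<le> (LINT p|lborel. norm (w \<epsilon> p))"
      using w[OF that(1)] bound by (intro integral_mono') (auto simp: norm_mult mult_left_le)
    finally show ?thesis .
  qed
  show "in_Lp M n (\<alpha> \<epsilon>)" if "\<epsilon> > 0" for \<epsilon>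
    unfolding in_Lp_def
  proof (intro conjI \<alpha>_meas that)
    note [measurable] = \<alpha>_meas[OF that]
    show "integrable M (\<lambda>\<omega>. \<bar>\<alpha> \<epsilon> \<omega>\<bar> powr n)"
    proof (rule integrable_const_bound[where B = "(LINT p|lborel. norm (w \<epsilon> p)) powr n"])
      show "AE \<omega> in M. norm (\<bar>\<alpha> \<epsilon> \<omega>\<bar> powr n) \<le> (LINT p|lborel. norm (w \<epsilon> p)) powr n"
        using \<alpha>_bdd[OF that] n by (intro AE_I2) (auto intro!: powr_mono2)
    qed measurable
  qed
  \<comment> \<open>An even integer above \<open>n\<close>: the absolute \<open>N\<close>-th power
    is then an honest power, to which the moment formula applies.\<close>
  define N where "N = 2 * nat \<lceil>n\<rceil>"
  have N: "even N" "N > 0" "n \<le> N" using n by (auto simp: N_def) linarith+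
  let ?P = "PiM {..<N} (\<lambda>_. lborel :: 'v measure)"
  have key: "(\<integral>\<^sup>+\<omega>. ennreal (\<bar>\<alpha> \<epsilon> \<omega> - \<alpha> \<eta> \<omega>\<bar> ^ N) \<partial>M)
     \<le> (\<integral>\<^sup>+p. ennreal ((\<Prod>i<N. norm (w \<epsilon> (p i) - w \<eta> (p i))) * F N p) \<partial>?P)"
    if \<epsilon>: "\<epsilon> > 0" and \<eta>: "\<eta> > 0" for \<epsilon> \<eta>
  proof -
    note [measurable] = \<alpha>_meas[OF \<epsilon>] \<alpha>_meas[OF \<eta>] w_meas[OF \<epsilon>] w_meas[OF \<eta>]
    let ?w = "\<lambda>p. w \<epsilon> p - w \<eta> p"
    have w': "integrable lborel ?w" using w \<epsilon> \<eta> by auto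
    have \<zeta>_section: "(\<lambda>p. \<zeta> p \<omega>) \<in> borel_measurable borel" if "\<omega> \<in> space M" for \<omega>
      using measurable_compose[OF measurable_Pair1'[OF that, of lborel] measurable_compose[OF measurable_pair_swap' meas]]
      by simp
    have int: "integrable lborel (\<lambda>p. w \<epsilon> p * \<zeta> p \<omega>)" if "\<omega> \<in> space M" "\<epsilon> > 0" for \<omega> \<epsilon>
    proof (rule Bochner_Integration.integrable_bound[OF w[OF that(2)]])
      show "AE p in lborel. norm (w \<epsilon> p * \<zeta> p \<omega>) \<le> norm (w \<epsilon> p)"
        using bound by (intro AE_I2) (simp add: norm_mult mult_left_le)
    qed (use \<zeta>_section[OF that(1)] w_meas[OF that(2)] in measurable)
    have diff: "complex_of_real (\<alpha> \<epsilon> \<omega> - \<alpha> \<eta> \<omega>) = (LINT p|lborel. ?w p * \<zeta> p \<omega>)" if "\<omega> \<in> space M" for \<omega>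
      using int[OF that \<epsilon>] int[OF that \<eta>] by (simp add: \<alpha>[OF \<epsilon> that] \<alpha>[OF \<eta> that] left_diff_distrib)
    have abs_eq: "\<bar>x\<bar> ^ N = x ^ N" for x :: real using N(1) by (rule power_even_abs)
    have int_N: "integrable M (\<lambda>\<omega>. \<bar>\<alpha> \<epsilon> \<omega> - \<alpha> \<eta> \<omega>\<bar> ^ N)"
    proof (rule integrable_const_bound[where B = "((LINT p|lborel. norm (w \<epsilon> p)) + (LINT p|lborel. norm (w \<eta> p))) ^ N"])
      show "AE \<omega> in M. norm (\<bar>\<alpha> \<epsilon> \<omega> - \<alpha> \<eta> \<omega>\<bar> ^ N) \<le> ((LINT p|lborel. norm (w \<epsilon> p)) + (LINT p|lborel. norm (w \<eta> p))) ^ N"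
      proof (intro AE_I2)
        fix \<omega> assume "\<omega> \<in> space M"
        from \<alpha>_bdd[OF \<epsilon> this] \<alpha>_bdd[OF \<eta> this]
        have "\<bar>\<alpha> \<epsilon> \<omega> - \<alpha> \<eta> \<omega>\<bar> \<le> (LINT p|lborel. norm (w \<epsilon> p)) + (LINT p|lborel. norm (w \<eta> p))" by linarith
        thus "norm (\<bar>\<alpha> \<epsilon> \<omega> - \<alpha> \<eta> \<omega>\<bar> ^ N) \<le> ((LINT p|lborel. norm (w \<epsilon> p)) + (LINT p|lborel. norm (w \<eta> p))) ^ N"
          by (simp add: power_mono)
      qed
    qed measurable
    have "complex_of_real (\<integral>\<omega>. \<bar>\<alpha> \<epsilon> \<omega> - \<alpha> \<eta> \<omega>\<bar> ^ N \<partial>M) = (\<integral>\<omega>. complex_of_real (\<alpha> \<epsilon> \<omega> - \<alpha> \<eta> \<omega>) ^ N \<partial>M)"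
      by (simp add: abs_eq flip: integral_complex_of_real of_real_diff)
    also have "\<dots> = (\<integral>\<omega>. (LINT p|lborel. ?w p * \<zeta> p \<omega>) ^ N \<partial>M)"
      by (rule Bochner_Integration.integral_cong) (simp_all only: diff)
    also have "\<dots> = (LINT p|?P. (\<Prod>i<N. ?w (p i)) * complex_of_real (F N p))"
      by (subst moment_formula[OF meas bound w']) (simp add: F)
    finally have eq: "complex_of_real (\<integral>\<omega>. \<bar>\<alpha> \<epsilon> \<omega> - \<alpha> \<eta> \<omega>\<bar> ^ N \<partial>M) = (LINT p|?P. (\<Prod>i<N. ?w (p i)) * complex_of_real (F N p))" .
    have "(\<integral>\<^sup>+\<omega>. ennreal (\<bar>\<alpha> \<epsilon> \<omega> - \<alpha> \<eta> \<omega>\<bar> ^ N) \<partial>M) = ennreal (\<integral>\<omega>. \<bar>\<alpha> \<epsilon> \<omega> - \<alpha> \<eta> \<omega>\<bar> ^ N \<partial>M)"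
      by (rule nn_integral_eq_integral[OF int_N]) simp
    also have "\<dots> \<le> ennreal (norm (LINT p|?P. (\<Prod>i<N. ?w (p i)) * complex_of_real (F N p)))"
      unfolding eq[symmetric] by (intro ennreal_leI) simp
    \<comment> \<open>If the integrand is not integrable, the Bochner integral is 0 and the bound is
      trivial.\<close>
    also have "\<dots> \<le> (\<integral>\<^sup>+p. ennreal (norm ((\<Prod>i<N. ?w (p i)) * complex_of_real (F N p))) \<partial>?P)"
      by (cases "integrable ?P (\<lambda>p. (\<Prod>i<N. ?w (p i)) * complex_of_real (F N p))")
         (auto intro!: integral_norm_bound_ennreal simp: not_integrable_integral_eq)
    also have "\<dots> = (\<integral>\<^sup>+p. ennreal ((\<Prod>i<N. norm (?w (p i))) * F N p) \<partial>?P)"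
      using F(1) by (simp add: norm_mult prod_norm)
    finally show ?thesis .
  qed
  fix \<delta> :: real assume \<delta>: "\<delta> > 0"
  \<comment> \<open>The threshold \<open>t\<close> and the tolerance \<delta>' are chosen so that
    the interpolation spends half of \<delta> on \<open>t powr n\<close> and half on
    \<open>t powr (n - N) * \<delta>'\<close>.\<close>
  define t where "t = (\<delta>/2) powr (1/n)"
  have t: "t > 0" "t powr n = \<delta>/2" using \<delta> n by (auto simp: t_def powr_powr)
  define \<delta>' where "\<delta>' = \<delta>/2 / t powr (n - N)"
  have \<delta>': "\<delta>' > 0" using \<delta> t by (simp add: \<delta>'_def)
  define D where "D \<epsilon> \<eta> = (\<integral>\<^sup>+p. ennreal ((\<Prod>i<N. norm (w \<epsilon> (p i) - w \<eta> (p i))) * F N p) \<partial>?P)" for \<epsilon> \<eta>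
  \<comment> \<open>Dominated convergence is sequential while two parameters tend to 0 together; a
    failure would supply two sequences below \<open>1 / Suc m\<close> along which it is
    contradicted.\<close>
  have "\<exists>e>0. \<forall>\<epsilon> \<eta>. 0 < \<epsilon> \<and> \<epsilon> \<le> e \<and> 0 < \<eta> \<and> \<eta> \<le> e \<longrightarrow> D \<epsilon> \<eta> \<le> ennreal \<delta>'"
  proof (rule ccontr)
    assume neg: "\<not> ?thesis"
    have "\<exists>\<epsilon> \<eta>. 0 < \<epsilon> \<and> \<epsilon> \<le> e \<and> 0 < \<eta> \<and> \<eta> \<le> e \<and> \<not> D \<epsilon> \<eta> \<le> ennreal \<delta>'" if "e > 0" for e
      using neg that by blast
    from this[of "1 / real (Suc m)" for m]
    have "\<exists>\<epsilon> \<eta>. 0 < \<epsilon> \<and> \<epsilon> \<le> 1 / Suc m \<and> 0 < \<eta> \<and> \<eta> \<le> 1 / Suc m \<and> \<not> D \<epsilon> \<eta> \<le> ennreal \<delta>'" for m :: nat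
      by simp
    then obtain \<epsilon> \<eta> where "\<And>m::nat. 0 < \<epsilon> m \<and> \<epsilon> m \<le> 1 / Suc m \<and> 0 < \<eta> m \<and> \<eta> m \<le> 1 / Suc m \<and>
        \<not> D (\<epsilon> m) (\<eta> m) \<le> ennreal \<delta>'"
      by metis
    hence \<epsilon>\<eta>: "\<And>m::nat. 0 < \<epsilon> m" "\<And>m. \<epsilon> m \<le> 1 / Suc m" "\<And>m. 0 < \<eta> m" "\<And>m. \<eta> m \<le> 1 / Suc m"
      "\<And>m. \<not> (\<integral>\<^sup>+p. ennreal ((\<Prod>i<N. norm (w (\<epsilon> m) (p i) - w (\<eta> m) (p i))) * F N p) \<partial>?P) \<le> ennreal \<delta>'"
      unfolding D_def by blast+
    have lim: "filterlim f (at_right 0) sequentially" if "\<And>m::nat. 0 < f m" "\<And>m. f m \<le> 1 / Suc m" for f :: "nat \<Rightarrow> real"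
    proof -
      have "f \<longlonglongrightarrow> 0"
      proof (rule tendsto_sandwich[of "\<lambda>_. 0" f _ "\<lambda>m. 1 / real (Suc m)"])
        show "(\<lambda>m. 1 / real (Suc m)) \<longlonglongrightarrow> 0" using LIMSEQ_inverse_real_of_nat by (simp add: inverse_eq_divide)
        show "\<forall>\<^sub>F m in sequentially. 0 \<le> f m" using that(1) by (intro always_eventually) (auto intro: less_imp_le)
      qed (use that in auto)
      thus ?thesis using that(1) 
        by (auto simp: filterlim_at less_imp_neq[THEN not_sym] intro!: always_eventually)
    qed
    have wdiff: "(\<lambda>m. norm (w (\<epsilon> m) p - w (\<eta> m) p)) \<longlonglongrightarrow> 0" for p
    proof -
      have "(\<lambda>m. w (\<epsilon> m) p - w (\<eta> m) p) \<longlonglongrightarrow> v p - v p"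
        using \<epsilon>\<eta> by (intro tendsto_diff filterlim_compose[OF w_lim lim]) auto
      thus ?thesis using tendsto_norm_zero by simp
    qed
    have W0: "0 \<le> W p" for p using w_le[of 1 p] norm_ge_zero[of "w 1 p"] by linarith
    have pm: "(\<lambda>p. f (p i)) \<in> borel_measurable ?P" if "f \<in> borel_measurable borel" "i < N" for i and f :: "'v \<Rightarrow> real"
      by (rule measurable_compose[OF borel_measurable_PiM_component that(1)]) (use that in auto)
    note [measurable] = F_meas
    have "(\<lambda>m. \<integral>\<^sup>+p. ennreal ((\<Prod>i<N. norm (w (\<epsilon> m) (p i) - w (\<eta> m) (p i))) * F N p) \<partial>?P) \<longlonglongrightarrow> (\<integral>\<^sup>+p. ennreal 0 \<partial>?P)"
    proof (rule nn_integral_dominated_convergence[where w = "\<lambda>p. ennreal (2 ^ N) * ennreal ((\<Prod>i<N. W (p i)) * F N p)"])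
      show "(\<lambda>p. ennreal ((\<Prod>i<N. norm (w (\<epsilon> m) (p i) - w (\<eta> m) (p i))) * F N p)) \<in> borel_measurable ?P" for m
      proof -
        have "(\<lambda>p. norm (w (\<epsilon> m) p - w (\<eta> m) p)) \<in> borel_measurable borel"
          using w_meas[OF \<epsilon>\<eta>(1)[of m]] w_meas[OF \<epsilon>\<eta>(3)[of m]] by measurable
        from pm[OF this] have "(\<lambda>p. \<Prod>i<N. norm (w (\<epsilon> m) (p i) - w (\<eta> m) (p i))) \<in> borel_measurable ?P"
          by (intro borel_measurable_prod) auto
        thus ?thesis by measurable
      qed
      have [measurable]: "(\<lambda>p. \<Prod>i<N. W (p i)) \<in> borel_measurable ?P"
        by (intro borel_measurable_prod pm W) auto
      show "(\<lambda>p. ennreal (2 ^ N) * ennreal ((\<Prod>i<N. W (p i)) * F N p)) \<in> borel_measurable ?P" by measurable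
      show "(\<integral>\<^sup>+p. ennreal (2 ^ N) * ennreal ((\<Prod>i<N. W (p i)) * F N p) \<partial>?P) < \<infinity>"
        using fin[of N] by (subst nn_integral_cmult) (auto simp: ennreal_mult_less_top)
      show "AE p in ?P. ennreal ((\<Prod>i<N. norm (w (\<epsilon> m) (p i) - w (\<eta> m) (p i))) * F N p)
          \<le> ennreal (2 ^ N) * ennreal ((\<Prod>i<N. W (p i)) * F N p)" for m
      proof (intro AE_I2)
        fix p :: "nat \<Rightarrow> 'v"
        have "norm (w (\<epsilon> m) (p i) - w (\<eta> m) (p i)) \<le> 2 * W (p i)" for i
          using norm_triangle_ineq4[of "w (\<epsilon> m) (p i)" "w (\<eta> m) (p i)"] w_le[OF \<epsilon>\<eta>(1), of m "p i"] w_le[OF \<epsilon>\<eta>(3), of m "p i"]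
          by linarith
        hence "(\<Prod>i<N. norm (w (\<epsilon> m) (p i) - w (\<eta> m) (p i))) \<le> (\<Prod>i<N. 2 * W (p i))"
          by (intro prod_mono) auto
        also have "\<dots> = 2 ^ N * (\<Prod>i<N. W (p i))" by (simp add: prod.distrib)
        finally have "(\<Prod>i<N. norm (w (\<epsilon> m) (p i) - w (\<eta> m) (p i))) * F N p \<le> 2 ^ N * (\<Prod>i<N. W (p i)) * F N p"
          by (rule mult_right_mono[OF _ F(1)])
        thus "ennreal ((\<Prod>i<N. norm (w (\<epsilon> m) (p i) - w (\<eta> m) (p i))) * F N p)
            \<le> ennreal (2 ^ N) * ennreal ((\<Prod>i<N. W (p i)) * F N p)"
          by (subst ennreal_mult[symmetric]) (auto simp: prod_nonneg W0 F(1) mult.assoc intro!: ennreal_leI mult_nonneg_nonneg)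
      qed
      show "AE p in ?P. (\<lambda>m. ennreal ((\<Prod>i<N. norm (w (\<epsilon> m) (p i) - w (\<eta> m) (p i))) * F N p)) \<longlonglongrightarrow> ennreal 0"
      proof (intro AE_I2 tendsto_ennrealI)
        fix p :: "nat \<Rightarrow> 'v"
        \<comment> \<open>The limit of the product is 0 only because \<open>N\<close> is positive;
          an empty product would be 1.\<close>
        have "(\<lambda>m. (\<Prod>i<N. norm (w (\<epsilon> m) (p i) - w (\<eta> m) (p i))) * F N p) \<longlonglongrightarrow> (\<Prod>i<N. 0) * F N p"
          by (intro tendsto_mult tendsto_prod wdiff tendsto_const)
        thus "(\<lambda>m. (\<Prod>i<N. norm (w (\<epsilon> m) (p i) - w (\<eta> m) (p i))) * F N p) \<longlonglongrightarrow> 0"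
          using N(2) by (simp add: power_0_left)
      qed
    qed measurable
    hence "eventually (\<lambda>m. (\<integral>\<^sup>+p. ennreal ((\<Prod>i<N. norm (w (\<epsilon> m) (p i) - w (\<eta> m) (p i))) * F N p) \<partial>?P) < ennreal \<delta>') sequentially"
      using \<delta>' by (intro order_tendstoD(2)[where y = 0]) auto
    then obtain m where "(\<integral>\<^sup>+p. ennreal ((\<Prod>i<N. norm (w (\<epsilon> m) (p i) - w (\<eta> m) (p i))) * F N p) \<partial>?P) < ennreal \<delta>'"
      by (auto simp: eventually_sequentially)
    with \<epsilon>\<eta>(5)[of m] show False by (meson less_imp_le)
  qed
  then obtain e where e: "e > 0" "\<And>\<epsilon> \<eta>. 0 < \<epsilon> \<Longrightarrow> \<epsilon> \<le> e \<Longrightarrow> 0 < \<eta> \<Longrightarrow> \<eta> \<le> e \<Longrightarrow>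
     D \<epsilon> \<eta> \<le> ennreal \<delta>'"
    by blast
  show "\<exists>e>0. \<forall>\<epsilon> \<eta>. 0 < \<epsilon> \<and> \<epsilon> \<le> e \<and> 0 < \<eta> \<and> \<eta> \<le> e \<longrightarrow>
       (\<integral>\<^sup>+\<omega>. ennreal (\<bar>\<alpha> \<epsilon> \<omega> - \<alpha> \<eta> \<omega>\<bar> powr n) \<partial>M) \<le> ennreal \<delta>"
  proof (intro exI[of _ e] conjI e(1) allI impI, elim conjE)
    fix \<epsilon> \<eta> assume *: "0 < \<epsilon>" "\<epsilon> \<le> e" "0 < \<eta>" "\<eta> \<le> e"
    note [measurable] = \<alpha>_meas[OF *(1)] \<alpha>_meas[OF *(3)]
    let ?y = "\<lambda>\<omega>. \<bar>\<alpha> \<epsilon> \<omega> - \<alpha> \<eta> \<omega>\<bar>"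
    have "(\<integral>\<^sup>+\<omega>. ennreal (?y \<omega> powr n) \<partial>M) \<le> (\<integral>\<^sup>+\<omega>. ennreal (t powr n) + ennreal (t powr (n - N)) * ennreal (?y \<omega> ^ N) \<partial>M)"
    proof (rule nn_integral_mono)
      fix \<omega>
      have "?y \<omega> powr n \<le> t powr n + t powr (n - N) * ?y \<omega> powr N"
        using powr_le_add_powr[of "?y \<omega>" t n N] n t N by simp
      also have "?y \<omega> powr N = ?y \<omega> ^ N" using N by (intro powr_realpow') auto
      finally show "ennreal (?y \<omega> powr n) \<le> ennreal (t powr n) + ennreal (t powr (n - N)) * ennreal (?y \<omega> ^ N)"
        by (simp add: ennreal_mult[symmetric] ennreal_plus[symmetric] ennreal_leI del: ennreal_plus)
    qed
    also have "\<dots> = ennreal (t powr n) + ennreal (t powr (n - N)) * (\<integral>\<^sup>+\<omega>. ennreal (?y \<omega> ^ N) \<partial>M)"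
      by (subst nn_integral_add) (auto simp: nn_integral_cmult emeasure_space_1)
    also have "\<dots> \<le> ennreal (t powr n) + ennreal (t powr (n - N)) * ennreal \<delta>'"
      by (intro add_left_mono mult_left_mono order_trans[OF key e(2)[unfolded D_def]] *) auto
    also have "\<dots> = ennreal (t powr n + t powr (n - N) * \<delta>')"
      using \<delta>' by (simp add: ennreal_mult[symmetric] ennreal_plus[symmetric] del: ennreal_plus)
    also have "t powr n + t powr (n - N) * \<delta>' = \<delta>" using t by (simp add: \<delta>'_def)
    finally show "(\<integral>\<^sup>+\<omega>. ennreal (?y \<omega> powr n) \<partial>M) \<le> ennreal \<delta>" .
  qed
qed

section \<open>Fourier representation of derivatives of the heat kernel\<close>

text \<open>Integrability of all moments is stable under multiplication by a coordinate, which is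
  what a derivative does on the Fourier side; neither smoothness nor pointwise decay is
  demanded.\<close>

definition rapidly_decreasing :: "('v::euclidean_space \<Rightarrow> complex) \<Rightarrow> bool" where
  "rapidly_decreasing g \<longleftrightarrow> g \<in> borel_measurable borel \<and>
     (\<forall>m::nat. integrable lborel (\<lambda>p. norm p ^ m * norm (g p)))"

text \<open>The power of \<open>2 * pi\<close> is left to \<open>g\<close>, and \<open>f\<close> is
  real because the kernels to be represented are.\<close>

definition inverse_Fourier_of :: "('v::euclidean_space \<Rightarrow> complex) \<Rightarrow> ('v \<Rightarrow> real) \<Rightarrow> bool" where
  "inverse_Fourier_of g f \<longleftrightarrow> (\<forall>x. complex_of_real (f x) = (LINT p|lborel. g p * iexp (p \<bullet> x)))"

lemma rapidly_decreasing_integrable: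
  assumes "rapidly_decreasing g"
  shows "integrable lborel g"
proof -
  have "integrable lborel (\<lambda>p. norm (g p))"
    using assms unfolding rapidly_decreasing_def by (auto dest: spec[of _ 0])
  thus ?thesis
    using assms by (simp add: rapidly_decreasing_def integrable_norm_iff)
qed

lemma rapidly_decreasing_mult_component:
  fixes e :: "'v::euclidean_space"
  assumes g: "rapidly_decreasing g"
  shows "rapidly_decreasing (\<lambda>p. \<i> * complex_of_real (p \<bullet> e) * g p)"
  unfolding rapidly_decreasing_def
proof (intro conjI allI)
  have [measurable]: "g \<in> borel_measurable borel" using g by (simp add: rapidly_decreasing_def)
  show "(\<lambda>p. \<i> * complex_of_real (p \<bullet> e) * g p) \<in> borel_measurable borel" by measurable
  fix m
  have "integrable lborel (\<lambda>p. norm e * (norm p ^ Suc m * norm (g p)))"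
    using g unfolding rapidly_decreasing_def by (intro integrable_mult_right) blast
  thus "integrable lborel (\<lambda>p. norm p ^ m * norm (\<i> * complex_of_real (p \<bullet> e) * g p))"
  proof (rule Bochner_Integration.integrable_bound, measurable, intro AE_I2)
    fix p :: 'v
    have "norm p ^ m * norm (\<i> * complex_of_real (p \<bullet> e) * g p) = norm p ^ m * (\<bar>p \<bullet> e\<bar> * norm (g p))"
      by (simp add: norm_mult)
    also have "\<dots> \<le> norm p ^ m * ((norm p * norm e) * norm (g p))"
      by (intro mult_left_mono mult_right_mono Cauchy_Schwarz_ineq2) auto
    finally show "norm (norm p ^ m * norm (\<i> * complex_of_real (p \<bullet> e) * g p)) \<le> norm (norm e * (norm p ^ Suc m * norm (g p)))"
      by (simp add: mult_ac)
  qed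
qed

text \<open>Differentiation under the integral sign: the difference quotient of the exponential is
  at most \<open>\<bar>p \<bullet> e\<bar>\<close>, so dominated convergence applies along every
  null sequence of increments.\<close>

lemma inverse_Fourier_of_directional_deriv:
  fixes e :: "'v::euclidean_space"
  assumes g: "rapidly_decreasing g" and f: "inverse_Fourier_of g f"
  shows "inverse_Fourier_of (\<lambda>p. \<i> * complex_of_real (p \<bullet> e) * g p) (\<lambda>x. deriv (\<lambda>t. f (x + t *\<^sub>R e)) 0)"
  unfolding inverse_Fourier_of_def
proof
  fix x
  have [measurable]: "g \<in> borel_measurable borel" using g by (simp add: rapidly_decreasing_def)
  define L where "L = (LINT p|lborel. \<i> * complex_of_real (p \<bullet> e) * g p * iexp (p \<bullet> x))"
  have int: "integrable lborel (\<lambda>p. g p * iexp (p \<bullet> y))" for y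
    by (rule Bochner_Integration.integrable_bound[OF rapidly_decreasing_integrable[OF g]])
       (auto simp: norm_mult)
  have int1: "integrable lborel (\<lambda>p. \<bar>p \<bullet> e\<bar> * norm (g p))"
    using rapidly_decreasing_integrable[OF rapidly_decreasing_mult_component[OF g, of e], THEN integrable_norm]
    by (simp add: norm_mult)
  have lim: "((\<lambda>t. complex_of_real ((f (x + t *\<^sub>R e) - f x) / t)) \<longlongrightarrow> L) (at 0)"
    unfolding tendsto_at_iff_sequentially comp_def
  proof (intro allI impI)
    fix t :: "nat \<Rightarrow> real" assume t: "\<forall>n. t n \<in> UNIV - {0}" and lim_t: "t \<longlonglongrightarrow> 0"
    let ?D = "\<lambda>n p. g p * iexp (p \<bullet> x) * ((iexp (t n * (p \<bullet> e)) - 1) / t n)"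
    have eq: "complex_of_real ((f (x + t n *\<^sub>R e) - f x) / t n) = (LINT p|lborel. ?D n p)" for n
    proof -
      have "complex_of_real ((f (x + t n *\<^sub>R e) - f x) / t n)
        = (LINT p|lborel. (g p * iexp (p \<bullet> (x + t n *\<^sub>R e)) - g p * iexp (p \<bullet> x)) / t n)"
        using f int by (simp add: inverse_Fourier_of_def)
      also have "\<dots> = (LINT p|lborel. ?D n p)"
        by (intro Bochner_Integration.integral_cong refl)
           (simp add: inner_add_right distrib_left exp_add algebra_simps)
      finally show ?thesis .
    qed
    have le: "norm (iexp y - 1) \<le> \<bar>y\<bar>" for y using iexp_approx1[of y 0] by simp
    have D_le: "norm (?D n p) \<le> \<bar>p \<bullet> e\<bar> * norm (g p)" for n p
    proof -
      have "norm (?D n p) = norm (g p) * (norm (iexp (t n * (p \<bullet> e)) - 1) / \<bar>t n\<bar>)"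
        by (simp add: norm_mult norm_divide)
      also have "\<dots> \<le> norm (g p) * (\<bar>t n * (p \<bullet> e)\<bar> / \<bar>t n\<bar>)"
        by (intro mult_left_mono divide_right_mono le) auto
      also have "\<dots> = \<bar>p \<bullet> e\<bar> * norm (g p)" using t by (simp add: abs_mult)
      finally show ?thesis .
    qed
    have D_lim: "(\<lambda>n. ?D n p) \<longlonglongrightarrow> \<i> * complex_of_real (p \<bullet> e) * g p * iexp (p \<bullet> x)" for p
    proof -
      have "(\<lambda>n. (iexp (t n * (p \<bullet> e)) - 1) / t n - \<i> * complex_of_real (p \<bullet> e)) \<longlonglongrightarrow> 0"
      proof (rule Lim_null_comparison)
        have "(\<lambda>n. \<bar>t n\<bar> * (p \<bullet> e)\<^sup>2 / 2) \<longlonglongrightarrow> \<bar>0\<bar> * (p \<bullet> e)\<^sup>2 / 2"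
          by (intro tendsto_intros lim_t) auto
        thus "(\<lambda>n. \<bar>t n\<bar> * (p \<bullet> e)\<^sup>2 / 2) \<longlonglongrightarrow> 0" by simp
        have "norm ((iexp (t n * (p \<bullet> e)) - 1) / t n - \<i> * complex_of_real (p \<bullet> e)) \<le> \<bar>t n\<bar> * (p \<bullet> e)\<^sup>2 / 2" for n
        proof -
          have "(iexp (t n * (p \<bullet> e)) - 1) / t n - \<i> * complex_of_real (p \<bullet> e)
             = (iexp (t n * (p \<bullet> e)) - (1 + \<i> * complex_of_real (t n * (p \<bullet> e)))) / t n"
            using t by (simp add: field_simps)
          hence "norm ((iexp (t n * (p \<bullet> e)) - 1) / t n - \<i> * complex_of_real (p \<bullet> e))
              = norm (iexp (t n * (p \<bullet> e)) - (1 + \<i> * complex_of_real (t n * (p \<bullet> e)))) / \<bar>t n\<bar>"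
            by (simp add: norm_divide)
          also have "\<dots> \<le> (\<bar>t n * (p \<bullet> e)\<bar>\<^sup>2 / 2) / \<bar>t n\<bar>"
            using iexp_approx1[of "t n * (p \<bullet> e)" 1] by (intro divide_right_mono) (auto simp: numeral_2_eq_2)
          also have "\<dots> = \<bar>t n\<bar> * (p \<bullet> e)\<^sup>2 / 2"
            using t by (simp add: power2_eq_square abs_mult field_simps)
          finally show ?thesis .
        qed
        thus "\<forall>\<^sub>F n in sequentially. norm ((iexp (t n * (p \<bullet> e)) - 1) / t n - \<i> * complex_of_real (p \<bullet> e)) \<le> \<bar>t n\<bar> * (p \<bullet> e)\<^sup>2 / 2"
          by (intro always_eventually) auto
      qed
      hence "(\<lambda>n. (iexp (t n * (p \<bullet> e)) - 1) / t n) \<longlonglongrightarrow> \<i> * complex_of_real (p \<bullet> e)"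
        by (simp add: LIM_zero_iff)
      from tendsto_mult[OF tendsto_const[of "g p * iexp (p \<bullet> x)"] this] show ?thesis
        by (simp add: mult_ac)
    qed
    have "(\<lambda>n. LINT p|lborel. ?D n p) \<longlonglongrightarrow> L" unfolding L_def
    proof (rule integral_dominated_convergence[where w = "\<lambda>p. \<bar>p \<bullet> e\<bar> * norm (g p)"])
      show "AE p in lborel. (\<lambda>n. ?D n p) \<longlonglongrightarrow> \<i> * complex_of_real (p \<bullet> e) * g p * iexp (p \<bullet> x)"
        by (intro AE_I2 D_lim)
      show "AE p in lborel. norm (?D n p) \<le> \<bar>p \<bullet> e\<bar> * norm (g p)" for n
        by (intro AE_I2 D_le)
    qed (use int1 in measurable)
    thus "(\<lambda>n. complex_of_real ((f (x + t n *\<^sub>R e) - f x) / t n)) \<longlonglongrightarrow> L" by (simp only: eq)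
  qed
  have "((\<lambda>t. (f (x + t *\<^sub>R e) - f x) / t) \<longlongrightarrow> Re L) (at 0)"
    using tendsto_Re[OF lim] by simp
  hence "((\<lambda>t. f (x + t *\<^sub>R e)) has_field_derivative Re L) (at 0)"
    by (simp add: DERIV_def)
  hence deriv: "deriv (\<lambda>t. f (x + t *\<^sub>R e)) 0 = Re L" by (rule DERIV_imp_deriv)
  \<comment> \<open>The difference quotients are real, hence so is their limit; this identifies
    \<open>L\<close> with the real derivative.\<close>
  have "((\<lambda>t. Im (complex_of_real ((f (x + t *\<^sub>R e) - f x) / t))) \<longlongrightarrow> Im L) (at 0)"
    by (rule tendsto_Im[OF lim])
  hence "((\<lambda>t::real. 0::real) \<longlongrightarrow> Im L) (at 0)" by simp
  hence "Im L = 0" using tendsto_unique[of "at (0::real)" "\<lambda>_. 0::real" "Im L" 0] by simp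
  hence "L = complex_of_real (Re L)" by (simp add: complex_eq_iff)
  with deriv show "complex_of_real (deriv (\<lambda>t. f (x + t *\<^sub>R e)) 0) = (LINT p|lborel. \<i> * complex_of_real (p \<bullet> e) * g p * iexp (p \<bullet> x))"
    by (simp add: L_def)
qed

text \<open>Every partial derivative multiplies the Fourier side by a scalar. The order fixed in
  \<open>multi_partial_deriv\<close> therefore disappears, and the product along the sorted list
  becomes a product over all indices.\<close>

lemma inverse_Fourier_of_multi_partial_deriv:
  fixes k :: "nat ^ 'n::{finite,linorder}" and g :: "real ^ 'n::{finite,linorder} \<Rightarrow> complex"
  assumes g: "rapidly_decreasing g" and f: "inverse_Fourier_of g f"
  defines "G \<equiv> \<lambda>p. (\<Prod>j\<in>UNIV. (\<i> * complex_of_real (p $ j)) ^ (k $ j)) * g p"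
  shows "rapidly_decreasing G" "inverse_Fourier_of G (multi_partial_deriv k f)"
proof -
  have pw: "rapidly_decreasing (\<lambda>p. (\<i> * complex_of_real (p $ j)) ^ m * g p) \<and>
     inverse_Fourier_of (\<lambda>p. (\<i> * complex_of_real (p $ j)) ^ m * g p) ((partial_deriv j ^^ m) f)"
    if "rapidly_decreasing g" "inverse_Fourier_of g f" for j m g and f :: "real ^ 'n::{finite,linorder} \<Rightarrow> real"
  proof (induction m)
    case (Suc m)
    have eq: "p \<bullet> axis j 1 = p $ j" for p :: "real ^ 'n::{finite,linorder}" by (simp add: inner_axis)
    have "(\<lambda>x. deriv (\<lambda>t. (partial_deriv j ^^ m) f (x + t *\<^sub>R axis j 1)) 0) = (partial_deriv j ^^ Suc m) f"
      by (simp add: partial_deriv_def[abs_def])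
    with rapidly_decreasing_mult_component[OF conjunct1[OF Suc], of "axis j 1"]
      inverse_Fourier_of_directional_deriv[OF conjunct1[OF Suc] conjunct2[OF Suc], of "axis j 1"]
    show ?case unfolding eq by (simp add: mult_ac)
  qed (use that in simp)
  have list: "rapidly_decreasing (\<lambda>p. (\<Prod>j\<leftarrow>xs. (\<i> * complex_of_real (p $ j)) ^ (k $ j)) * g p) \<and>
     inverse_Fourier_of (\<lambda>p. (\<Prod>j\<leftarrow>xs. (\<i> * complex_of_real (p $ j)) ^ (k $ j)) * g p)
       (foldr (\<lambda>j. partial_deriv j ^^ (k $ j)) xs f)" for xs
  proof (induction xs)
    case (Cons a xs)
    from pw[OF conjunct1[OF Cons] conjunct2[OF Cons], of a "k $ a"] show ?case by (simp add: mult.assoc)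
  qed (use g f in simp)
  have "(\<Prod>j\<leftarrow>sorted_list_of_set UNIV. (\<i> * complex_of_real (p $ j)) ^ (k $ j)) = (\<Prod>j\<in>UNIV. (\<i> * complex_of_real (p $ j)) ^ (k $ j))" for p :: "real ^ 'n::{finite,linorder}"
    by (subst prod.distinct_set_conv_list[symmetric]) auto
  with list[of "sorted_list_of_set UNIV"] show "rapidly_decreasing G" "inverse_Fourier_of G (multi_partial_deriv k f)"
    unfolding G_def multi_partial_deriv_def by auto
qed

lemma rapidly_decreasing_Gaussian:
  assumes "\<epsilon> > 0"
  shows "rapidly_decreasing (\<lambda>p::'v::euclidean_space. complex_of_real (c * exp (- \<epsilon> * (norm p)\<^sup>2 / 2)))"
  unfolding rapidly_decreasing_def
proof (intro conjI allI)
  show "(\<lambda>p::'v. complex_of_real (c * exp (- \<epsilon> * (norm p)\<^sup>2 / 2))) \<in> borel_measurable borel" by measurable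
  fix m :: nat
  \<comment> \<open>\<open>exp_increment_bound\<close> with \<open>h = 1\<close>,
    \<open>z = 1\<close> and constant \<open>\<epsilon>/2\<close> compares the Gaussian with a
    power. This \<theta> absorbs the factor \<open>norm p ^ m\<close> and leaves the exponent
    \<open>DIM('v) + 1\<close>, just enough for integrability.\<close>
  define \<theta> where "\<theta> = real (m + DIM('v) + 1)"
  define C where "C = exp (\<theta>\<^sup>2 / (4 * (\<epsilon>/2)))"
  have "integrable lborel (\<lambda>p::'v. (1 + norm p) powr (- real (DIM('v) + 1)))"
    by (rule integrableI_nonneg) (use nn_integral_one_plus_norm_powr[where 'v = 'v, of "real (DIM('v) + 1)"] in auto)
  hence "integrable lborel (\<lambda>p::'v. \<bar>c\<bar> * C * (1 + norm p) powr (- real (DIM('v) + 1)))"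
    by (rule integrable_mult_right)
  thus "integrable lborel (\<lambda>p::'v. norm p ^ m * norm (complex_of_real (c * exp (- \<epsilon> * (norm p)\<^sup>2 / 2))))"
  proof (rule Bochner_Integration.integrable_bound, measurable, intro AE_I2)
    fix p :: 'v
    have p: "1 + norm p > 0" by (simp add: add_pos_nonneg)
    have "exp (- \<epsilon> * (norm p)\<^sup>2 / 2) \<le> C * (1 + norm p) powr (-\<theta>)"
      using exp_increment_bound[of "\<epsilon>/2" 1 \<theta> "norm p" 1] assms by (simp add: C_def \<theta>_def)
    moreover have "norm p ^ m \<le> (1 + norm p) powr real m"
      using p by (simp add: powr_realpow power_mono)
    ultimately have "norm p ^ m * exp (- \<epsilon> * (norm p)\<^sup>2 / 2) \<le> (1 + norm p) powr real m * (C * (1 + norm p) powr (-\<theta>))"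
      by (intro mult_mono) auto
    also have "\<dots> = C * (1 + norm p) powr (- real (DIM('v) + 1))"
    proof -
      have "(1 + norm p) powr real m * (1 + norm p) powr (-\<theta>) = (1 + norm p) powr (- real (DIM('v) + 1))"
        unfolding \<theta>_def powr_add[symmetric] by (rule arg_cong) simp
      thus ?thesis by simp
    qed
    finally have "\<bar>c\<bar> * (norm p ^ m * exp (- \<epsilon> * (norm p)\<^sup>2 / 2)) \<le> \<bar>c\<bar> * (C * (1 + norm p) powr (- real (DIM('v) + 1)))"
      by (rule mult_left_mono) simp
    moreover have "C > 0" by (simp add: C_def)
    ultimately show "norm (norm p ^ m * norm (complex_of_real (c * exp (- \<epsilon> * (norm p)\<^sup>2 / 2))))
       \<le> norm (\<bar>c\<bar> * C * (1 + norm p) powr (- real (DIM('v) + 1)))"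
      by (simp add: abs_mult norm_mult mult_ac del: of_real_mult)
  qed
qed

section \<open>Fourier transform of the heat kernel\<close>

lemma integral_lborel_prod:
  fixes f :: "'v::euclidean_space \<Rightarrow> real \<Rightarrow> complex"
  assumes f: "\<And>b. b \<in> Basis \<Longrightarrow> integrable lborel (f b)"
  shows "(LINT x|lborel. (\<Prod>b\<in>Basis. f b (x \<bullet> b))) = (\<Prod>b\<in>Basis. LINT x|lborel. f b x)"
proof -
  interpret L: product_sigma_finite "\<lambda>_::'v. lborel :: real measure" by unfold_locales
  have [measurable]: "f b \<in> borel_measurable borel" if "b \<in> Basis" for b using f[OF that] by auto
  have [measurable]: "(\<lambda>g. \<Sum>b\<in>Basis. g b *\<^sub>R b) \<in> borel_measurable (\<Pi>\<^sub>M b\<in>(Basis::'v set). (lborel :: real measure))"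
    by measurable
  have "(LINT x|lborel. (\<Prod>b\<in>Basis. f b (x \<bullet> b))) =
      (LINT g|(\<Pi>\<^sub>M b\<in>Basis. lborel). (\<Prod>b\<in>(Basis::'v set). f b ((\<Sum>b\<in>Basis. g b *\<^sub>R b) \<bullet> b)))"
    by (subst lborel_eq, subst integral_distr) auto
  also have "\<dots> = (LINT g|(\<Pi>\<^sub>M b\<in>Basis. lborel). (\<Prod>b\<in>(Basis::'v set). f b (g b)))"
    by (intro Bochner_Integration.integral_cong refl prod.cong) simp
  also have "\<dots> = (\<Prod>b\<in>Basis. LINT x|lborel. f b x)"
    by (rule L.product_integral_prod) (use f in auto)
  finally show ?thesis .
qed

text \<open>The characteristic function of the standard normal law at
  \<open>x / sqrt \<epsilon>\<close>, after the substitution of \<open>sqrt \<epsilon> * y\<close>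
  for the variable.\<close>

lemma Gaussian_Fourier_1d:
  assumes "\<epsilon> > 0"
  shows "integrable lborel (\<lambda>y. complex_of_real (exp (- \<epsilon> * y\<^sup>2 / 2)) * iexp (y * x))"
    and "(LINT y|lborel. complex_of_real (exp (- \<epsilon> * y\<^sup>2 / 2)) * iexp (y * x)) = complex_of_real (sqrt (2 * pi / \<epsilon>) * exp (- x\<^sup>2 / (2 * \<epsilon>)))"
proof -
  let ?s = "sqrt \<epsilon>"
  have s: "?s > 0" using assms by simp
  have "integrable lborel (\<lambda>y::real. complex_of_real (1 * exp (- \<epsilon> * (norm y)\<^sup>2 / 2)))"
    by (intro rapidly_decreasing_integrable rapidly_decreasing_Gaussian assms)
  thus "integrable lborel (\<lambda>y. complex_of_real (exp (- \<epsilon> * y\<^sup>2 / 2)) * iexp (y * x))"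
    by (rule Bochner_Integration.integrable_bound) (auto simp: norm_mult simp del: of_real_exp)
  have "complex_of_real (exp (- (x / ?s)\<^sup>2 / 2)) = (LINT y|std_normal_distribution. iexp (x / ?s * y))"
    using fun_cong[OF char_std_normal_distribution, of "x / ?s"] unfolding char_def by (rule sym)
  also have "\<dots> = (LINT y|lborel. std_normal_density y *\<^sub>R iexp (x / ?s * y))"
    by (rule integral_density) auto
  also have "\<dots> = \<bar>?s\<bar> *\<^sub>R (LINT y|lborel. std_normal_density (0 + ?s * y) *\<^sub>R iexp (x / ?s * (0 + ?s * y)))"
    by (rule lborel_integral_real_affine) (use s in simp)
  also have "\<dots> = \<bar>?s\<bar> *\<^sub>R (LINT y|lborel. complex_of_real (1 / sqrt (2 * pi)) * (complex_of_real (exp (- \<epsilon> * y\<^sup>2 / 2)) * iexp (y * x)))"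
    using s assms by (simp add: std_normal_density_def scaleR_conv_of_real power_mult_distrib mult_ac)
  also have "\<dots> = \<bar>?s\<bar> *\<^sub>R (complex_of_real (1 / sqrt (2 * pi)) * (LINT y|lborel. complex_of_real (exp (- \<epsilon> * y\<^sup>2 / 2)) * iexp (y * x)))"
    by (simp only: integral_mult_right_zero)
  finally have "(LINT y|lborel. complex_of_real (exp (- \<epsilon> * y\<^sup>2 / 2)) * iexp (y * x))
     = complex_of_real (sqrt (2 * pi) / ?s) * complex_of_real (exp (- (x / ?s)\<^sup>2 / 2))"
    using s by (simp add: scaleR_conv_of_real field_simps del: of_real_exp)
  also have "- (x / ?s)\<^sup>2 / 2 = - x\<^sup>2 / (2 * \<epsilon>)" using assms by (simp add: power_divide)
  finally show "(LINT y|lborel. complex_of_real (exp (- \<epsilon> * y\<^sup>2 / 2)) * iexp (y * x)) = complex_of_real (sqrt (2 * pi / \<epsilon>) * exp (- x\<^sup>2 / (2 * \<epsilon>)))"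
    by (simp add: real_sqrt_divide del: of_real_exp)
qed

lemma inverse_Fourier_of_heat_kernel:
  assumes "\<epsilon> > 0"
  shows "inverse_Fourier_of (\<lambda>p::real ^ 'n. complex_of_real ((1 / (2 * pi) ^ CARD('n)) * exp (- \<epsilon> * (norm p)\<^sup>2 / 2)))
     (heat_kernel \<epsilon>)"
  unfolding inverse_Fourier_of_def
proof
  fix x :: "real ^ 'n"
  let ?f = "\<lambda>b y. complex_of_real (exp (- \<epsilon> * y\<^sup>2 / 2)) * iexp (y * (x \<bullet> b))"
  have norm_sq: "(norm q)\<^sup>2 = (\<Sum>b\<in>Basis. (q \<bullet> b)\<^sup>2)" for q :: "real ^ 'n"
    unfolding power2_norm_eq_inner by (subst euclidean_inner) (simp add: power2_eq_square)
  have "complex_of_real (exp (- \<epsilon> * (norm p)\<^sup>2 / 2)) * iexp (p \<bullet> x) = (\<Prod>b\<in>Basis. ?f b (p \<bullet> b))" for p :: "real ^ 'n"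
  proof -
    have "p \<bullet> x = (\<Sum>b\<in>Basis. (p \<bullet> b) * (x \<bullet> b))" by (rule euclidean_inner)
    moreover have "- \<epsilon> * (norm p)\<^sup>2 / 2 = (\<Sum>b\<in>Basis. - \<epsilon> * (p \<bullet> b)\<^sup>2 / 2)"
      by (simp add: norm_sq sum_distrib_left sum_divide_distrib sum_negf)
    ultimately show ?thesis
      by (simp add: exp_sum prod.distrib sum_distrib_left del: of_real_exp flip: of_real_prod)
  qed
  hence "(LINT p|lborel. complex_of_real ((1 / (2 * pi) ^ CARD('n)) * exp (- \<epsilon> * (norm p)\<^sup>2 / 2)) * iexp (p \<bullet> x))
     = (LINT p|lborel. complex_of_real (1 / (2 * pi) ^ CARD('n)) * (\<Prod>b\<in>(Basis :: (real^'n) set). ?f b (p \<bullet> b)))"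
    by (simp only: of_real_mult mult.assoc)
  also have "\<dots> = complex_of_real (1 / (2 * pi) ^ CARD('n)) * (\<Prod>b\<in>(Basis :: (real^'n) set). LINT y|lborel. ?f b y)"
    unfolding integral_mult_right_zero
    by (subst integral_lborel_prod) (rule Gaussian_Fourier_1d(1)[OF assms], rule refl)
  also have "(\<Prod>b\<in>(Basis :: (real^'n) set). LINT y|lborel. ?f b y)
     = complex_of_real (\<Prod>b\<in>(Basis :: (real^'n) set). sqrt (2 * pi / \<epsilon>) * exp (- (x \<bullet> b)\<^sup>2 / (2 * \<epsilon>)))"
    unfolding of_real_prod by (intro prod.cong refl Gaussian_Fourier_1d(2) assms)
  also have "(\<Prod>b\<in>(Basis :: (real^'n) set). sqrt (2 * pi / \<epsilon>) * exp (- (x \<bullet> b)\<^sup>2 / (2 * \<epsilon>)))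
     = sqrt (2 * pi / \<epsilon>) ^ CARD('n) * exp (- (norm x)\<^sup>2 / (2 * \<epsilon>))"
    by (simp add: prod.distrib exp_sum[symmetric] norm_sq sum_negf sum_divide_distrib[symmetric])
  finally have "(LINT p|lborel. complex_of_real ((1 / (2 * pi) ^ CARD('n)) * exp (- \<epsilon> * (norm p)\<^sup>2 / 2)) * iexp (p \<bullet> x))
     = complex_of_real (1 / (2 * pi) ^ CARD('n) * (sqrt (2 * pi / \<epsilon>) ^ CARD('n) * exp (- (norm x)\<^sup>2 / (2 * \<epsilon>))))"
    by (simp only: of_real_mult)
  moreover have "1 / (2 * pi) ^ CARD('n) * sqrt (2 * pi / \<epsilon>) ^ CARD('n) = (2 * pi * \<epsilon>) powr (- real CARD('n) / 2)"
  proof -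
    have "1 / (2 * pi) ^ CARD('n) * sqrt (2 * pi / \<epsilon>) ^ CARD('n) = (sqrt (2 * pi / \<epsilon>) / (2 * pi)) ^ CARD('n)"
      by (simp add: power_divide)
    also have "sqrt (2 * pi / \<epsilon>) / (2 * pi) = 1 / sqrt (2 * pi * \<epsilon>)"
    proof -
      have "sqrt (2 * pi / \<epsilon>) * sqrt (2 * pi * \<epsilon>) = 2 * pi"
      proof -
        have "2 * pi / \<epsilon> * (2 * pi * \<epsilon>) = (2 * pi)\<^sup>2"
          using assms by (simp add: power2_eq_square)
        hence "sqrt (2 * pi / \<epsilon> * (2 * pi * \<epsilon>)) = 2 * pi" by (simp only: real_sqrt_abs) simp
        thus ?thesis by (simp only: real_sqrt_mult)
      qed
      thus ?thesis using assms by (simp add: field_simps)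
    qed
    also have "1 / sqrt (2 * pi * \<epsilon>) = (2 * pi * \<epsilon>) powr (- 1 / 2)"
      using assms by (simp add: powr_half_sqrt[symmetric] powr_minus_divide)
    also have "\<dots> ^ CARD('n) = (2 * pi * \<epsilon>) powr (- real CARD('n) / 2)"
      using assms by (simp add: powr_realpow[symmetric] powr_powr)
    finally show ?thesis .
  qed
  ultimately show "complex_of_real (heat_kernel \<epsilon> x) =
     (LINT p|lborel. complex_of_real ((1 / (2 * pi) ^ CARD('n)) * exp (- \<epsilon> * (norm p)\<^sup>2 / 2)) * iexp (p \<bullet> x))"
    unfolding heat_kernel_def by (simp only: mult.assoc[symmetric])
qed

section \<open>Characteristic functions and continuous versions\<close>

text \<open>The Dirac case really occurs, for instance for vanishing coefficients or at time 0; it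
  is treated separately from the standardised normal law.\<close>

lemma (in prob_space) gaussian_rv_integrable:
  assumes "gaussian_rv M X"
  shows "integrable M X" "integrable M (\<lambda>\<omega>. (X \<omega>)\<^sup>2)"
proof -
  have X [measurable]: "X \<in> borel_measurable M" using assms by (simp add: gaussian_rv_def)
  have "integrable M X \<and> integrable M (\<lambda>\<omega>. (X \<omega>)\<^sup>2)"
  proof (cases "\<exists>\<mu>. AE \<omega> in M. X \<omega> = \<mu>")
    case True
    then obtain \<mu> where \<mu>: "AE \<omega> in M. X \<omega> = \<mu>" by blast
    have "integrable M X \<longleftrightarrow> integrable M (\<lambda>_. \<mu>)" using \<mu> by (intro integrable_cong_AE) auto
    moreover have "integrable M (\<lambda>\<omega>. (X \<omega>)\<^sup>2) \<longleftrightarrow> integrable M (\<lambda>_. \<mu>\<^sup>2)"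
      using \<mu> by (intro integrable_cong_AE) auto
    ultimately show ?thesis by simp
  next
    case False
    then obtain \<mu> \<sigma> where \<sigma>: "\<sigma> > 0" and D: "distributed M lborel X (normal_density \<mu> \<sigma>)"
      using assms by (auto simp: gaussian_rv_def)
    define Y where "Y = (\<lambda>\<omega>. (X \<omega> - \<mu>) / \<sigma>)"
    have "distributed M lborel Y std_normal_density"
      using D normal_standard_normal_convert[OF \<sigma>, of X \<mu>] by (simp add: Y_def)
    hence distr: "distr M lborel Y = std_normal_distribution" by (simp add: distributed_def)
    have [measurable]: "Y \<in> borel_measurable M" unfolding Y_def by measurable
    have Y: "integrable M (\<lambda>\<omega>. Y \<omega> ^ m)" for m
      using integrable_std_normal_distribution_moment[of m] unfolding distr[symmetric]
      by (subst (asm) integrable_distr_eq) auto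
    have X_eq: "X = (\<lambda>\<omega>. \<mu> + \<sigma> * Y \<omega>)" using \<sigma> by (auto simp: Y_def)
    have X2_eq: "(\<lambda>\<omega>. (X \<omega>)\<^sup>2) = (\<lambda>\<omega>. \<mu>\<^sup>2 + 2 * \<mu> * \<sigma> * Y \<omega> ^ 1 + \<sigma>\<^sup>2 * Y \<omega> ^ 2)"
      unfolding X_eq by (auto simp: power2_eq_square algebra_simps)
    have "integrable M (\<lambda>\<omega>. \<mu> + \<sigma> * Y \<omega> ^ 1)"
      by (intro Bochner_Integration.integrable_add integrable_mult_right Y) simp
    moreover have "integrable M (\<lambda>\<omega>. (X \<omega>)\<^sup>2)"
      unfolding X2_eq by (intro Bochner_Integration.integrable_add integrable_mult_right Y) simp
    ultimately show ?thesis by (simp add: X_eq)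
  qed
  thus "integrable M X" "integrable M (\<lambda>\<omega>. (X \<omega>)\<^sup>2)" by auto
qed

lemma (in prob_space) gaussian_rv_char:
  assumes "gaussian_rv M X" and mean: "(\<integral>\<omega>. X \<omega> \<partial>M) = 0"
  shows "(\<integral>\<omega>. iexp (X \<omega>) \<partial>M) = complex_of_real (exp (- (\<integral>\<omega>. (X \<omega>)\<^sup>2 \<partial>M) / 2))"
proof -
  have X [measurable]: "X \<in> borel_measurable M" using assms by (simp add: gaussian_rv_def)
  show ?thesis
  proof (cases "\<exists>\<mu>. AE \<omega> in M. X \<omega> = \<mu>")
    case True
    then obtain \<mu> where \<mu>: "AE \<omega> in M. X \<omega> = \<mu>" by blast
    have "(\<integral>\<omega>. X \<omega> \<partial>M) = (\<integral>\<omega>. \<mu> \<partial>M)" using \<mu> by (intro integral_cong_AE) auto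
    hence "\<mu> = 0" using mean by (simp add: prob_space)
    have "(\<integral>\<omega>. iexp (X \<omega>) \<partial>M) = (\<integral>\<omega>. iexp 0 \<partial>M)"
      using \<mu> \<open>\<mu> = 0\<close> by (intro integral_cong_AE) auto
    moreover have "(\<integral>\<omega>. (X \<omega>)\<^sup>2 \<partial>M) = (\<integral>\<omega>. 0\<^sup>2 \<partial>M)"
      using \<mu> \<open>\<mu> = 0\<close> by (intro integral_cong_AE) auto
    ultimately show ?thesis by (simp add: prob_space)
  next
    case False
    then obtain \<mu> \<sigma> where \<sigma>: "\<sigma> > 0" and D: "distributed M lborel X (normal_density \<mu> \<sigma>)"
      using assms by (auto simp: gaussian_rv_def)
    have "\<mu> = 0" using normal_distributed_expectation[OF \<sigma> D] mean by simp
    define Y where "Y = (\<lambda>\<omega>. X \<omega> / \<sigma>)"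
    have "distributed M lborel Y std_normal_density"
      using D normal_standard_normal_convert[OF \<sigma>, of X \<mu>] \<open>\<mu> = 0\<close> by (simp add: Y_def)
    hence distr: "distr M lborel Y = std_normal_distribution" by (simp add: distributed_def)
    have [measurable]: "Y \<in> borel_measurable M" unfolding Y_def by measurable
    have X_eq: "X = (\<lambda>\<omega>. \<sigma> * Y \<omega>)" using \<sigma> by (auto simp: Y_def)
    have "(\<integral>\<omega>. (Y \<omega>)\<^sup>2 \<partial>M) = (\<integral>y. y\<^sup>2 \<partial>std_normal_distribution)"
      unfolding distr[symmetric] by (subst integral_distr) auto
    hence 1: "(\<integral>\<omega>. (X \<omega>)\<^sup>2 \<partial>M) = \<sigma>\<^sup>2"
      using std_normal_distribution_even_moments(1)[of 1] by (simp add: X_eq power_mult_distrib)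
    have "(\<integral>\<omega>. iexp (X \<omega>) \<partial>M) = (\<integral>y. iexp (\<sigma> * y) \<partial>std_normal_distribution)"
      unfolding distr[symmetric] X_eq by (subst integral_distr) auto
    also have "\<dots> = complex_of_real (exp (- \<sigma>\<^sup>2 / 2))"
      using fun_cong[OF char_std_normal_distribution, of \<sigma>] unfolding char_def .
    finally show ?thesis unfolding 1 .
  qed
qed

text \<open>Cross terms between different components vanish by independence and zero mean. What
  remains is the scalar covariance weighted with inner products of the frequencies.\<close>

lemma (in prob_space) fractional_brownian_motion_second_moment:
  fixes B :: "real \<Rightarrow> 'a \<Rightarrow> real ^ 'n" and p :: "nat \<Rightarrow> real ^ 'n" and s :: "nat \<Rightarrow> real"
  assumes B: "fractional_brownian_motion M H B" and s: "\<And>i. i < N \<Longrightarrow> 0 \<le> s i"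
  shows "gaussian_rv M (\<lambda>\<omega>. \<Sum>i<N. p i \<bullet> B (s i) \<omega>)"
    and "(\<integral>\<omega>. (\<Sum>i<N. p i \<bullet> B (s i) \<omega>) \<partial>M) = 0"
    and "(\<integral>\<omega>. (\<Sum>i<N. p i \<bullet> B (s i) \<omega>)\<^sup>2 \<partial>M) = fbm_form H {..<N} p s"
proof -
  have gp: "gaussian_rv M (\<lambda>\<omega>. \<Sum>t\<in>F. c t \<bullet> B t \<omega>)" if "finite F" "F \<subseteq> {0..}" for F c
    using B that by (simp add: fractional_brownian_motion_def gaussian_process_def)
  have comp: "gaussian_rv M (\<lambda>\<omega>. B t \<omega> $ j)" if "t \<ge> 0" for t j
    using gp[of "{t}" "\<lambda>_. axis j 1"] that by (simp add: inner_axis')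
  note int = gaussian_rv_integrable[OF comp]
  \<comment> \<open>The mean is prescribed for the vector-valued Bochner integral, which is 0 by
    convention for a non-integrable function; reading off the means of the components requires
    integrability first.\<close>
  have int_B: "integrable M (B t)" if "t \<ge> 0" for t
  proof -
    have "B t = (\<lambda>\<omega>. \<Sum>j\<in>UNIV. (B t \<omega> $ j) *\<^sub>R axis j 1)"
      by (auto simp: vec_eq_iff axis_def if_distrib cong: if_cong)
    moreover have "integrable M (\<lambda>\<omega>. \<Sum>j\<in>UNIV. (B t \<omega> $ j) *\<^sub>R axis j (1::real))"
      by (intro Bochner_Integration.integrable_sum integrable_scaleR_left) (use int(1)[OF that] in simp)
    ultimately show ?thesis by simp
  qed
  have EB: "(\<integral>\<omega>. B t \<omega> \<partial>M) = 0" if "t \<ge> 0" for t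
    using B that by (simp add: fractional_brownian_motion_def)
  have mean: "(\<integral>\<omega>. B t \<omega> $ j \<partial>M) = 0" if "t \<ge> 0" for t j
    using integral_inner_left[of "axis j 1" M "B t"] int_B[OF that] EB[OF that] by (simp add: inner_axis)
  have int2: "integrable M (\<lambda>\<omega>. B t \<omega> $ j * B t' \<omega> $ j')" if "t \<ge> 0" "t' \<ge> 0" for t t' j j'
  proof (rule Bochner_Integration.integrable_bound)
    show "integrable M (\<lambda>\<omega>. (B t \<omega> $ j)\<^sup>2 + (B t' \<omega> $ j')\<^sup>2)"
      by (intro Bochner_Integration.integrable_add int that)
    have "\<bar>x * y\<bar> \<le> x\<^sup>2 + y\<^sup>2" for x y :: real
    proof -
      have "2 * (\<bar>x\<bar> * \<bar>y\<bar>) \<le> x\<^sup>2 + y\<^sup>2"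
        using sum_squares_bound[of "\<bar>x\<bar>" "\<bar>y\<bar>"] by (simp only: power2_abs mult.assoc)
      moreover have "0 \<le> \<bar>x\<bar> * \<bar>y\<bar>" by simp
      ultimately show ?thesis unfolding abs_mult by linarith
    qed
    thus "AE \<omega> in M. norm (B t \<omega> $ j * B t' \<omega> $ j') \<le> norm ((B t \<omega> $ j)\<^sup>2 + (B t' \<omega> $ j')\<^sup>2)"
      by (intro AE_I2) simp
  qed (use int(1)[OF that(1), of j] int(1)[OF that(2), of j'] in measurable)
  have cov: "(\<integral>\<omega>. B t \<omega> $ j * B t' \<omega> $ j' \<partial>M) = (if j = j' then fbm_cov H t t' else 0)" if "t \<ge> 0" "t' \<ge> 0" for t t' j j'
  proof (cases "j = j'")
    case True
    have "(\<integral>\<omega>. B t \<omega> $ j * B t' \<omega> $ j \<partial>M) = (t powr (2 * H) + t' powr (2 * H) - \<bar>t - t'\<bar> powr (2 * H)) / 2"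
      using B that unfolding fractional_brownian_motion_def by blast
    thus ?thesis using True that by (simp add: fbm_cov_def)
  next
    case False
    have "indep_vars (\<lambda>j. \<Pi>\<^sub>M t\<in>{0..}. borel) (\<lambda>j \<omega>. \<lambda>t\<in>{0..}. B t \<omega> $ j) UNIV"
      using B by (simp add: fractional_brownian_motion_def)
    \<comment> \<open>Evaluating component \<open>j\<close> at \<open>t\<close> and every other
      component at \<open>t'\<close> turns independence of whole paths into independence of the two
      values.\<close>
    hence "indep_vars (\<lambda>j. borel) (\<lambda>i \<omega>. (\<lambda>t\<in>{0..}. B t \<omega> $ i) (if i = j then t else t')) UNIV"
      by (rule indep_vars_compose2) (use that in \<open>auto intro!: measurable_component_singleton\<close>)
    hence "indep_vars (\<lambda>j. borel) (\<lambda>i \<omega>. B (if i = j then t else t') \<omega> $ i) UNIV"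
      using that by (simp add: restrict_def if_distrib cong: if_cong)
    hence "indep_vars (\<lambda>j. borel) (\<lambda>i \<omega>. B (if i = j then t else t') \<omega> $ i) {j, j'}"
      by (rule indep_vars_subset) auto
    hence "(\<integral>\<omega>. (\<Prod>i\<in>{j,j'}. B (if i = j then t else t') \<omega> $ i) \<partial>M)
        = (\<Prod>i\<in>{j,j'}. \<integral>\<omega>. B (if i = j then t else t') \<omega> $ i \<partial>M)"
      using that by (intro indep_vars_lebesgue_integral) (auto intro: int)
    thus ?thesis using False mean that by auto
  qed
  \<comment> \<open>\<open>gaussian_process\<close> sums over a set of times, whereas the
    \<open>s i\<close> may coincide; frequencies at equal times are added up first.\<close>
  have "(\<lambda>\<omega>. \<Sum>i<N. p i \<bullet> B (s i) \<omega>) = (\<lambda>\<omega>. \<Sum>t\<in>s ` {..<N}. (\<Sum>i\<in>{i\<in>{..<N}. s i = t}. p i) \<bullet> B t \<omega>)"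
  proof
    fix \<omega>
    show "(\<Sum>i<N. p i \<bullet> B (s i) \<omega>) = (\<Sum>t\<in>s ` {..<N}. (\<Sum>i\<in>{i\<in>{..<N}. s i = t}. p i) \<bullet> B t \<omega>)"
      by (subst sum.image_gen[of "{..<N}" _ s]) (auto simp: inner_sum_left intro!: sum.cong)
  qed
  thus "gaussian_rv M (\<lambda>\<omega>. \<Sum>i<N. p i \<bullet> B (s i) \<omega>)"
    using gp[of "s ` {..<N}" "\<lambda>t. \<Sum>i\<in>{i\<in>{..<N}. s i = t}. p i"] s by auto
  have expand: "(\<Sum>i<N. p i \<bullet> B (s i) \<omega>) = (\<Sum>i<N. \<Sum>j\<in>UNIV. p i $ j * B (s i) \<omega> $ j)" for \<omega>
    by (simp add: inner_vec_def)
  have "(\<integral>\<omega>. (\<Sum>i<N. p i \<bullet> B (s i) \<omega>) \<partial>M) = (\<Sum>i<N. \<Sum>j\<in>UNIV. p i $ j * (\<integral>\<omega>. B (s i) \<omega> $ j \<partial>M))"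
  proof -
    have i: "integrable M (\<lambda>\<omega>. p i $ j * B (s i) \<omega> $ j)" if "i \<in> {..<N}" for i j
      using that s by (intro integrable_mult_right int) auto
    have "(\<integral>\<omega>. (\<Sum>i<N. p i \<bullet> B (s i) \<omega>) \<partial>M) = (\<Sum>i<N. \<integral>\<omega>. (\<Sum>j\<in>UNIV. p i $ j * B (s i) \<omega> $ j) \<partial>M)"
      unfolding expand by (rule Bochner_Integration.integral_sum) (intro Bochner_Integration.integrable_sum i)
    also have "\<dots> = (\<Sum>i<N. \<Sum>j\<in>UNIV. \<integral>\<omega>. p i $ j * B (s i) \<omega> $ j \<partial>M)"
      by (intro sum.cong refl Bochner_Integration.integral_sum i)
    finally show ?thesis by simp
  qed
  also have "\<dots> = 0" using s by (simp add: mean)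
  finally show "(\<integral>\<omega>. (\<Sum>i<N. p i \<bullet> B (s i) \<omega>) \<partial>M) = 0" .
  define A where "A = {..<N} \<times> (UNIV :: 'n set)"
  define c where "c = (\<lambda>(i, j). p i $ j)"
  define Z where "Z = (\<lambda>(i, j) \<omega>. B (s i) \<omega> $ j)"
  have "(\<Sum>i<N. p i \<bullet> B (s i) \<omega>)\<^sup>2 = (\<Sum>a\<in>A. \<Sum>b\<in>A. (c a * c b) * (Z a \<omega> * Z b \<omega>))" for \<omega>
    unfolding expand power2_eq_square A_def c_def Z_def sum.cartesian_product sum_product
    by (intro sum.cong refl) (auto simp: mult_ac)
  moreover have "integrable M (\<lambda>\<omega>. (c a * c b) * (Z a \<omega> * Z b \<omega>))" if "a \<in> A" "b \<in> A" for a b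
    using that s by (intro integrable_mult_right) (auto simp: A_def Z_def intro!: int2)
  ultimately have "(\<integral>\<omega>. (\<Sum>i<N. p i \<bullet> B (s i) \<omega>)\<^sup>2 \<partial>M) = (\<Sum>a\<in>A. \<Sum>b\<in>A. (c a * c b) * (\<integral>\<omega>. Z a \<omega> * Z b \<omega> \<partial>M))"
    by (simp add: Bochner_Integration.integral_sum)
  also have "\<dots> = (\<Sum>a\<in>A. \<Sum>b\<in>A. (c a * c b) * (if snd a = snd b then fbm_cov H (s (fst a)) (s (fst b)) else 0))"
    using s by (intro sum.cong refl) (auto simp: A_def Z_def cov)
  also have "\<dots> = (\<Sum>i<N. \<Sum>j\<in>UNIV. \<Sum>l<N. \<Sum>j'\<in>UNIV. (p i $ j * p l $ j') * (if j = j' then fbm_cov H (s i) (s l) else 0))"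
    unfolding A_def c_def by (simp only: sum.cartesian_product' fst_conv snd_conv case_prod_conv)
  also have "\<dots> = (\<Sum>i<N. \<Sum>j\<in>UNIV. \<Sum>l<N. (p i $ j * p l $ j) * fbm_cov H (s i) (s l))"
    by (simp add: if_distrib cong: if_cong)
  also have "\<dots> = (\<Sum>i<N. \<Sum>l<N. \<Sum>j\<in>UNIV. (p i $ j * p l $ j) * fbm_cov H (s i) (s l))"
    by (intro sum.cong refl sum.swap)
  also have "\<dots> = fbm_form H {..<N} p s"
    by (simp add: fbm_form_def inner_vec_def sum_distrib_right)
  finally show "(\<integral>\<omega>. (\<Sum>i<N. p i \<bullet> B (s i) \<omega>)\<^sup>2 \<partial>M) = fbm_form H {..<N} p s" .
qed

lemma (in prob_space) fractional_brownian_motion_char: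
  fixes B :: "real \<Rightarrow> 'a \<Rightarrow> real ^ 'n" and p :: "nat \<Rightarrow> real ^ 'n" and s :: "nat \<Rightarrow> real"
  assumes B: "fractional_brownian_motion M H B" and s: "\<And>i. i < N \<Longrightarrow> 0 \<le> s i"
  shows "(\<integral>\<omega>. iexp (\<Sum>i<N. p i \<bullet> B (s i) \<omega>) \<partial>M) = complex_of_real (exp (- fbm_form H {..<N} p s / 2))"
  using gaussian_rv_char[OF fractional_brownian_motion_second_moment(1,2)[OF assms, where p = p]]
  by (simp only: fractional_brownian_motion_second_moment(3)[OF assms])

lemma fractional_brownian_motion_measurable:
  assumes "fractional_brownian_motion M H B" "t \<ge> 0"
  shows "B t \<in> borel_measurable M"
proof -
  have "(\<lambda>\<omega>. b \<bullet> B t \<omega>) \<in> borel_measurable M" for b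
    using assms unfolding fractional_brownian_motion_def gaussian_process_def gaussian_rv_def
    by (auto dest!: spec[of _ "{t}"] spec[of _ "\<lambda>_. b"])
  thus ?thesis by (subst borel_measurable_euclidean_space) (auto simp: inner_commute)
qed

text \<open>The second process enters with frequencies \<open>- p i\<close>, and the quadratic form
  is even, so both factors have the same shape.\<close>

lemma (in prob_space) indep_fractional_brownian_motion_char:
  fixes B B' :: "real \<Rightarrow> 'a \<Rightarrow> real ^ 'n" and p :: "nat \<Rightarrow> real ^ 'n" and s r :: "nat \<Rightarrow> real"
  assumes B: "fractional_brownian_motion M H B" "fractional_brownian_motion M H B'"
    and indep: "indep_processes M B B'"
    and s: "\<And>i. i < N \<Longrightarrow> 0 \<le> s i" and r: "\<And>i. i < N \<Longrightarrow> 0 \<le> r i"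
  shows "(\<integral>\<omega>. iexp (\<Sum>i<N. p i \<bullet> (B (s i) \<omega> - B' (r i) \<omega>)) \<partial>M) =
     complex_of_real (exp (- fbm_form H {..<N} p s / 2) * exp (- fbm_form H {..<N} p r / 2))"
proof -
  let ?P = "\<Pi>\<^sub>M t\<in>{0..}. borel :: (real ^ 'n) measure"
  let ?Y = "\<lambda>p s f. iexp (\<Sum>i<N. p i \<bullet> f (s i))"
  have Y: "?Y p s \<in> borel_measurable ?P" if "\<And>i. i < N \<Longrightarrow> 0 \<le> s i" for p and s :: "nat \<Rightarrow> real"
  proof -
    have [measurable]: "(\<lambda>f. f (s i)) \<in> borel_measurable ?P" if "i \<in> {..<N}" for i
      using that \<open>\<And>i. i < N \<Longrightarrow> 0 \<le> s i\<close> by (intro measurable_component_singleton) auto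
    have "(\<lambda>f. \<Sum>i<N. p i \<bullet> f (s i)) \<in> borel_measurable ?P" by measurable
    thus ?thesis by measurable
  qed
  have "indep_var borel (?Y p s \<circ> (\<lambda>\<omega>. \<lambda>t\<in>{0..}. B t \<omega>)) borel (?Y (\<lambda>i. - p i) r \<circ> (\<lambda>\<omega>. \<lambda>t\<in>{0..}. B' t \<omega>))"
    using indep unfolding indep_processes_def by (rule indep_var_compose) (intro Y s r; assumption)+
  moreover have "?Y p s \<circ> (\<lambda>\<omega>. \<lambda>t\<in>{0..}. B t \<omega>) = (\<lambda>\<omega>. iexp (\<Sum>i<N. p i \<bullet> B (s i) \<omega>))"
    using s by (auto simp: fun_eq_iff intro!: sum.cong)
  moreover have "?Y (\<lambda>i. - p i) r \<circ> (\<lambda>\<omega>. \<lambda>t\<in>{0..}. B' t \<omega>) = (\<lambda>\<omega>. iexp (\<Sum>i<N. (- p i) \<bullet> B' (r i) \<omega>))"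
    using r by (auto simp: fun_eq_iff intro!: sum.cong)
  ultimately have iv: "indep_var borel (\<lambda>\<omega>. iexp (\<Sum>i<N. p i \<bullet> B (s i) \<omega>)) borel (\<lambda>\<omega>. iexp (\<Sum>i<N. (- p i) \<bullet> B' (r i) \<omega>))"
    by simp
  have int: "integrable M (\<lambda>\<omega>. iexp (\<Sum>i<N. p i \<bullet> B (s i) \<omega>))"
    if "fractional_brownian_motion M H B" "\<And>i. i < N \<Longrightarrow> 0 \<le> s i" for p s and B :: "real \<Rightarrow> 'a \<Rightarrow> real ^ 'n"
  proof (rule integrable_const_bound[where B = 1])
    have "(\<lambda>\<omega>. \<Sum>i<N. p i \<bullet> B (s i) \<omega>) \<in> borel_measurable M"
      using fractional_brownian_motion_second_moment(1)[OF that, where p = p] by (simp add: gaussian_rv_def)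
    thus "(\<lambda>\<omega>. iexp (\<Sum>i<N. p i \<bullet> B (s i) \<omega>)) \<in> borel_measurable M" by measurable
  qed simp
  have "(\<integral>\<omega>. iexp (\<Sum>i<N. p i \<bullet> (B (s i) \<omega> - B' (r i) \<omega>)) \<partial>M)
     = (\<integral>\<omega>. iexp (\<Sum>i<N. p i \<bullet> B (s i) \<omega>) * iexp (\<Sum>i<N. (- p i) \<bullet> B' (r i) \<omega>) \<partial>M)"
    by (intro Bochner_Integration.integral_cong refl)
       (simp add: exp_add[symmetric] inner_diff_right sum_subtractf sum_negf algebra_simps)
  also have "\<dots> = (\<integral>\<omega>. iexp (\<Sum>i<N. p i \<bullet> B (s i) \<omega>) \<partial>M) * (\<integral>\<omega>. iexp (\<Sum>i<N. (- p i) \<bullet> B' (r i) \<omega>) \<partial>M)"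
    by (intro indep_var_lebesgue_integral iv int B s r)
  also have "\<dots> = complex_of_real (exp (- fbm_form H {..<N} p s / 2)) * complex_of_real (exp (- fbm_form H {..<N} (\<lambda>i. - p i) r / 2))"
    by (intro arg_cong2[where f = "(*)"] fractional_brownian_motion_char B s r)
  also have "fbm_form H {..<N} (\<lambda>i. - p i) r = fbm_form H {..<N} p r" by (simp add: fbm_form_def)
  finally show ?thesis by (simp only: of_real_mult)
qed

text \<open>The set of discontinuous paths need not be measurable, so the process is replaced by 0
  on a measurable null set containing it. Freezing the time at \<open>max 0 t\<close> gives
  continuity on the whole line, although nothing is known at negative times.\<close>

lemma fractional_brownian_motion_continuous_version:
  fixes B :: "real \<Rightarrow> 'a \<Rightarrow> real ^ 'n"
  assumes B: "fractional_brownian_motion M H B"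
  obtains X :: "real \<Rightarrow> 'a \<Rightarrow> real ^ 'n" where "\<forall>t. X t \<in> borel_measurable M"
    "\<forall>\<omega>. continuous_on UNIV (\<lambda>t. X t \<omega>)" "AE \<omega> in M. \<forall>t\<ge>0. X t \<omega> = B t \<omega>"
proof -
  have "AE \<omega> in M. continuous_on {0..} (\<lambda>t. B t \<omega>)"
    using B by (simp add: fractional_brownian_motion_def)
  then obtain N where N: "{\<omega> \<in> space M. \<not> continuous_on {0..} (\<lambda>t. B t \<omega>)} \<subseteq> N" "N \<in> null_sets M"
    by (auto elim!: AE_E simp: null_sets_def)
  define X where "X = (\<lambda>t \<omega>. if \<omega> \<in> space M - N then B (max 0 t) \<omega> else 0)"
  show ?thesis
  proof (rule that[of X])
    have [measurable]: "N \<in> sets M" using N by auto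
    show "\<forall>t. X t \<in> borel_measurable M"
    proof
      fix t
      have [measurable]: "B (max 0 t) \<in> borel_measurable M"
        by (rule fractional_brownian_motion_measurable[OF B]) simp
      show "X t \<in> borel_measurable M" unfolding X_def by measurable
    qed
    show "\<forall>\<omega>. continuous_on UNIV (\<lambda>t. X t \<omega>)"
    proof
      fix \<omega>
      show "continuous_on UNIV (\<lambda>t. X t \<omega>)"
      proof (cases "\<omega> \<in> space M - N")
        case True
        hence "continuous_on {0..} (\<lambda>t. B t \<omega>)" using N by auto
        hence "continuous_on UNIV (\<lambda>t. B (max 0 t) \<omega>)"
          by (rule continuous_on_compose2) (auto intro!: continuous_intros)
        thus ?thesis using True by (simp add: X_def)
      next
        case False
        hence "X t \<omega> = 0" for t by (auto simp: X_def)
        thus ?thesis by simp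
      qed
    qed
    have "AE \<omega> in M. \<omega> \<notin> N" by (rule AE_not_in[OF N(2)])
    thus "AE \<omega> in M. \<forall>t\<ge>0. X t \<omega> = B t \<omega>" using AE_space
      by eventually_elim (simp add: X_def max_def)
  qed
qed

text \<open>Rounding the time down to a multiple of \<open>1 / Suc m\<close> leaves countably many
  random variables, which gives joint measurability; path continuity passes it to the limit.\<close>

lemma continuous_process_jointly_measurable:
  fixes X :: "real \<Rightarrow> 'a \<Rightarrow> 'b::euclidean_space"
  assumes X: "\<forall>t. X t \<in> borel_measurable M" and cont: "\<forall>\<omega>. continuous_on UNIV (\<lambda>t. X t \<omega>)"
  shows "(\<lambda>x. X (fst x) (snd x)) \<in> borel_measurable (borel \<Otimes>\<^sub>M M)"
proof (rule borel_measurable_LIMSEQ_metric)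
  fix m :: nat
  note [measurable] = X[rule_format]
  show "(\<lambda>x. X (real_of_int \<lfloor>real (Suc m) * fst x\<rfloor> / real (Suc m)) (snd x)) \<in> borel_measurable (borel \<Otimes>\<^sub>M M)"
    by (rule measurable_compose_countable[where f = "\<lambda>i x. X (real_of_int i / real (Suc m)) (snd x)"
          and g = "\<lambda>x. \<lfloor>real (Suc m) * fst x\<rfloor>"]) measurable
next
  fix x :: "real \<times> 'a"
  have "(\<lambda>m. real_of_int \<lfloor>real (Suc m) * fst x\<rfloor> / real (Suc m) - fst x) \<longlonglongrightarrow> 0"
  proof (rule Lim_null_comparison)
    show "(\<lambda>m. 1 / real (Suc m)) \<longlonglongrightarrow> 0" using LIMSEQ_inverse_real_of_nat by (simp add: inverse_eq_divide)
    have "norm (real_of_int \<lfloor>real (Suc m) * fst x\<rfloor> / real (Suc m) - fst x) \<le> 1 / real (Suc m)" for m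
    proof -
      have "real_of_int \<lfloor>real (Suc m) * fst x\<rfloor> / real (Suc m) - fst x = (real_of_int \<lfloor>real (Suc m) * fst x\<rfloor> - real (Suc m) * fst x) / real (Suc m)"
        by (simp add: field_simps)
      moreover have "\<bar>real_of_int \<lfloor>y\<rfloor> - y\<bar> \<le> 1" for y :: real by linarith
      ultimately show ?thesis by (simp only: real_norm_def abs_divide) (simp add: divide_right_mono)
    qed
    thus "\<forall>\<^sub>F m in sequentially. norm (real_of_int \<lfloor>real (Suc m) * fst x\<rfloor> / real (Suc m) - fst x) \<le> 1 / real (Suc m)"
      by (intro always_eventually) auto
  qed
  hence "(\<lambda>m. real_of_int \<lfloor>real (Suc m) * fst x\<rfloor> / real (Suc m)) \<longlonglongrightarrow> fst x" by (simp only: LIM_zero_iff)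
  moreover have "isCont (\<lambda>t. X t (snd x)) (fst x)"
    using cont by (simp add: continuous_on_eq_continuous_at)
  ultimately show "(\<lambda>m. X (real_of_int \<lfloor>real (Suc m) * fst x\<rfloor> / real (Suc m)) (snd x)) \<longlonglongrightarrow> X (fst x) (snd x)"
    by (rule isCont_tendsto_compose[rotated])
qed

lemma borel_measurable_completion_AE_eq:
  fixes f g :: "'a \<Rightarrow> 'b::topological_space"
  assumes g: "g \<in> borel_measurable M" and AE: "AE x in M. f x = g x"
  shows "f \<in> borel_measurable (completion M)"
proof (rule borel_measurableI)
  fix S :: "'b set" assume "open S"
  have m: "{x \<in> space M. f x \<noteq> g x \<and> P x} \<in> sets (completion M)" for P
  proof -
    have "AE x in M. \<not> (f x \<noteq> g x \<and> P x)" using AE by eventually_elim simp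
    from sets_completion_AE[OF this] show ?thesis by (simp add: pred_def)
  qed
  have "g -` S \<inter> space M \<in> sets (completion M)"
    using measurable_sets[OF g borel_open[OF \<open>open S\<close>]] by simp
  hence "(g -` S \<inter> space M - {x \<in> space M. f x \<noteq> g x \<and> f x \<notin> S}) \<union> {x \<in> space M. f x \<noteq> g x \<and> f x \<in> S} \<in> sets (completion M)"
    by (intro sets.Un sets.Diff m)
  also have "(g -` S \<inter> space M - {x \<in> space M. f x \<noteq> g x \<and> f x \<notin> S}) \<union> {x \<in> space M. f x \<noteq> g x \<and> f x \<in> S} = f -` S \<inter> space (completion M)"
    by auto
  finally show "f -` S \<inter> space (completion M) \<in> sets (completion M)" .
qed

text \<open>Carries the convergence from the continuous versions, measurable on \<open>M\<close>,
  back to the original processes, where measurability holds only on the completion. The limit is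
  unchanged.\<close>

lemma converges_in_Lp_completion:
  assumes conv: "converges_in_Lp M n g F" and eq: "\<And>i. AE x in M. f i x = g i x"
  shows "converges_in_Lp (completion M) n f F"
proof -
  have inLp: "in_Lp (completion M) n u" if "in_Lp M n v" "AE x in M. u x = v x" for u v :: "'a \<Rightarrow> real"
  proof -
    have [measurable]: "v \<in> borel_measurable M" using that by (simp add: in_Lp_def)
    have u [measurable]: "u \<in> borel_measurable (completion M)"
      by (rule borel_measurable_completion_AE_eq[OF _ that(2)]) measurable
    have [measurable]: "v \<in> borel_measurable (completion M)" by (rule measurable_completion) measurable
    have "integrable (completion M) (\<lambda>x. \<bar>u x\<bar> powr n) \<longleftrightarrow> integrable (completion M) (\<lambda>x. \<bar>v x\<bar> powr n)"
      using AE_completion[OF that(2)] by (intro integrable_cong_AE) auto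
    also have "\<dots> \<longleftrightarrow> integrable M (\<lambda>x. \<bar>v x\<bar> powr n)" by (rule integrable_completion) measurable
    finally show ?thesis using that u by (simp add: in_Lp_def)
  qed
  obtain X where X: "in_Lp M n X" "((\<lambda>i. \<integral>x. \<bar>g i x - X x\<bar> powr n \<partial>M) \<longlongrightarrow> 0) F"
    and ev: "\<forall>\<^sub>F i in F. in_Lp M n (g i)"
    using conv by (auto simp: converges_in_Lp_def)
  show ?thesis unfolding converges_in_Lp_def
  proof (intro conjI exI[of _ X])
    show "\<forall>\<^sub>F i in F. in_Lp (completion M) n (f i)"
      using ev by eventually_elim (rule inLp[OF _ eq])
    show "in_Lp (completion M) n X" by (rule inLp[OF X(1)]) simp
    have "\<forall>\<^sub>F i in F. (\<integral>x. \<bar>g i x - X x\<bar> powr n \<partial>M) = (\<integral>x. \<bar>f i x - X x\<bar> powr n \<partial>completion M)"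
      using ev
    proof eventually_elim
      case (elim i)
      have [measurable]: "g i \<in> borel_measurable M" "X \<in> borel_measurable M" using elim X by (auto simp: in_Lp_def)
      have [measurable]: "f i \<in> borel_measurable (completion M)"
        by (rule borel_measurable_completion_AE_eq[OF _ eq]) measurable
      have [measurable]: "g i \<in> borel_measurable (completion M)" "X \<in> borel_measurable (completion M)"
        by (rule measurable_completion, measurable)+
      have "(\<integral>x. \<bar>f i x - X x\<bar> powr n \<partial>completion M) = (\<integral>x. \<bar>g i x - X x\<bar> powr n \<partial>completion M)"
        using AE_completion[OF eq[of i]] by (intro integral_cong_AE) auto
      also have "\<dots> = (\<integral>x. \<bar>g i x - X x\<bar> powr n \<partial>M)" by (rule integral_completion) measurable
      finally show ?case by simp
    qed
    with X(2) show "((\<lambda>i. \<integral>x. \<bar>f i x - X x\<bar> powr n \<partial>completion M) \<longlongrightarrow> 0) F"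
      by (rule Lim_transform_eventually)
  qed
qed

section \<open>Convergence of the approximations\<close>

text \<open>The shape of all exchanges below: an integrable weight in one variable and a bounded
  kernel over a probability space in the other.\<close>

lemma Fubini_prob_bounded:
  fixes h :: "'a \<Rightarrow> 'b \<Rightarrow> complex" and G :: "'a \<Rightarrow> complex"
  assumes "sigma_finite_measure L" "prob_space Q" and G: "integrable L G"
    and h: "(\<lambda>x. h (fst x) (snd x)) \<in> borel_measurable (L \<Otimes>\<^sub>M Q)" and bound: "\<And>p q. norm (h p q) \<le> 1"
  shows "(LINT q|Q. LINT p|L. G p * h p q) = (LINT p|L. G p * (LINT q|Q. h p q))"
proof -
  interpret L: sigma_finite_measure L by fact
  interpret Q: prob_space Q by fact
  interpret pair_sigma_finite L Q by unfold_locales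
  have [measurable]: "G \<in> borel_measurable L" using G by (rule borel_measurable_integrable)
  have Gfst: "integrable (L \<Otimes>\<^sub>M Q) (\<lambda>x. G (fst x))"
  proof (rule integrableI_bounded)
    have "(\<integral>\<^sup>+x. ennreal (norm (G (fst x))) \<partial>(L \<Otimes>\<^sub>M Q)) = (\<integral>\<^sup>+p. \<integral>\<^sup>+q. ennreal (norm (G p)) \<partial>Q \<partial>L)"
      by (subst Q.nn_integral_fst[symmetric]) (auto simp: split_beta')
    also have "\<dots> < \<infinity>" using G by (simp add: Q.emeasure_space_1 integrable_iff_bounded)
    finally show "(\<integral>\<^sup>+x. ennreal (norm (G (fst x))) \<partial>(L \<Otimes>\<^sub>M Q)) < \<infinity>" .
  qed measurable
  have "integrable (L \<Otimes>\<^sub>M Q) (\<lambda>x. G (fst x) * h (fst x) (snd x))"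
  proof (rule Bochner_Integration.integrable_bound[OF Gfst])
    show "(\<lambda>x. G (fst x) * h (fst x) (snd x)) \<in> borel_measurable (L \<Otimes>\<^sub>M Q)"
      by (intro borel_measurable_times h) measurable
    show "AE x in L \<Otimes>\<^sub>M Q. norm (G (fst x) * h (fst x) (snd x)) \<le> norm (G (fst x))"
      using bound by (intro AE_I2) (simp add: norm_mult mult_left_le)
  qed
  hence "(LINT q|Q. LINT p|L. G p * h p q) = (LINT p|L. LINT q|Q. G p * h p q)"
    by (intro Fubini_integral) (simp add: split_beta')
  thus ?thesis by simp
qed

lemma norm_integral_prob_le_1:
  fixes h :: "'a \<Rightarrow> complex"
  assumes "prob_space Q" "\<And>q. norm (h q) \<le> 1"
  shows "norm (LINT q|Q. h q) \<le> 1"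
proof -
  interpret Q: prob_space Q by fact
  have "norm (LINT q|Q. h q) \<le> (LINT q|Q. norm (h q))" by (rule integral_norm_bound)
  also have "\<dots> \<le> (LINT q|Q. 1)" using assms(2) by (intro integral_mono') auto
  finally show ?thesis by (simp add: Q.prob_space)
qed

lemma inverse_Fourier_of_measurable:
  fixes f :: "'v::euclidean_space \<Rightarrow> real"
  assumes f: "inverse_Fourier_of g f" and [measurable]: "g \<in> borel_measurable borel"
  shows "f \<in> borel_measurable borel"
proof -
  have "(\<lambda>(x, p). g p * iexp (p \<bullet> x)) \<in> borel_measurable (borel \<Otimes>\<^sub>M lborel)" by measurable
  from measurable_compose[OF lborel.borel_measurable_lebesgue_integral[OF this] borel_measurable_Re]
  have "(\<lambda>x. Re (LINT p|lborel. g p * iexp (p \<bullet> x))) \<in> borel_measurable borel" .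
  moreover have "(\<lambda>x. Re (LINT p|lborel. g p * iexp (p \<bullet> x))) = f"
    by (simp flip: f[unfolded inverse_Fourier_of_def, rule_format])
  ultimately show ?thesis by simp
qed

text \<open>A deterministic identity for one pair of paths: once the frequency integral is
  outermost, the exponential of the difference splits and the two time integrals separate.\<close>

lemma double_time_integral_Fourier:
  fixes f :: "'v::euclidean_space \<Rightarrow> real" and x y :: "real \<Rightarrow> 'v"
  assumes g: "rapidly_decreasing g" and f: "inverse_Fourier_of g f"
    and [measurable]: "x \<in> borel_measurable borel" "y \<in> borel_measurable borel"
  shows "complex_of_real (LINT s:{0..1}|lborel. LINT r:{0..1}|lborel. f (x s - y r))
     = (LINT p|lborel. g p * ((LINT s|unit_lborel. iexp (p \<bullet> x s)) * (LINT r|unit_lborel. iexp (- (p \<bullet> y r)))))"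
proof -
  interpret U: prob_space unit_lborel by (rule prob_space_unit_lborel)
  have [measurable]: "g \<in> borel_measurable borel" using g by (simp add: rapidly_decreasing_def)
  note [measurable] = inverse_Fourier_of_measurable[OF f]
  have unit: "(LINT s:{0..1}|lborel. u s) = (LINT s|unit_lborel. u s)" if "u \<in> borel_measurable borel" for u :: "real \<Rightarrow> real"
    unfolding set_lebesgue_integral_def unit_lborel_def using that by (subst integral_density) auto
  have "(LINT s:{0..1}|lborel. LINT r:{0..1}|lborel. f (x s - y r)) = (LINT s:{0..1}|lborel. LINT r|unit_lborel. f (x s - y r))"
    by (simp add: unit)
  also have "\<dots> = (LINT s|unit_lborel. LINT r|unit_lborel. f (x s - y r))"
    by (rule unit) measurable
  finally have "complex_of_real (LINT s:{0..1}|lborel. LINT r:{0..1}|lborel. f (x s - y r))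
     = (LINT s|unit_lborel. LINT r|unit_lborel. complex_of_real (f (x s - y r)))"
    by simp
  also have "\<dots> = (LINT s|unit_lborel. LINT r|unit_lborel. LINT p|lborel. g p * iexp (p \<bullet> (x s - y r)))"
    using f by (simp add: inverse_Fourier_of_def)
  also have "\<dots> = (LINT s|unit_lborel. LINT p|lborel. g p * (LINT r|unit_lborel. iexp (p \<bullet> (x s - y r))))"
    by (intro Bochner_Integration.integral_cong refl Fubini_prob_bounded prob_space_unit_lborel lborel.sigma_finite_measure_axioms
          rapidly_decreasing_integrable[OF g]) auto
  also have "\<dots> = (LINT s|unit_lborel. LINT p|lborel. g p * (iexp (p \<bullet> x s) * (LINT r|unit_lborel. iexp (- (p \<bullet> y r)))))"
  proof -
    have "(LINT r|unit_lborel. iexp (p \<bullet> (x s - y r))) = iexp (p \<bullet> x s) * (LINT r|unit_lborel. iexp (- (p \<bullet> y r)))" for p s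
      by (subst integral_mult_right_zero[symmetric], intro Bochner_Integration.integral_cong refl)
         (simp add: exp_add[symmetric] inner_diff_right algebra_simps)
    thus ?thesis by simp
  qed
  also have "\<dots> = (LINT p|lborel. g p * (LINT s|unit_lborel. iexp (p \<bullet> x s) * (LINT r|unit_lborel. iexp (- (p \<bullet> y r)))))"
  proof (intro Fubini_prob_bounded prob_space_unit_lborel lborel.sigma_finite_measure_axioms rapidly_decreasing_integrable[OF g])
    show "norm (iexp (p \<bullet> x s) * (LINT r|unit_lborel. iexp (- (p \<bullet> y r)))) \<le> 1" for p s
      using norm_integral_prob_le_1[OF prob_space_unit_lborel, of "\<lambda>r. iexp (- (p \<bullet> y r))"] by (simp add: norm_mult)
    show "(\<lambda>z. iexp (fst z \<bullet> x (snd z)) * (LINT r|unit_lborel. iexp (- (fst z \<bullet> y r)))) \<in> borel_measurable (lborel \<Otimes>\<^sub>M unit_lborel)"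
      by measurable
  qed
  finally show ?thesis by simp
qed

lemma prod_time_integral_iexp:
  fixes x :: "real \<Rightarrow> 'v::euclidean_space" and p :: "nat \<Rightarrow> 'v"
  assumes [measurable]: "x \<in> borel_measurable borel"
  shows "(\<Prod>i<N. LINT s|unit_lborel. iexp (p i \<bullet> x s)) =
     (LINT s|PiM {..<N} (\<lambda>_. unit_lborel). iexp (\<Sum>i<N. p i \<bullet> x (s i)))"
proof -
  interpret U: prob_space unit_lborel by (rule prob_space_unit_lborel)
  interpret P: product_sigma_finite "\<lambda>_::nat. unit_lborel" by unfold_locales
  have "(\<Prod>i<N. LINT s|unit_lborel. iexp (p i \<bullet> x s)) = (LINT s|PiM {..<N} (\<lambda>_. unit_lborel). (\<Prod>i<N. iexp (p i \<bullet> x (s i))))"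
    by (rule P.product_integral_prod[symmetric, of "{..<N}" "\<lambda>i s. iexp (p i \<bullet> x s)"]) (auto intro!: U.integrable_const_bound[where B = 1])
  thus ?thesis by (simp add: exp_sum sum_distrib_left)
qed

lemma fbm_time_integral_measurable:
  "fbm_time_integral h N \<in> borel_measurable (PiM {..<N} (\<lambda>_. lborel :: 'v::euclidean_space measure))"
proof -
  interpret P: prob_space "PiM {..<N} (\<lambda>_. unit_lborel)" by (intro prob_space_PiM prob_space_unit_lborel)
  let ?M = "PiM {..<N} (\<lambda>_. lborel :: 'v measure) \<Otimes>\<^sub>M PiM {..<N} (\<lambda>_. unit_lborel)"
  have [measurable]: "(\<lambda>z. fst z i) \<in> borel_measurable ?M" if "i \<in> {..<N}" for i
    by (rule measurable_compose[OF measurable_fst borel_measurable_PiM_component]) (use that in auto)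
  have [measurable]: "(\<lambda>z. snd z i) \<in> borel_measurable ?M" if "i \<in> {..<N}" for i
    by (rule measurable_compose[OF measurable_snd borel_measurable_PiM_component]) (use that in auto)
  have "(\<lambda>z. fbm_form h {..<N} (fst z) (snd z)) \<in> borel_measurable ?M"
    unfolding fbm_form_def fbm_cov_def by measurable
  hence "(\<lambda>(p, s). exp (- fbm_form h {..<N} p s / 2)) \<in> borel_measurable ?M"
    unfolding split_beta' by measurable
  from P.borel_measurable_lebesgue_integral[OF this] show ?thesis
    by (simp add: fbm_time_integral_def[abs_def])
qed

text \<open>Products of time integrals become integrals over two independent vectors of times. With
  the expectation moved innermost, the characteristic function splits into a factor in
  \<open>s\<close> and one in \<open>r\<close>, which yields the square.\<close>

lemma (in prob_space) expectation_prod_time_integrals: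
  fixes X Y :: "real \<Rightarrow> 'a \<Rightarrow> 'v::euclidean_space" and p :: "nat \<Rightarrow> 'v"
  assumes X: "(\<lambda>z. X (fst z) (snd z)) \<in> borel_measurable (borel \<Otimes>\<^sub>M M)"
    and Y: "(\<lambda>z. Y (fst z) (snd z)) \<in> borel_measurable (borel \<Otimes>\<^sub>M M)"
    and paths: "\<And>\<omega>. (\<lambda>t. X t \<omega>) \<in> borel_measurable borel" "\<And>\<omega>. (\<lambda>t. Y t \<omega>) \<in> borel_measurable borel"
    and char: "\<And>s r. (\<And>i. i < N \<Longrightarrow> 0 \<le> s i) \<Longrightarrow> (\<And>i. i < N \<Longrightarrow> 0 \<le> r i) \<Longrightarrow>
      (\<integral>\<omega>. iexp (\<Sum>i<N. p i \<bullet> (X (s i) \<omega> - Y (r i) \<omega>)) \<partial>M) =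
        complex_of_real (exp (- fbm_form H {..<N} p s / 2) * exp (- fbm_form H {..<N} p r / 2))"
  shows "(\<integral>\<omega>. (\<Prod>i<N. (LINT s|unit_lborel. iexp (p i \<bullet> X s \<omega>)) * (LINT r|unit_lborel. iexp (- (p i \<bullet> Y r \<omega>)))) \<partial>M)
     = complex_of_real ((fbm_time_integral H N p)\<^sup>2)"
proof -
  let ?P = "PiM {..<N} (\<lambda>_. unit_lborel)"
  interpret P: prob_space ?P by (intro prob_space_PiM prob_space_unit_lborel)
  define h where "h = (\<lambda>s r \<omega>. iexp (\<Sum>i<N. p i \<bullet> (X (s i) \<omega> - Y (r i) \<omega>)))"
  have h1: "norm (h s r \<omega>) \<le> 1" for s r \<omega> by (simp add: h_def)
  have prod_eq: "(\<Prod>i<N. (LINT s|unit_lborel. iexp (p i \<bullet> X s \<omega>)) * (LINT r|unit_lborel. iexp (- (p i \<bullet> Y r \<omega>))))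
     = (LINT s|?P. LINT r|?P. h s r \<omega>)" for \<omega>
  proof -
    have "(\<Prod>i<N. LINT r|unit_lborel. iexp (- (p i \<bullet> Y r \<omega>))) = (LINT r|?P. iexp (\<Sum>i<N. (- p i) \<bullet> Y (r i) \<omega>))"
      using prod_time_integral_iexp[OF paths(2)[of \<omega>], of "\<lambda>i. - p i"] by simp
    hence "(\<Prod>i<N. (LINT s|unit_lborel. iexp (p i \<bullet> X s \<omega>)) * (LINT r|unit_lborel. iexp (- (p i \<bullet> Y r \<omega>))))
       = (LINT s|?P. iexp (\<Sum>i<N. p i \<bullet> X (s i) \<omega>)) * (LINT r|?P. iexp (\<Sum>i<N. (- p i) \<bullet> Y (r i) \<omega>))"
      by (simp only: prod.distrib prod_time_integral_iexp[OF paths(1)[of \<omega>]])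
    also have "\<dots> = (LINT s|?P. LINT r|?P. iexp (\<Sum>i<N. p i \<bullet> X (s i) \<omega>) * iexp (\<Sum>i<N. (- p i) \<bullet> Y (r i) \<omega>))"
      by (simp only: integral_mult_right_zero integral_mult_left_zero)
    also have "\<dots> = (LINT s|?P. LINT r|?P. h s r \<omega>)"
      unfolding h_def exp_add[symmetric] distrib_left[symmetric] of_real_add[symmetric] sum.distrib[symmetric]
      by (simp add: inner_diff_right)
    finally show ?thesis .
  qed
  let ?Q = "(?P \<Otimes>\<^sub>M M) \<Otimes>\<^sub>M ?P"
  have h_meas: "(\<lambda>z. h (fst (fst z)) (snd z) (snd (fst z))) \<in> borel_measurable ?Q"
  proof -
    have "(\<lambda>z. X (fst (fst z) i) (snd (fst z))) \<in> borel_measurable ?Q" if "i \<in> {..<N}" for i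
    proof -
      have "(\<lambda>z. fst (fst z) i) \<in> borel_measurable ?Q"
        by (rule measurable_compose[OF measurable_compose[OF measurable_fst measurable_fst] borel_measurable_PiM_component])
           (use that in auto)
      hence "(\<lambda>z. (fst (fst z) i, snd (fst z))) \<in> measurable ?Q (borel \<Otimes>\<^sub>M M)" by measurable
      from measurable_compose[OF this X] show ?thesis by simp
    qed
    moreover have "(\<lambda>z. Y (snd z i) (snd (fst z))) \<in> borel_measurable ?Q" if "i \<in> {..<N}" for i
    proof -
      have "(\<lambda>z. snd z i) \<in> borel_measurable ?Q"
        by (rule measurable_compose[OF measurable_snd borel_measurable_PiM_component]) (use that in auto)
      hence "(\<lambda>z. (snd z i, snd (fst z))) \<in> measurable ?Q (borel \<Otimes>\<^sub>M M)" by measurable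
      from measurable_compose[OF this Y] show ?thesis by simp
    qed
    ultimately have "(\<lambda>z. \<Sum>i<N. p i \<bullet> (X (fst (fst z) i) (snd (fst z)) - Y (snd z i) (snd (fst z)))) \<in> borel_measurable ?Q"
      by (intro borel_measurable_sum borel_measurable_inner borel_measurable_diff borel_measurable_const)
    thus ?thesis unfolding h_def by measurable
  qed
  have inner_meas: "(\<lambda>z. LINT r|?P. h (fst z) r (snd z)) \<in> borel_measurable (?P \<Otimes>\<^sub>M M)"
    by (rule P.borel_measurable_lebesgue_integral) (use h_meas in \<open>simp add: split_beta'\<close>)
  have inner_meas': "(\<lambda>z. h s (fst z) (snd z)) \<in> borel_measurable (?P \<Otimes>\<^sub>M M)" if "s \<in> space ?P" for s
  proof -
    have "(\<lambda>z. ((s, snd z), fst z)) \<in> measurable (?P \<Otimes>\<^sub>M M) ?Q"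
      using that by measurable
    from measurable_compose[OF this h_meas] show ?thesis by simp
  qed
  have E_meas: "(\<lambda>z. \<integral>\<omega>. h (fst z) (snd z) \<omega> \<partial>M) \<in> borel_measurable (?P \<Otimes>\<^sub>M ?P)"
  proof (rule borel_measurable_lebesgue_integral)
    have "(\<lambda>y. ((fst (fst y), snd y), snd (fst y))) \<in> measurable ((?P \<Otimes>\<^sub>M ?P) \<Otimes>\<^sub>M M) ?Q"
      by measurable
    from measurable_compose[OF this h_meas] show "(\<lambda>(z, \<omega>). h (fst z) (snd z) \<omega>) \<in> borel_measurable ((?P \<Otimes>\<^sub>M ?P) \<Otimes>\<^sub>M M)"
      by (simp add: split_beta')
  qed
  \<comment> \<open>The factors 1 bring the integrands into the form of
    \<open>Fubini_prob_bounded\<close>, the constant weight being integrable over the times.\<close>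
  have "(\<integral>\<omega>. (\<Prod>i<N. (LINT s|unit_lborel. iexp (p i \<bullet> X s \<omega>)) * (LINT r|unit_lborel. iexp (- (p i \<bullet> Y r \<omega>)))) \<partial>M)
     = (\<integral>\<omega>. (LINT s|?P. 1 * (LINT r|?P. h s r \<omega>)) \<partial>M)"
    by (simp only: prod_eq mult_1_left)
  also have "\<dots> = (LINT s|?P. 1 * (\<integral>\<omega>. (LINT r|?P. h s r \<omega>) \<partial>M))"
    by (rule Fubini_prob_bounded)
       (auto intro: P.sigma_finite_measure_axioms prob_space_axioms inner_meas norm_integral_prob_le_1 P.prob_space_axioms h1)
  also have "\<dots> = (LINT s|?P. LINT r|?P. \<integral>\<omega>. h s r \<omega> \<partial>M)"
  proof (intro Bochner_Integration.integral_cong refl)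
    fix s assume s: "s \<in> space ?P"
    have "(\<integral>\<omega>. (LINT r|?P. 1 * h s r \<omega>) \<partial>M) = (LINT r|?P. 1 * (\<integral>\<omega>. h s r \<omega> \<partial>M))"
      by (rule Fubini_prob_bounded)
         (auto intro: P.sigma_finite_measure_axioms prob_space_axioms inner_meas'[OF s] h1)
    thus "1 * (\<integral>\<omega>. (LINT r|?P. h s r \<omega>) \<partial>M) = (LINT r|?P. \<integral>\<omega>. h s r \<omega> \<partial>M)" by simp
  qed
  also have "\<dots> = (LINT s|?P. LINT r|?P. complex_of_real (exp (- fbm_form H {..<N} p s / 2) * exp (- fbm_form H {..<N} p r / 2)))"
  proof -
    \<comment> \<open>\<open>char\<close> covers nonnegative times only, while the product space
      contains all real ones; the identity holds almost everywhere, for \<open>r\<close> with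
      \<open>s\<close> fixed and then for \<open>s\<close>.\<close>
    have "AE s in ?P. s i \<in> {0..1}" if "i < N" for i
      using AE_unit_lborel that by (intro AE_PiM_component prob_space_unit_lborel) auto
    hence AE: "AE s in ?P. \<forall>i\<in>{..<N}. s i \<in> {0..1}" by (intro AE_finite_allI) auto
    note [measurable] = fbm_form_measurable_PiM E_meas
    have inner: "(LINT r|?P. \<integral>\<omega>. h s r \<omega> \<partial>M) = (LINT r|?P. complex_of_real (exp (- fbm_form H {..<N} p s / 2) * exp (- fbm_form H {..<N} p r / 2)))"
      if s: "s \<in> space ?P" "\<forall>i\<in>{..<N}. s i \<in> {0..1}" for s
    proof (rule integral_cong_AE)
      show "(\<lambda>r. \<integral>\<omega>. h s r \<omega> \<partial>M) \<in> borel_measurable ?P"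
        using measurable_compose[OF measurable_Pair1'[OF s(1), of ?P] E_meas] by simp
      show "AE r in ?P. (\<integral>\<omega>. h s r \<omega> \<partial>M) = complex_of_real (exp (- fbm_form H {..<N} p s / 2) * exp (- fbm_form H {..<N} p r / 2))"
        using AE by eventually_elim (unfold h_def, rule char, use s in auto)
    qed measurable
    show ?thesis
    proof (rule integral_cong_AE)
      show "(\<lambda>s. LINT r|?P. \<integral>\<omega>. h s r \<omega> \<partial>M) \<in> borel_measurable ?P"
        by (rule P.borel_measurable_lebesgue_integral) (use E_meas in \<open>simp add: split_beta'\<close>)
      show "AE s in ?P. (LINT r|?P. \<integral>\<omega>. h s r \<omega> \<partial>M) =
          (LINT r|?P. complex_of_real (exp (- fbm_form H {..<N} p s / 2) * exp (- fbm_form H {..<N} p r / 2)))"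
        using AE AE_space by eventually_elim (rule inner)
    qed (simp only: of_real_mult integral_mult_right_zero, measurable)
  qed
  also have "\<dots> = complex_of_real ((fbm_time_integral H N p)\<^sup>2)"
    by (simp add: fbm_time_integral_def power2_eq_square del: of_real_exp)
  finally show ?thesis .
qed

theorem theorem1p1:
  fixes M :: "'a measure"
    and B B' :: "real \<Rightarrow> 'a \<Rightarrow> real ^ 'n::{finite,linorder}"
    and H :: real
    and k :: "nat ^ 'n::{finite,linorder}"
  assumes "prob_space M"
    and "0 < H" and "H < 1"
    and "fractional_brownian_motion M H B"
    and "fractional_brownian_motion M H B'"
    and "indep_processes M B B'"
    and "2 * real (\<Sum>j\<in>UNIV. k $ j) * H + H * real CARD('n) < 2"
  shows "\<forall>n::real. n \<ge> 1 \<longrightarrow>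
           converges_in_Lp (completion M) n (approx_intersection_deriv k B B') (at_right 0)"
proof (intro allI impI)
  fix n :: real assume n: "n \<ge> 1"
  interpret prob_space M by fact
  define K where "K = (\<Sum>j\<in>UNIV. k $ j)"
  obtain X where X: "\<forall>t. X t \<in> borel_measurable M"
    "\<forall>\<omega>. continuous_on UNIV (\<lambda>t. X t \<omega>)" "AE \<omega> in M. \<forall>t\<ge>0. X t \<omega> = B t \<omega>"
    by (rule fractional_brownian_motion_continuous_version[OF assms(4)]) (rule that)
  obtain Y where Y: "\<forall>t. Y t \<in> borel_measurable M"
    "\<forall>\<omega>. continuous_on UNIV (\<lambda>t. Y t \<omega>)" "AE \<omega> in M. \<forall>t\<ge>0. Y t \<omega> = B' t \<omega>"
    by (rule fractional_brownian_motion_continuous_version[OF assms(5)]) (rule that)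
  note X_joint = continuous_process_jointly_measurable[OF X(1,2)]
  note Y_joint = continuous_process_jointly_measurable[OF Y(1,2)]
  have X_path: "(\<lambda>t. X t \<omega>) \<in> borel_measurable borel" and Y_path: "(\<lambda>t. Y t \<omega>) \<in> borel_measurable borel" for \<omega>
    using X(2) Y(2) by (auto intro: borel_measurable_continuous_onI)
  define \<zeta> where "\<zeta> = (\<lambda>(p :: real ^ 'n::{finite,linorder}) \<omega>.
     (LINT s|unit_lborel. iexp (p \<bullet> X s \<omega>)) * (LINT r|unit_lborel. iexp (- (p \<bullet> Y r \<omega>))))"
  define w0 where "w0 = (\<lambda>p :: real ^ 'n::{finite,linorder}. (\<Prod>j\<in>UNIV. (\<i> * complex_of_real (p $ j)) ^ (k $ j)))"
  define w where "w = (\<lambda>\<epsilon> (p :: real ^ 'n::{finite,linorder}).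
     w0 p * complex_of_real ((1 / (2 * pi) ^ CARD('n)) * exp (- \<epsilon> * (norm p)\<^sup>2 / 2)))"
  have w: "rapidly_decreasing (w \<epsilon>)" "inverse_Fourier_of (w \<epsilon>) (multi_partial_deriv k (heat_kernel \<epsilon>))" if "\<epsilon> > 0" for \<epsilon>
    using inverse_Fourier_of_multi_partial_deriv[OF rapidly_decreasing_Gaussian[OF that] inverse_Fourier_of_heat_kernel[OF that], of k]
    unfolding w_def w0_def by auto
  \<comment> \<open>For the continuous versions the path integrals are jointly measurable and the
    Fourier identity holds at every point of \<open>M\<close>, as the moment criterion
    demands.\<close>
  have "converges_in_Lp M n (approx_intersection_deriv k X Y) (at_right 0)"
  proof (rule converges_in_Lp_of_moments[where \<zeta> = \<zeta> and w = w and v = "\<lambda>p. w0 p * complex_of_real (1 / (2 * pi) ^ CARD('n))"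
        and W = "\<lambda>p. norm p ^ K" and F = "\<lambda>N p. (fbm_time_integral H N p)\<^sup>2"])
    show "(\<lambda>(p, \<omega>). \<zeta> p \<omega>) \<in> borel_measurable (lborel \<Otimes>\<^sub>M M)"
    proof -
      interpret U: prob_space unit_lborel by (rule prob_space_unit_lborel)
      have [measurable]: "(\<lambda>y. Z (snd y) (snd (fst y))) \<in> borel_measurable (((lborel :: (real ^ 'n::{finite,linorder}) measure) \<Otimes>\<^sub>M M) \<Otimes>\<^sub>M unit_lborel)"
        if "(\<lambda>z. Z (fst z) (snd z)) \<in> borel_measurable (borel \<Otimes>\<^sub>M M)" for Z :: "real \<Rightarrow> 'a \<Rightarrow> real ^ 'n::{finite,linorder}"
      proof -
        have "(\<lambda>y. (snd y, snd (fst y))) \<in> measurable (((lborel :: (real ^ 'n::{finite,linorder}) measure) \<Otimes>\<^sub>M M) \<Otimes>\<^sub>M unit_lborel) (borel \<Otimes>\<^sub>M M)" by measurable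
        from measurable_compose[OF this that] show ?thesis by simp
      qed
      note [measurable] = this[OF X_joint] this[OF Y_joint]
      have "(\<lambda>z. LINT s|unit_lborel. iexp (fst z \<bullet> X s (snd z))) \<in> borel_measurable (lborel \<Otimes>\<^sub>M M)"
        by (rule U.borel_measurable_lebesgue_integral) (unfold split_beta', measurable)
      moreover have "(\<lambda>z. LINT r|unit_lborel. iexp (- (fst z \<bullet> Y r (snd z)))) \<in> borel_measurable (lborel \<Otimes>\<^sub>M M)"
        by (rule U.borel_measurable_lebesgue_integral) (unfold split_beta', measurable)
      ultimately show ?thesis unfolding \<zeta>_def split_beta' by (rule borel_measurable_times)
    qed
    show "norm (\<zeta> p \<omega>) \<le> 1" for p \<omega>
      unfolding \<zeta>_def norm_mult
      by (intro mult_le_one norm_integral_prob_le_1 prob_space_unit_lborel) auto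
    show "integrable lborel (w \<epsilon>)" if "\<epsilon> > 0" for \<epsilon>
      by (rule rapidly_decreasing_integrable[OF w(1)[OF that]])
    show "norm (w \<epsilon> p) \<le> norm p ^ K" if "\<epsilon> > 0" for \<epsilon> p
    proof -
      have "norm (w0 p) = (\<Prod>j\<in>UNIV. \<bar>p $ j\<bar> ^ (k $ j))"
        by (simp add: w0_def prod_norm[symmetric] norm_mult norm_power)
      also have "\<dots> \<le> (\<Prod>j\<in>UNIV. norm p ^ (k $ j))"
        by (intro prod_mono) (auto intro!: power_mono component_le_norm_cart)
      also have "\<dots> = norm p ^ K" by (simp add: K_def power_sum)
      finally have 1: "norm (w0 p) \<le> norm p ^ K" .
      \<comment> \<open>Both the normalising constant and the Gaussian factor are at most 1, so the
        majorant can be the bare power of the norm, uniformly in \<epsilon>.\<close>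
      have "1 \<le> (2 * pi) ^ CARD('n)" using pi_gt3 by (intro one_le_power) simp
      hence "1 / (2 * pi) ^ CARD('n) \<le> 1" by simp
      moreover have "exp (- \<epsilon> * (norm p)\<^sup>2 / 2) \<le> 1" using that by simp
      ultimately have "(1 / (2 * pi) ^ CARD('n)) * exp (- \<epsilon> * (norm p)\<^sup>2 / 2) \<le> 1"
        by (intro mult_le_one) auto
      hence "norm (w0 p) * \<bar>(1 / (2 * pi) ^ CARD('n)) * exp (- \<epsilon> * (norm p)\<^sup>2 / 2)\<bar> \<le> norm p ^ K * 1"
        by (intro mult_mono 1) auto
      thus ?thesis by (simp only: w_def norm_mult norm_of_real mult_1_right)
    qed
    show "((\<lambda>\<epsilon>. w \<epsilon> p) \<longlongrightarrow> w0 p * complex_of_real (1 / (2 * pi) ^ CARD('n))) (at_right 0)" for p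
    proof -
      have "((\<lambda>\<epsilon>. w \<epsilon> p) \<longlongrightarrow> w0 p * complex_of_real ((1 / (2 * pi) ^ CARD('n)) * exp (- 0 * (norm p)\<^sup>2 / 2))) (at_right 0)"
        unfolding w_def by (intro tendsto_intros) auto
      thus ?thesis by simp
    qed
    show "(\<lambda>p :: real ^ 'n::{finite,linorder}. norm p ^ K) \<in> borel_measurable borel" by measurable
    show "0 \<le> (fbm_time_integral H N p)\<^sup>2" for N and p :: "nat \<Rightarrow> real ^ 'n::{finite,linorder}" by simp
    show "(\<integral>\<omega>. (\<Prod>i<N. \<zeta> (p i) \<omega>) \<partial>M) = complex_of_real ((fbm_time_integral H N p)\<^sup>2)" for N p
      unfolding \<zeta>_def
    proof (rule expectation_prod_time_integrals[OF X_joint Y_joint X_path Y_path])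
      fix s r :: "nat \<Rightarrow> real" assume s: "\<And>i. i < N \<Longrightarrow> 0 \<le> s i" and r: "\<And>i. i < N \<Longrightarrow> 0 \<le> r i"
      note [measurable] = X(1)[rule_format] Y(1)[rule_format]
      have [measurable]: "B (s i) \<in> borel_measurable M" "B' (r i) \<in> borel_measurable M" if "i \<in> {..<N}" for i
        using that s r by (auto intro: fractional_brownian_motion_measurable[OF assms(4)] fractional_brownian_motion_measurable[OF assms(5)])
      have "(\<integral>\<omega>. iexp (\<Sum>i<N. p i \<bullet> (X (s i) \<omega> - Y (r i) \<omega>)) \<partial>M) = (\<integral>\<omega>. iexp (\<Sum>i<N. p i \<bullet> (B (s i) \<omega> - B' (r i) \<omega>)) \<partial>M)"
      proof (rule integral_cong_AE)
        show "AE \<omega> in M. iexp (\<Sum>i<N. p i \<bullet> (X (s i) \<omega> - Y (r i) \<omega>)) = iexp (\<Sum>i<N. p i \<bullet> (B (s i) \<omega> - B' (r i) \<omega>))"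
          using X(3) Y(3) by eventually_elim (use s r in simp)
      qed measurable
      also have "\<dots> = complex_of_real (exp (- fbm_form H {..<N} p s / 2) * exp (- fbm_form H {..<N} p r / 2))"
        by (rule indep_fractional_brownian_motion_char[OF assms(4-6) s r])
      finally show "(\<integral>\<omega>. iexp (\<Sum>i<N. p i \<bullet> (X (s i) \<omega> - Y (r i) \<omega>)) \<partial>M) =
        complex_of_real (exp (- fbm_form H {..<N} p s / 2) * exp (- fbm_form H {..<N} p r / 2))" .
    qed
    show "(\<lambda>p. (fbm_time_integral H N p)\<^sup>2) \<in> borel_measurable (PiM {..<N} (\<lambda>_. lborel :: (real ^ 'n::{finite,linorder}) measure))" for N
      by (intro borel_measurable_power fbm_time_integral_measurable)
    show "(\<integral>\<^sup>+p. ennreal ((\<Prod>i<N. norm (p i) ^ K) * (fbm_time_integral H N p)\<^sup>2)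
        \<partial>PiM {..<N} (\<lambda>_. lborel :: (real ^ 'n::{finite,linorder}) measure)) < \<infinity>" for N
      by (rule nn_integral_moment_bound) (use assms in \<open>simp_all add: K_def\<close>)
    show "complex_of_real (approx_intersection_deriv k X Y \<epsilon> \<omega>) = (LINT p|lborel. w \<epsilon> p * \<zeta> p \<omega>)"
      if "\<epsilon> > 0" "\<omega> \<in> space M" for \<epsilon> \<omega>
      unfolding approx_intersection_deriv_def \<zeta>_def
      by (rule double_time_integral_Fourier[OF w[OF that(1)] X_path Y_path])
    show "n \<ge> 1" by (rule n)
  qed
  \<comment> \<open>The versions agree with the processes at all nonnegative times outside one null
    set, so the approximations coincide there for every \<epsilon>.\<close>
  moreover have "AE \<omega> in M. approx_intersection_deriv k B B' \<epsilon> \<omega> = approx_intersection_deriv k X Y \<epsilon> \<omega>" for \<epsilon>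
    using X(3) Y(3)
  proof eventually_elim
    case (elim \<omega>)
    thus ?case unfolding approx_intersection_deriv_def
      by (intro set_lebesgue_integral_cong allI impI) auto
  qed
  ultimately show "converges_in_Lp (completion M) n (approx_intersection_deriv k B B') (at_right 0)"
    by (rule converges_in_Lp_completion)
qed

end
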